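(* Let $\Delta$ be an integer and let $\mathcal{G}$ be a class of graphs each of maximum degree at most $\Delta$. The following are equivalent: (1) there is a constant $c_1$ such that $\mathrm{cr}(G)\leq c_1|V(G)|$ for every $G\in\mathcal{G}$; (2) there is a constant $c_2$ such that every $G\in\mathcal{G}$ has a planar decomposition of width at most $c_2$ and order at most $|V(G)|$; (3) there is a constant $c_3$ such that every $G\in\mathcal{G}$ has a planar decomposition of width at most $2$ and order at most $c_3|V(G)|$.
   Context: All graphs are finite, simple and undirected. A drawing represents vertices by distinct points and edges by simple curves between their endpoints, meeting no other vertex, with no three edges through a common non-endpoint point; a crossing is an intersection of two edges other than a common endpoint; $\mathrm{cr}(G)$ is the minimum number of crossings in a drawing of $G$. A decomposition of a graph $G$ is a graph $D$ whose vertices (called bags) are subsets of $V(G)$ (distinct vertices of $D$ may be equal as sets), such that for each vertex $v$ of $G$ the subgraph $D(v)$ of $D$ induced by the bags containing $v$ is nonempty and connected, and for each edge $vw$ of $G$ the subgraphs $D(v)$ and $D(w)$ touch (they share a bag, or some bag containing $v$ is adjacent in $D$ to some bag containing $w$). The width of $D$ is the maximum cardinality of a bag, its order is $|V(D)|$, and $D$ is planar if the graph $D$ is planar. *)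

theory Defs
  imports "HOL-Analysis.Analysis" "Graph_Theory.Digraph_Component"
begin

(* A finite simple undirected graph is a pair_graph, i.e. a finite symmetric loopless digraph in
   which the undirected edge vw is given by the two arcs (v, w) and (w, v). *)

definition edges :: "'a pair_pre_digraph \<Rightarrow> 'a set set" where
  "edges G = (\<lambda>(v, w). {v, w}) ` parcs G"

(* The supremum of the empty set of naturals is 0, so the null graph has maximum degree 0. *)
definition max_degree :: "'a pair_pre_digraph \<Rightarrow> nat" where
  "max_degree G = (SUP v\<in>pverts G. out_degree (with_proj G) v)"


record 'a drawing =
  vertex_point :: "'a \<Rightarrow> complex"
  edge_curve :: "'a set \<Rightarrow> real \<Rightarrow> complex"

abbreviation edge_image :: "'a drawing \<Rightarrow> 'a set \<Rightarrow> complex set" where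
  "edge_image d e \<equiv> path_image (edge_curve d e)"

(* Since curves meet no vertices other than their own ends, a point that lies on a drawn edge and
   is not the point of a vertex is exactly a non-endpoint point. *)
definition is_drawing :: "'a pair_pre_digraph \<Rightarrow> 'a drawing \<Rightarrow> bool" where
  "is_drawing G d \<longleftrightarrow>
     inj_on (vertex_point d) (pverts G) \<and>
     (\<forall>e\<in>edges G.
        arc (edge_curve d e) \<and>
        {pathstart (edge_curve d e), pathfinish (edge_curve d e)} = vertex_point d ` e \<and>
        (\<forall>v\<in>pverts G - e. vertex_point d v \<notin> edge_image d e)) \<and>
     (\<forall>e\<in>edges G. \<forall>f\<in>edges G. \<forall>g\<in>edges G. e \<noteq> f \<longrightarrow> e \<noteq> g \<longrightarrow> f \<noteq> g \<longrightarrow>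
        edge_image d e \<inter> edge_image d f \<inter> edge_image d g \<subseteq> vertex_point d ` pverts G)"

(* In a drawing each of these points lies on exactly two edges, so counting points is the same as
   counting (pair of edges, intersection point). *)
definition crossings :: "'a pair_pre_digraph \<Rightarrow> 'a drawing \<Rightarrow> complex set" where
  "crossings G d = {p. \<exists>e\<in>edges G. \<exists>f\<in>edges G. e \<noteq> f \<and>
     p \<in> edge_image d e \<inter> edge_image d f \<and> p \<notin> vertex_point d ` (e \<inter> f)}"

(* A drawing may have infinitely many crossings; card would count those as 0. *)
definition num_crossings :: "'a pair_pre_digraph \<Rightarrow> 'a drawing \<Rightarrow> enat" where
  "num_crossings G d = (if finite (crossings G d) then enat (card (crossings G d)) else \<infinity>)"

(* enat is well-ordered, so the infimum is a minimum. *)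
definition crossing_number :: "'a pair_pre_digraph \<Rightarrow> enat" where
  "crossing_number G = (INF d\<in>{d. is_drawing G d}. num_crossings G d)"

definition planar :: "'a pair_pre_digraph \<Rightarrow> bool" where
  "planar G \<longleftrightarrow> (\<exists>d. is_drawing G d \<and> crossings G d = {})"


(* A decomposition of G is a graph D together with a map sending each vertex x of D to the set
   bag x of vertices of G; distinct vertices of D may thus carry equal bags. *)

definition bags_containing :: "'b pair_pre_digraph \<Rightarrow> ('b \<Rightarrow> 'a set) \<Rightarrow> 'a \<Rightarrow> 'b set" where
  "bags_containing D bag v = {x \<in> pverts D. v \<in> bag x}"

definition touch :: "'b pair_pre_digraph \<Rightarrow> 'b set \<Rightarrow> 'b set \<Rightarrow> bool" where
  "touch D X Y \<longleftrightarrow> X \<inter> Y \<noteq> {} \<or> (\<exists>x\<in>X. \<exists>y\<in>Y. (x, y) \<in> parcs D)"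

definition decomposition ::
  "'a pair_pre_digraph \<Rightarrow> 'b pair_pre_digraph \<Rightarrow> ('b \<Rightarrow> 'a set) \<Rightarrow> bool" where
  "decomposition G D bag \<longleftrightarrow>
     pair_graph D \<and>
     (\<forall>x\<in>pverts D. bag x \<subseteq> pverts G) \<and>
     (\<forall>v\<in>pverts G. bags_containing D bag v \<noteq> {} \<and>
        Digraph_Component.connected (with_proj D \<restriction> bags_containing D bag v)) \<and>
     (\<forall>(v, w)\<in>parcs G. touch D (bags_containing D bag v) (bags_containing D bag w))"

(* The width of a decomposition with no bags is 0. *)
definition decomp_width :: "'b pair_pre_digraph \<Rightarrow> ('b \<Rightarrow> 'a set) \<Rightarrow> nat" where
  "decomp_width D bag = (SUP x\<in>pverts D. card (bag x))"

definition decomp_order :: "'b pair_pre_digraph \<Rightarrow> nat" where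
  "decomp_order D = card (pverts D)"

end

theory Submission
  imports Defs
begin

text \<open>A drawing of G with few crossings becomes a planar graph H by turning crossings into vertices.
  Orient every edge of G and give the crossing of two edges the bag consisting of their two tails:
  this is a planar decomposition of width 2 and order n + cr(G), so (1) implies (3). Since G has
  bounded degree, so has H; hence H splits into at most n parts of bounded size, each connected or a
  union of components, and contracting the parts gives (2).

  Conversely, let D be a planar decomposition of width at most k and order O(n). Draw each edge vw of
  G as a polygonal curve that follows, within a thin neighbourhood of a polygonal drawing of D, a path
  of D inside D(v) and D(w). Along an edge of D the curves run parallel without crossing, so crossings
  only occur near the vertices of D. At most k times the maximum degree of G curves come near each
  vertex, so there are O(n) crossings.

  Both directions need a planar drawing by arbitrary arcs to be replaced by a polygonal one, in which
  straight edges can be contracted by coning and edges can be replaced by parallel copies.\<close>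

section \<open>Connected vertex sets\<close>

text \<open>Two obstacles shape the constructions. A contraction by coning needs the contracted edge
  to be a segment, but it may leave bent edges behind at the merged vertex. A connected set of
  vertices must therefore be contracted in an order in which the edges still to be used have not
  been touched, which is why each step removes a vertex whose loss keeps the rest connected by
  straight edges. In the converse direction the curves need two displacements of different sizes.
  The larger one moves every bend along a normal by a multiple that differs from edge to edge of G
  and so separates curves that share an edge of D. The smaller one puts all points into general
  position, so that segments without a common end meet at most once and no three concur; as
  disjointness of segments is an open condition, it does not undo the first. The order in (2) must
  be at most n and not merely O(n). All parts but one are made so large that there are at most n/2
  of them, and the exceptional part pools small components, of which there may be many.\<close>

lemma pair_graph_iff:
  "pair_graph G \<longleftrightarrow> finite (pverts G) \<and> parcs G \<subseteq> pverts G \<times> pverts G \<and> sym (parcs G) \<and>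
     (\<forall>a b. (a, b) \<in> parcs G \<longrightarrow> a \<noteq> b)" (is "_ \<longleftrightarrow> ?R")
proof
  assume "pair_graph G"
  then interpret pair_graph G .
  show ?R
    using pair_finite_verts in_arcsD1 in_arcsD2 arcs_symmetric no_loops by (force simp: sym_def)
next
  assume R: ?R
  then have "finite (parcs G)" by (meson finite_SigmaI finite_subset)
  with R show "pair_graph G"
    by unfold_locales (auto simp: symmetric_def dest: symD split: prod.splits)
qed

text \<open>Connectedness with respect to a relation instead of a graph, so that the same facts
  serve all arcs of a graph and its straight arcs alone.\<close>

definition conn :: "'a rel \<Rightarrow> 'a set \<Rightarrow> bool" where
  "conn E S \<longleftrightarrow> S \<noteq> {} \<and> (\<forall>u\<in>S. \<forall>v\<in>S. (u, v) \<in> (E \<inter> S \<times> S)\<^sup>*)"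

lemma rtrancl_on_eq: "a \<in> S \<Longrightarrow> (a, b) \<in> rtrancl_on S E \<longleftrightarrow> (a, b) \<in> (E \<inter> S \<times> S)\<^sup>*"
proof
  assume a: "a \<in> S"
  assume "(a, b) \<in> rtrancl_on S E"
  then show "(a, b) \<in> (E \<inter> S \<times> S)\<^sup>*"
    by (induction rule: rtrancl_on_induct) (auto intro: rtrancl_into_rtrancl)
next
  assume a: "a \<in> S"
  assume "(a, b) \<in> (E \<inter> S \<times> S)\<^sup>*"
  then show "(a, b) \<in> rtrancl_on S E"
    using a by induction (auto intro: rtrancl_on_into_rtrancl_on)
qed

lemma connected_restrict_iff:
  assumes "sym (parcs D)"
  shows "Digraph_Component.connected (with_proj D \<restriction> S) \<longleftrightarrow> conn (parcs D) S"
proof -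
  have "parcs (mk_symmetric (with_proj D \<restriction> S)) = parcs D \<inter> S \<times> S"
    using assms by (auto simp: parcs_mk_symmetric sym_def)
  then show ?thesis
    by (auto simp: Digraph_Component.connected_def strongly_connected_def conn_def reachable_def
        rtrancl_on_eq)
qed

lemma decomposition_iff:
  assumes "sym (parcs D)"
  shows "decomposition G D bag \<longleftrightarrow> pair_graph D \<and> (\<forall>x\<in>pverts D. bag x \<subseteq> pverts G) \<and>
    (\<forall>v\<in>pverts G. conn (parcs D) (bags_containing D bag v)) \<and>
    (\<forall>(v, w)\<in>parcs G. touch D (bags_containing D bag v) (bags_containing D bag w))"
  unfolding decomposition_def connected_restrict_iff[OF assms] by (auto simp: conn_def)

lemma conn_singleton [simp]: "conn E {x}"
  by (simp add: conn_def)

lemma connD: "conn E S \<Longrightarrow> u \<in> S \<Longrightarrow> v \<in> S \<Longrightarrow> (u, v) \<in> (E \<inter> S \<times> S)\<^sup>*"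
  by (simp add: conn_def)

lemma conn_nonempty: "conn E S \<Longrightarrow> S \<noteq> {}"
  by (simp add: conn_def)

lemma conn_mono: "conn E S \<Longrightarrow> E \<inter> S \<times> S \<subseteq> F \<Longrightarrow> conn F S"
proof -
  assume "E \<inter> S \<times> S \<subseteq> F" "conn E S"
  then have "(E \<inter> S \<times> S)\<^sup>* \<subseteq> (F \<inter> S \<times> S)\<^sup>*" by (intro rtrancl_mono) auto
  with \<open>conn E S\<close> show ?thesis by (auto simp: conn_def)
qed

lemma conn_via_root:
  assumes "sym E" "r \<in> S" and "\<And>u. u \<in> S \<Longrightarrow> (r, u) \<in> (E \<inter> S \<times> S)\<^sup>*"
  shows "conn E S"
proof -
  have "sym (E \<inter> S \<times> S)" using assms(1) by (auto simp: sym_def)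
  then have "sym ((E \<inter> S \<times> S)\<^sup>*)" by (rule sym_rtrancl)
  then show ?thesis unfolding conn_def
    using assms by (meson emptyE rtrancl_trans symD)
qed

lemma conn_rtrancl_mono: "(u, v) \<in> (E \<inter> S \<times> S)\<^sup>* \<Longrightarrow> S \<subseteq> T \<Longrightarrow> (u, v) \<in> (E \<inter> T \<times> T)\<^sup>*"
  by (meson Int_mono Sigma_mono in_mono order_refl rtrancl_mono)

lemma conn_Un:
  assumes "sym E" "conn E S" "conn E T" "s \<in> S" "t \<in> T" "s = t \<or> (s, t) \<in> E"
  shows "conn E (S \<union> T)"
proof (rule conn_via_root[OF assms(1), of s])
  fix u assume "u \<in> S \<union> T"
  moreover have "(s, u) \<in> (E \<inter> (S \<union> T) \<times> (S \<union> T))\<^sup>*" if "u \<in> S"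
    using connD[OF assms(2,4) that] by (rule conn_rtrancl_mono) auto
  moreover have "(s, u) \<in> (E \<inter> (S \<union> T) \<times> (S \<union> T))\<^sup>*" if "u \<in> T"
  proof -
    have "(t, u) \<in> (E \<inter> (S \<union> T) \<times> (S \<union> T))\<^sup>*"
      using connD[OF assms(3,5) that] by (rule conn_rtrancl_mono) auto
    moreover have "s = t \<or> (s, t) \<in> E \<inter> (S \<union> T) \<times> (S \<union> T)" using assms by auto
    ultimately show ?thesis by (metis converse_rtrancl_into_rtrancl)
  qed
  ultimately show "(s, u) \<in> (E \<inter> (S \<union> T) \<times> (S \<union> T))\<^sup>*" by blast
qed (use assms in auto)

lemma conn_UNION:
  assumes "sym E" "conn E S" and "\<And>i. i \<in> I \<Longrightarrow> conn E (T i) \<and> S \<inter> T i \<noteq> {}"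
  shows "conn E (S \<union> (\<Union>i\<in>I. T i))"
proof -
  obtain r where r: "r \<in> S" using conn_nonempty[OF assms(2)] by auto
  show ?thesis
  proof (rule conn_via_root[OF assms(1), of r])
    fix u assume u: "u \<in> S \<union> (\<Union>i\<in>I. T i)"
    let ?X = "S \<union> (\<Union>i\<in>I. T i)"
    have S: "(r, u) \<in> (E \<inter> ?X \<times> ?X)\<^sup>*" if "u \<in> S" for u
      using connD[OF assms(2) r that] by (rule conn_rtrancl_mono) auto
    show "(r, u) \<in> (E \<inter> ?X \<times> ?X)\<^sup>*"
    proof (cases "u \<in> S")
      case False
      then obtain i where i: "i \<in> I" "u \<in> T i" using u by auto
      then obtain s where s: "s \<in> S" "s \<in> T i" using assms(3) by blast
      have "(s, u) \<in> (E \<inter> ?X \<times> ?X)\<^sup>*"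
        using connD[of E "T i" s u] assms(3) i s by (intro conn_rtrancl_mono[of _ _ _ "T i" ?X]) auto
      with S[OF s(1)] show ?thesis by (rule rtrancl_trans)
    qed (use S in auto)
  qed (use r in auto)
qed

lemma conn_image:
  assumes "conn E S" and "\<And>a b. a \<in> S \<Longrightarrow> b \<in> S \<Longrightarrow> (a, b) \<in> E \<Longrightarrow> f a = f b \<or> (f a, f b) \<in> F"
  shows "conn F (f ` S)"
proof -
  have "(f u, f v) \<in> (F \<inter> (f ` S) \<times> (f ` S))\<^sup>*" if "(u, v) \<in> (E \<inter> S \<times> S)\<^sup>*" for u v
    using that
  proof induction
    case (step y z)
    then have "f y = f z \<or> (f y, f z) \<in> F \<inter> (f ` S) \<times> (f ` S)" using assms(2)[of y z] by auto
    with step show ?case by (metis rtrancl.rtrancl_into_rtrancl)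
  qed simp
  then show ?thesis using assms(1) by (auto simp: conn_def)
qed

lemma conn_crossing_arc:
  assumes "conn E S" "T \<subseteq> S" "T \<noteq> {}" "T \<noteq> S"
  obtains u w where "u \<in> T" "w \<in> S - T" "(u, w) \<in> E"
proof -
  obtain a b where ab: "a \<in> T" "b \<in> S - T" using assms by blast
  have "b \<in> T \<or> (\<exists>u w. u \<in> T \<and> w \<in> S - T \<and> (u, w) \<in> E)" if "(a, b) \<in> (E \<inter> S \<times> S)\<^sup>*" for b
    using that by induction (use ab in auto)
  with connD[OF assms(1), of a b] ab assms(2) that show ?thesis by blast
qed

text \<open>A largest connected proper subset misses only one vertex, because adding the end of an
  arc that leaves it must give all of \<open>S\<close>. The missed vertex \<open>q\<close> is the
  one that \<open>pdraw_quotient\<close> contracts into its neighbour \<open>p\<close>.\<close>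

lemma conn_remove_vertex:
  assumes "conn E S" "finite S" "sym E" "card S \<ge> 2"
  obtains p q where "p \<in> S" "q \<in> S" "p \<noteq> q" "(p, q) \<in> E" "conn E (S - {q})"
proof -
  let ?P = "\<lambda>T. conn E T \<and> T \<subset> S"
  obtain a where a: "a \<in> S" using conn_nonempty[OF assms(1)] by auto
  have "{a} \<noteq> S" using assms(4) by auto
  then have "?P {a}" using a by auto
  moreover have "\<forall>T. ?P T \<longrightarrow> card T < card S + 1"
    using assms(2) by (simp add: less_SucI psubset_card_mono)
  ultimately obtain T where T: "?P T" and max: "\<And>T'. ?P T' \<Longrightarrow> card T' \<le> card T"
    using ex_has_greatest_nat[of ?P "{a}" card "card S + 1"] by blast
  then obtain u w where uw: "u \<in> T" "w \<in> S - T" "(u, w) \<in> E"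
    using conn_crossing_arc[OF assms(1), of T] conn_nonempty[of E T] by blast
  have "conn E (T \<union> {w})" using assms(3) T uw by (intro conn_Un[of E T "{w}" u w]) auto
  moreover have "card (T \<union> {w}) = card T + 1"
    using T uw assms(2) by (subst card_Un_disjoint) (auto intro: finite_subset)
  ultimately have "\<not> T \<union> {w} \<subset> S" using max[of "T \<union> {w}"] by auto
  then have "S - {w} = T" using T uw by auto
  then show ?thesis using that[of u w] T uw by auto
qed

text \<open>When a step returns to a vertex already listed, the list is cut back to that earlier
  visit; otherwise the vertex is appended.\<close>

lemma rtrancl_simple_path:
  assumes "(u, v) \<in> R\<^sup>*"
  obtains xs where "xs \<noteq> []" "hd xs = u" "last xs = v" "distinct xs"
    "\<And>i. Suc i < length xs \<Longrightarrow> (xs ! i, xs ! Suc i) \<in> R"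
proof -
  have "\<exists>xs. xs \<noteq> [] \<and> hd xs = u \<and> last xs = v \<and> distinct xs \<and>
      (\<forall>i. Suc i < length xs \<longrightarrow> (xs ! i, xs ! Suc i) \<in> R)"
    using assms
  proof induction
    case base
    show ?case by (rule exI[of _ "[u]"]) auto
  next
    case (step y z)
    then obtain xs where xs: "xs \<noteq> []" "hd xs = u" "last xs = y" "distinct xs"
      "\<And>i. Suc i < length xs \<Longrightarrow> (xs ! i, xs ! Suc i) \<in> R" by blast
    show ?case
    proof (cases "z \<in> set xs")
      case True
      then obtain k where k: "k < length xs" "xs ! k = z" by (auto simp: in_set_conv_nth)
      have "take (Suc k) xs \<noteq> []" "hd (take (Suc k) xs) = u" "distinct (take (Suc k) xs)"
        using xs by auto
      moreover have "last (take (Suc k) xs) = z" using k by (simp add: take_Suc_conv_app_nth)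
      moreover have "\<forall>i. Suc i < length (take (Suc k) xs) \<longrightarrow> (take (Suc k) xs ! i, take (Suc k) xs ! Suc i) \<in> R"
        using xs(5) by simp
      ultimately show ?thesis by blast
    next
      case False
      have "((xs @ [z]) ! i, (xs @ [z]) ! Suc i) \<in> R" if "Suc i < length (xs @ [z])" for i
      proof (cases "Suc i < length xs")
        case True
        then show ?thesis using xs(5)[of i] by (simp add: nth_append)
      next
        case False
        then have i: "Suc i = length xs" using that by auto
        then have "i = length xs - 1" by simp
        then have "xs ! i = y" using xs(1,3) by (simp add: last_conv_nth)
        then show ?thesis using step(2) i by (simp add: nth_append flip: i)
      qed
      then show ?thesis using xs False by (intro exI[of _ "xs @ [z]"]) auto
    qed
  qed
  then show ?thesis using that by blast
qed

lemma edges_iff: "sym (parcs G) \<Longrightarrow> {v, w} \<in> edges G \<longleftrightarrow> (v, w) \<in> parcs G"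
  by (auto simp: edges_def doubleton_eq_iff sym_def)

lemma edgesE:
  assumes "e \<in> edges G" obtains v w where "e = {v, w}" "(v, w) \<in> parcs G"
  using assms by (auto simp: edges_def)

section \<open>Polygonal drawings and contraction of straight edges\<close>

text \<open>A simple polygonal line given by its point set instead of a parametrization: contraction
  replaces a piece at one end, and point sets can be glued without reparametrizing.\<close>

inductive pline :: "complex \<Rightarrow> complex \<Rightarrow> complex set \<Rightarrow> bool" where
  segment: "a \<noteq> b \<Longrightarrow> pline a b (closed_segment a b)"
| step: "a \<noteq> c \<Longrightarrow> pline c b R \<Longrightarrow> closed_segment a c \<inter> R = {c} \<Longrightarrow>
    pline a b (closed_segment a c \<union> R)"

lemma pline_ends: "pline a b P \<Longrightarrow> a \<in> P \<and> b \<in> P \<and> a \<noteq> b"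
  by (induction rule: pline.induct) auto

lemma pline_compact: "pline a b P \<Longrightarrow> compact P"
  by (induction rule: pline.induct) (auto simp: compact_Un)

lemma pline_arc:
  "pline a b P \<Longrightarrow> \<exists>\<gamma>. arc \<gamma> \<and> pathstart \<gamma> = a \<and> pathfinish \<gamma> = b \<and> path_image \<gamma> = P"
proof (induction rule: pline.induct)
  case (segment a b)
  then show ?case by (intro exI[of _ "linepath a b"]) auto
next
  case (step a c b R)
  then obtain \<gamma> where \<gamma>: "arc \<gamma>" "pathstart \<gamma> = c" "pathfinish \<gamma> = b" "path_image \<gamma> = R" by blast
  then show ?case using step
    by (intro exI[of _ "linepath a c +++ \<gamma>"]) (auto simp: path_image_join intro!: arc_join)
qed

lemma pline_snoc:
  "pline a b P \<Longrightarrow> b \<noteq> c \<Longrightarrow> P \<inter> closed_segment b c = {b} \<Longrightarrow> pline a c (P \<union> closed_segment b c)"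
proof (induction rule: pline.induct)
  case (segment a b)
  then show ?case using pline.step[OF _ pline.segment[of b c]] by blast
next
  case (step a d b R)
  have *: "R \<inter> closed_segment b c = {b}" using step pline_ends[OF step(2)] by blast
  have "d \<notin> closed_segment b c \<or> d = b" using step(6) by (auto)
  with pline_ends[OF step(2)] step(6) have "closed_segment a d \<inter> closed_segment b c = {}"
    using step(3) by (auto dest: pline_ends)
  then have "closed_segment a d \<inter> (R \<union> closed_segment b c) = {d}" using step(3) by auto
  from pline.step[OF step(1) step.IH[OF step(5) *] this] show ?case by (simp add: Un_assoc)
qed

lemma pline_sym: "pline a b P \<Longrightarrow> pline b a P"
proof (induction rule: pline.induct)
  case (segment a b)
  then show ?case using pline.segment[of b a] by (simp add: closed_segment_commute)
next
  case (step a c b R)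
  then show ?case using pline_snoc[of b c R a] by (simp add: closed_segment_commute Un_commute Int_commute)
qed

lemma segment_tail_subset: "w \<in> closed_segment a (c::complex) \<Longrightarrow> closed_segment w c \<subseteq> closed_segment a c"
  by (simp add: subset_closed_segment)

text \<open>A contraction cuts an edge inside its first segment, where the edge leaves a
  neighbourhood of its end, and what remains must again be a polygonal line. If the line is a single
  segment, the remainder \<open>R\<close> is just \<open>{b}\<close>.\<close>

lemma pline_firstE:
  assumes "pline a b P"
  obtains c R where "a \<noteq> c" "P = closed_segment a c \<union> R" "closed_segment a c \<inter> R = {c}" "compact R" "b \<in> R"
    "\<And>w. w \<in> closed_segment a c \<Longrightarrow> w \<noteq> c \<Longrightarrow> pline w b (closed_segment w c \<union> R)"
  using assms
proof cases
  case segment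
  have "closed_segment w b \<union> {b} = closed_segment w b" for w by auto
  then show ?thesis using that[of b "{b}"] segment pline.segment[of _ b] by auto
next
  case (step c R)
  have "pline w b (closed_segment w c \<union> R)" if "w \<in> closed_segment a c" "w \<noteq> c" for w
  proof (rule pline.step[OF that(2) step(3)])
    show "closed_segment w c \<inter> R = {c}"
      using step(4) segment_tail_subset[OF that(1)] pline_ends[OF step(3)] by auto
  qed
  then show ?thesis using that[of c R] step pline_ends[OF step(3)] pline_compact[OF step(3)] by auto
qed

text \<open>The vertices are points of the plane and the curves are point sets, so an induction over
  contractions has no placement map to maintain.\<close>

definition pdraw :: "complex pair_pre_digraph \<Rightarrow> (complex set \<Rightarrow> complex set) \<Rightarrow> bool" where
  "pdraw D P \<longleftrightarrow> pair_graph D \<and>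
    (\<forall>a b. (a, b) \<in> parcs D \<longrightarrow> pline a b (P {a, b}) \<and> P {a, b} \<inter> pverts D \<subseteq> {a, b}) \<and>
    (\<forall>a b c d. (a, b) \<in> parcs D \<longrightarrow> (c, d) \<in> parcs D \<longrightarrow> {a, b} \<noteq> {c, d} \<longrightarrow>
      P {a, b} \<inter> P {c, d} \<subseteq> {a, b} \<inter> {c, d})"

text \<open>Since two edges share only common ends, the condition on three edges through one point
  follows from that on two.\<close>

lemma planarI_arcs:
  fixes pt :: "'b \<Rightarrow> complex"
  assumes "pair_graph D" "inj_on pt (pverts D)"
    and arcs: "\<And>a b. (a, b) \<in> parcs D \<Longrightarrow> \<exists>\<gamma>. arc \<gamma> \<and> {pathstart \<gamma>, pathfinish \<gamma>} = {pt a, pt b} \<and> path_image \<gamma> = P {a, b}"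
    and verts: "\<And>a b v. (a, b) \<in> parcs D \<Longrightarrow> v \<in> pverts D \<Longrightarrow> pt v \<in> P {a, b} \<Longrightarrow> v \<in> {a, b}"
    and disj: "\<And>a b c d. (a, b) \<in> parcs D \<Longrightarrow> (c, d) \<in> parcs D \<Longrightarrow> {a, b} \<noteq> {c, d} \<Longrightarrow>
      P {a, b} \<inter> P {c, d} \<subseteq> pt ` ({a, b} \<inter> {c, d})"
  shows "planar D"
proof -
  have "\<forall>e\<in>edges D. \<exists>\<gamma>. arc \<gamma> \<and> {pathstart \<gamma>, pathfinish \<gamma>} = pt ` e \<and> path_image \<gamma> = P e"
    using arcs by (auto simp: edges_def)
  then obtain c where c: "\<And>e. e \<in> edges D \<Longrightarrow> arc (c e) \<and> {pathstart (c e), pathfinish (c e)} = pt ` e \<and> path_image (c e) = P e"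
    by metis
  let ?d = "\<lparr>vertex_point = pt, edge_curve = c\<rparr>"
  have disj': "P e \<inter> P f \<subseteq> pt ` (e \<inter> f)" if "e \<in> edges D" "f \<in> edges D" "e \<noteq> f" for e f
    using that disj by (elim edgesE) metis
  have sub: "e \<subseteq> pverts D" if "e \<in> edges D" for e
    using that assms(1) by (auto simp: edges_def pair_graph_iff)
  have "crossings D ?d = {}"
    using disj' c by (auto simp: crossings_def)
  moreover have "is_drawing D ?d"
    unfolding is_drawing_def
  proof (intro conjI ballI impI)
    fix e v assume e: "e \<in> edges D" and v: "v \<in> pverts D - e"
    obtain a b where ab: "e = {a, b}" "(a, b) \<in> parcs D" using e by (rule edgesE)
    show "vertex_point ?d v \<notin> edge_image ?d e"
      using verts[OF ab(2), of v] v c[OF e] ab(1) by auto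
  next
    fix e f g assume "e \<in> edges D" "f \<in> edges D" "g \<in> edges D" "e \<noteq> f"
    then have "P e \<inter> P f \<subseteq> pt ` pverts D" using disj'[of e f] sub[of e] by blast
    then show "edge_image ?d e \<inter> edge_image ?d f \<inter> edge_image ?d g \<subseteq> vertex_point ?d ` pverts D"
      using c \<open>e \<in> edges D\<close> \<open>f \<in> edges D\<close> by auto
  qed (use assms(2) c in auto)
  ultimately show ?thesis by (auto simp: planar_def)
qed

lemma pdraw_disjoint:
  "pdraw D P \<Longrightarrow> (a, b) \<in> parcs D \<Longrightarrow> (c, d) \<in> parcs D \<Longrightarrow> {a, b} \<noteq> {c, d} \<Longrightarrow>
    P {a, b} \<inter> P {c, d} \<subseteq> {a, b} \<inter> {c, d}"
  unfolding pdraw_def by (elim conjE) simp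

lemma pdraw_planar: "pdraw D P \<Longrightarrow> planar D"
proof (rule planarI_arcs[of D id P])
  fix a b assume D: "pdraw D P" and "(a, b) \<in> parcs D"
  then have "pline a b (P {a, b})" by (auto simp: pdraw_def)
  from pline_arc[OF this]
  show "\<exists>\<gamma>. arc \<gamma> \<and> {pathstart \<gamma>, pathfinish \<gamma>} = {id a, id b} \<and> path_image \<gamma> = P {a, b}" by auto
next
  fix a b v assume "pdraw D P" "(a, b) \<in> parcs D" "v \<in> pverts D" "id v \<in> P {a, b}"
  then show "v \<in> {a, b}" unfolding pdraw_def id_apply by blast
next
  fix a b c d assume "pdraw D P" "(a, b) \<in> parcs D" "(c, d) \<in> parcs D" "{a, b} \<noteq> {c, d}"
  from pdraw_disjoint[OF this] show "P {a, b} \<inter> P {c, d} \<subseteq> id ` ({a, b} \<inter> {c, d})"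
    by (simp only: image_id id_apply)
qed (auto simp: pdraw_def)

text \<open>The sum of the segment and a disc whose radius is half the distance to \<open>X\<close>;
  sums of compact convex sets are compact and convex.\<close>

lemma convex_neighbourhood_of_segment:
  fixes p q :: complex
  assumes "closed X" "closed_segment p q \<inter> X = {}"
  obtains K where "compact K" "convex K" "closed_segment p q \<subseteq> interior K" "K \<inter> X = {}"
proof -
  obtain d where d: "d > 0" "\<And>x y. x \<in> closed_segment p q \<Longrightarrow> y \<in> X \<Longrightarrow> d \<le> dist x y"
    using separate_compact_closed[OF _ assms] by auto
  define K where "K = (\<Union>x\<in>closed_segment p q. \<Union>y\<in>cball 0 (d/2). {x + y})"
  have "x \<in> interior K" if "x \<in> closed_segment p q" for x
  proof -
    have "ball x (d/2) \<subseteq> K"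
    proof
      fix y assume "y \<in> ball x (d/2)"
      then have "y = x + (y - x)" "y - x \<in> cball 0 (d/2)" by (auto simp: dist_norm norm_minus_commute)
      with that show "y \<in> K" unfolding K_def by blast
    qed
    then show ?thesis using d(1) by (meson centre_in_ball half_gt_zero interior_maximal open_ball subsetD)
  qed
  moreover have "compact K" unfolding K_def by (intro compact_sums') auto
  moreover have "convex K" unfolding K_def by (intro convex_sums) auto
  moreover have "K \<inter> X = {}"
  proof -
    have False if "x \<in> closed_segment p q" "norm y \<le> d/2" "x + y \<in> X" for x y
      using d(2)[OF that(1,3)] that(2) d(1) by (simp add: dist_norm)
    then show ?thesis by (auto simp: K_def)
  qed
  ultimately show ?thesis using that by blast
qed

text \<open>The point of \<open>K\<close> on the segment that is nearest to \<open>c\<close>. It is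
  not interior, since otherwise a small move towards \<open>c\<close> would stay in \<open>K\<close>
  and come closer.\<close>

lemma convex_exit_point:
  fixes q c :: complex
  assumes "compact K" "q \<in> interior K" "c \<notin> K"
  obtains w where "w \<in> closed_segment q c" "w \<noteq> c" "w \<noteq> q" "w \<in> K" "w \<notin> interior K"
    "K \<inter> closed_segment w c = {w}"
proof -
  have "q \<in> K" using assms(2) interior_subset by auto
  have "compact (K \<inter> closed_segment q c)" using assms(1) by (simp add: compact_Int)
  then obtain w where w: "w \<in> K" "w \<in> closed_segment q c"
    and min: "\<And>y. y \<in> K \<inter> closed_segment q c \<Longrightarrow> dist c w \<le> dist c y"
    using distance_attains_inf[of "K \<inter> closed_segment q c" c] \<open>q \<in> K\<close>
    by (metis IntE IntI compact_imp_closed empty_iff ends_in_segment(1))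
  have Kw: "y = w" if "y \<in> K" "y \<in> closed_segment w c" for y
  proof -
    have "dist c w \<le> dist c y"
      using min[of y] that segment_tail_subset[OF w(2)] by auto
    moreover have "dist w c = dist w y + dist y c"
      using that(2) between_mem_segment[of w c y] by (simp add: between)
    ultimately show ?thesis by (simp add: dist_commute)
  qed
  have "w \<noteq> c" using w assms(3) by auto
  have nint: "w \<notin> interior K"
  proof
    assume "w \<in> interior K"
    then obtain e where e: "e > 0" "ball w e \<subseteq> K" by (meson mem_interior)
    have pos: "dist w c > 0" using \<open>w \<noteq> c\<close> by simp
    define t where "t = min 1 (e / (2 * dist w c))"
    have t: "0 < t" "t \<le> 1" using e pos by (auto simp: t_def)
    let ?y = "w + t *\<^sub>R (c - w)"
    have "t * dist w c \<le> e / 2"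
    proof -
      have "t * dist w c \<le> e / (2 * dist w c) * dist w c"
        using pos by (intro mult_right_mono) (auto simp: t_def)
      then show ?thesis using pos by simp
    qed
    then have "?y \<in> ball w e" using t e(1) by (simp add: dist_norm norm_minus_commute)
    moreover have "?y \<in> closed_segment w c"
      using t unfolding in_segment by (intro conjI exI[of _ t]) (auto simp: algebra_simps)
    ultimately have "?y = w" using Kw e by blast
    with t \<open>w \<noteq> c\<close> show False by simp
  qed
  show ?thesis using that[of w] w \<open>w \<noteq> c\<close> nint Kw assms(2) by auto
qed

text \<open>A segment from an interior point of a convex set to a point of the set has its relative
  interior inside the interior, so a ray from \<open>p\<close> has only one exit point. This makes
  the cone with apex \<open>p\<close> free of crossings.\<close>

lemma convex_star_unique:
  fixes p w w' :: complex
  assumes "convex K" "p \<in> interior K" "w \<notin> interior K" "w' \<in> K" "w \<in> closed_segment p w'"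
  shows "w = w'"
proof (rule ccontr)
  assume "w \<noteq> w'"
  then have "w \<in> open_segment p w'" using assms by (auto simp: open_segment_def)
  moreover have "open_segment p w' \<subseteq> interior K"
    using assms closure_subset[of K] by (intro in_interior_closure_convex_segment) auto
  ultimately show False using assms by auto
qed

lemma closed_segment_iff:
  fixes p w x :: complex
  shows "x \<in> closed_segment p w \<longleftrightarrow> (\<exists>s. 0 \<le> s \<and> s \<le> 1 \<and> x = p + s *\<^sub>R (w - p))"
  by (simp add: in_segment algebra_simps)

text \<open>Both segments leave \<open>p\<close> in the same direction, so the shorter one ends on
  the longer one.\<close>

lemma segments_common_ray:
  fixes p v w x :: complex
  assumes "x \<in> closed_segment p w" "x \<in> closed_segment p v" "x \<noteq> p"
  shows "w \<in> closed_segment p v \<or> v \<in> closed_segment p w"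
proof -
  obtain s t where s: "0 \<le> s" "s \<le> 1" "x = p + s *\<^sub>R (w - p)" and t: "0 \<le> t" "t \<le> 1" "x = p + t *\<^sub>R (v - p)"
    using assms unfolding closed_segment_iff by blast
  have st: "s > 0" "t > 0" using s t assms(3) by (auto simp: less_le)
  have eq: "s *\<^sub>R (w - p) = t *\<^sub>R (v - p)" using s t by simp
  show ?thesis
  proof (cases "t \<le> s")
    case True
    have "w - p = (t / s) *\<^sub>R (v - p)"
      using arg_cong[OF eq, of "\<lambda>z. (1/s) *\<^sub>R z"] st by (simp add: divide_inverse_commute)
    then have "w = (1 - t/s) *\<^sub>R p + (t/s) *\<^sub>R v" by (simp add: algebra_simps)
    moreover have "0 \<le> t/s" "t/s \<le> 1" using True st by auto
    ultimately show ?thesis unfolding in_segment by blast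
  next
    case False
    have "v - p = (s / t) *\<^sub>R (w - p)"
      using arg_cong[OF eq, of "\<lambda>z. (1/t) *\<^sub>R z"] st by (simp add: divide_inverse_commute)
    then have "v = (1 - s/t) *\<^sub>R p + (s/t) *\<^sub>R w" by (simp add: algebra_simps)
    moreover have "0 \<le> s/t" "s/t \<le> 1" using False st by auto
    ultimately show ?thesis unfolding in_segment by blast
  qed
qed

text \<open>The merged vertex keeps the name \<open>p\<close>, so no new vertex type arises. Edges
  from \<open>p\<close> and from \<open>q\<close> to a common neighbour become one arc, and the arc
  from \<open>p\<close> to \<open>q\<close> disappears.\<close>

definition merge_into :: "'a pair_pre_digraph \<Rightarrow> 'a \<Rightarrow> 'a \<Rightarrow> 'a pair_pre_digraph" where
  "merge_into D p q = \<lparr>pverts = pverts D - {q},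
     parcs = {(a, b). (a, b) \<in> parcs D \<and> a \<noteq> q \<and> b \<noteq> q} \<union>
       {(a, b). (q, b) \<in> parcs D \<and> b \<noteq> p \<and> a = p} \<union> {(a, b). (q, a) \<in> parcs D \<and> a \<noteq> p \<and> b = p}\<rparr>"

text \<open>Inside a thin convex neighbourhood of the segment from p to q, replace everything
  by the cone with apex p over the points where the edges at q leave the neighbourhood.\<close>

lemma pdraw_contract:
  assumes D: "pdraw D P" and pq: "(p, q) \<in> parcs D" and straight: "P {p, q} = closed_segment p q"
  obtains P' where "pdraw (merge_into D p q) P'"
    "\<And>a b. (a, b) \<in> parcs D \<Longrightarrow> a \<noteq> q \<Longrightarrow> b \<noteq> q \<Longrightarrow> P' {a, b} = P {a, b}"
proof -
  have G: "finite (pverts D)" "parcs D \<subseteq> pverts D \<times> pverts D" "\<And>a b. (a, b) \<in> parcs D \<Longrightarrow> (b, a) \<in> parcs D"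
    "\<And>a b. (a, b) \<in> parcs D \<Longrightarrow> a \<noteq> b"
    using D by (auto simp: pdraw_def pair_graph_iff dest: symD)
  have finE: "finite (parcs D)" using G(1,2) by (meson finite_SigmaI finite_subset)
  have pl: "pline a b (P {a, b})" and vs: "P {a, b} \<inter> pverts D \<subseteq> {a, b}" if "(a, b) \<in> parcs D" for a b
    using D that by (auto simp: pdraw_def)
  have dj: "P {a, b} \<inter> P {c, d} \<subseteq> {a, b} \<inter> {c, d}"
    if "(a, b) \<in> parcs D" "(c, d) \<in> parcs D" "{a, b} \<noteq> {c, d}" for a b c d
    using pdraw_disjoint[OF D that] .
  have "\<exists>c R. a \<noteq> c \<and> P {a, b} = closed_segment a c \<union> R \<and> closed_segment a c \<inter> R = {c} \<and> compact R \<and>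
      b \<in> R \<and> (\<forall>w. w \<in> closed_segment a c \<longrightarrow> w \<noteq> c \<longrightarrow> pline w b (closed_segment w c \<union> R))"
    if "(a, b) \<in> parcs D" for a b
    by (rule pline_firstE[OF pl[OF that]]) blast
  then obtain c R where cR: "\<And>a b. (a, b) \<in> parcs D \<Longrightarrow> a \<noteq> c a b \<and> P {a, b} = closed_segment a (c a b) \<union> R a b \<and>
      closed_segment a (c a b) \<inter> R a b = {c a b} \<and> compact (R a b) \<and> b \<in> R a b \<and>
      (\<forall>w. w \<in> closed_segment a (c a b) \<longrightarrow> w \<noteq> c a b \<longrightarrow> pline w b (closed_segment w (c a b) \<union> R a b))"
    by metis
  have aR: "a \<notin> R a b" if "(a, b) \<in> parcs D" for a b
    using cR[OF that] ends_in_segment(1)[of a "c a b"] by blast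
  \<comment> \<open>All that the neighbourhood has to avoid: the other vertices, the edges away from
    \<open>p\<close> and \<open>q\<close>, and of every other edge at \<open>p\<close> or
    \<open>q\<close> everything beyond its first segment.\<close>
  define X where "X = (pverts D - {p, q}) \<union>
    (\<Union>(a, b)\<in>{(a, b). (a, b) \<in> parcs D \<and> a \<notin> {p, q} \<and> b \<notin> {p, q}}. P {a, b}) \<union>
    (\<Union>(a, b)\<in>{(a, b). (a, b) \<in> parcs D \<and> a \<in> {p, q} \<and> b \<notin> {p, q}}. R a b)"
  have "closed X"
  proof -
    have "closed (pverts D - {p, q})" using G(1) by (intro finite_imp_closed) auto
    moreover have "closed (P {a, b})" "closed (R a b)" if "(a, b) \<in> parcs D" for a b
      using pline_compact[OF pl[OF that]] cR[OF that] by (auto intro: compact_imp_closed)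
    moreover have "finite {(a, b). (a, b) \<in> parcs D \<and> Q a b}" for Q
      by (rule finite_subset[OF _ finE]) auto
    ultimately show ?thesis unfolding X_def
      by (intro closed_Un closed_UN) auto
  qed
  moreover have "closed_segment p q \<inter> X = {}"
  proof -
    have "x \<notin> X" if x: "x \<in> P {p, q}" for x
    proof
      assume "x \<in> X"
      then consider "x \<in> pverts D - {p, q}"
        | a b where "(a, b) \<in> parcs D" "a \<notin> {p, q}" "b \<notin> {p, q}" "x \<in> P {a, b}"
        | a b where "(a, b) \<in> parcs D" "a \<in> {p, q}" "b \<notin> {p, q}" "x \<in> R a b"
        unfolding X_def by blast
      then show False
      proof cases
        case 1 then show False using vs[OF pq] x by blast
      next
        case 2 then show False using dj[OF 2(1) pq] x by (auto simp: doubleton_eq_iff)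
      next
        case 3
        then have "x \<in> P {a, b}" using cR[OF 3(1)] by blast
        then have "x \<in> {a, b} \<inter> {p, q}" using dj[OF 3(1) pq] x 3 by (auto simp: doubleton_eq_iff)
        then have "x = a" using 3 by auto
        then show False using aR 3 by blast
      qed
    qed
    then show ?thesis using straight by blast
  qed
  ultimately obtain K where K: "compact K" "convex K" "closed_segment p q \<subseteq> interior K" "K \<inter> X = {}"
    by (rule convex_neighbourhood_of_segment)
  have pqK: "p \<in> interior K" "q \<in> interior K" using K(3) by auto
  then have pK: "p \<in> K" using interior_subset by blast
  define Z where "Z = {z. (q, z) \<in> parcs D \<and> z \<noteq> p}"
  have Zq: "z \<notin> {p, q}" "(q, z) \<in> parcs D" if "z \<in> Z" for z
    using that G(4) by (auto simp: Z_def)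
  have RK: "R a b \<inter> K = {}" if "(a, b) \<in> parcs D" "a \<in> {p, q}" "b \<notin> {p, q}" for a b
    using K(4) that unfolding X_def by blast
  have cnK: "c a b \<notin> K" if "(a, b) \<in> parcs D" "a \<in> {p, q}" "b \<notin> {p, q}" for a b
    using RK[OF that] cR[OF that(1)] by blast
  have "\<exists>w. w \<in> closed_segment q (c q z) \<and> w \<noteq> c q z \<and> w \<noteq> q \<and> w \<in> K \<and> w \<notin> interior K \<and>
    K \<inter> closed_segment w (c q z) = {w}" if "z \<in> Z" for z
    by (rule convex_exit_point[OF K(1) pqK(2) cnK[OF Zq(2)[OF that]]]) (use Zq(1)[OF that] in auto)
  then obtain w where w: "\<And>z. z \<in> Z \<Longrightarrow> w z \<in> closed_segment q (c q z) \<and> w z \<noteq> c q z \<and> w z \<noteq> q \<and>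
    w z \<in> K \<and> w z \<notin> interior K \<and> K \<inter> closed_segment (w z) (c q z) = {w z}"
    by metis
  \<comment> \<open>\<open>T z\<close> is the edge from \<open>q\<close> to \<open>z\<close> from
    its exit point \<open>w z\<close> on. The new edge \<open>N z\<close> reaches that exit point
    along a ray of the cone.\<close>
  define T where "T z = closed_segment (w z) (c q z) \<union> R q z" for z
  define N where "N z = closed_segment p (w z) \<union> T z" for z
  have TK: "K \<inter> T z = {w z}" if "z \<in> Z" for z
    using w[OF that] RK[OF Zq(2)[OF that]] Zq(1)[OF that] unfolding T_def by blast
  have TP: "T z \<subseteq> P {q, z}" if "z \<in> Z" for z
    using w[OF that] cR[OF Zq(2)[OF that]] segment_tail_subset[of "w z" q "c q z"] unfolding T_def by blast
  have wT: "w z \<in> T z" for z by (simp add: T_def)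
  have qT: "q \<notin> T z" if "z \<in> Z" for z
  proof
    assume "q \<in> T z"
    then have "q \<in> K \<inter> T z" using pqK(2) interior_subset by blast
    then show False using TK[OF that] w[OF that] by auto
  qed
  have segK: "closed_segment p (w z) \<subseteq> K" if "z \<in> Z" for z
    using closed_segment_subset[OF pK _ K(2)] w[OF that] by blast
  have wp: "w z \<noteq> p" if "z \<in> Z" for z using w[OF that] pqK by auto
  have F1: "pline p z (N z)" if z: "z \<in> Z" for z
    unfolding N_def
  proof (rule pline.step)
    show "pline (w z) z (T z)" using cR[OF Zq(2)[OF z]] w[OF z] by (simp add: T_def)
    show "closed_segment p (w z) \<inter> T z = {w z}" using segK[OF z] TK[OF z] by auto
  qed (use wp[OF z] in auto)
  have F2: "N z \<inter> (pverts D - {q}) \<subseteq> {p, z}" if z: "z \<in> Z" for z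
    using segK[OF z] TP[OF z] vs[OF Zq(2)[OF z]] K(4) unfolding N_def X_def by blast
  \<comment> \<open>A ray meets \<open>K\<close> and hence the other tail only in that tail's exit
    point, which would make the exit points equal. Rays that share a second point would put one exit
    point on the other ray.\<close>
  have F3: "N z \<inter> N z' \<subseteq> {p}" if z: "z \<in> Z" "z' \<in> Z" "z \<noteq> z'" for z z'
  proof -
    have TT: "T z \<inter> T z' = {}" if z: "z \<in> Z" "z' \<in> Z" "z \<noteq> z'" for z z'
    proof -
      have "P {q, z} \<inter> P {q, z'} \<subseteq> {q, z} \<inter> {q, z'}"
        using z by (intro dj Zq(2)) (auto simp: doubleton_eq_iff)
      then show ?thesis using TP[OF z(1)] TP[OF z(2)] qT[OF z(1)] z(3) by blast
    qed
    have sT: "closed_segment p (w z) \<inter> T z' = {}" if z: "z \<in> Z" "z' \<in> Z" "z \<noteq> z'" for z z'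
    proof (rule ccontr)
      assume "\<not> ?thesis"
      then obtain x where x: "x \<in> closed_segment p (w z)" "x \<in> T z'" by auto
      then have "x \<in> K \<inter> T z'" using segK[OF z(1)] by auto
      then have "w z' \<in> closed_segment p (w z)" using TK[OF z(2)] x(1) by auto
      then have "w z' = w z" using w[OF z(1)] w[OF z(2)] by (intro convex_star_unique[OF K(2) pqK(1)]) auto
      then show False using TT[OF z] wT[of z] wT[of z'] by auto
    qed
    have "x = p" if x: "x \<in> closed_segment p (w z)" "x \<in> closed_segment p (w z')" for x
    proof (rule ccontr)
      assume "x \<noteq> p"
      from segments_common_ray[OF x this] show False
        using sT[OF z] sT[OF z(2,1) z(3)[symmetric]] wT[of z] wT[of z'] by blast
    qed
    then have "closed_segment p (w z) \<inter> closed_segment p (w z') \<subseteq> {p}" by auto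
    with TT[OF z] sT[OF z] sT[OF z(2,1) z(3)[symmetric]] show ?thesis unfolding N_def Int_Un_distrib Int_Un_distrib2
      by (simp add: Int_commute)
  qed
  \<comment> \<open>An old edge at \<open>p\<close> lies in \<open>K\<close> only along its first
    segment. If that overlapped a new ray, either the exit point \<open>w z\<close> would lie on the
    old edge or the end of the first segment would lie in \<open>K\<close>.\<close>
  have F4p: "N z \<inter> P {p, b} \<subseteq> {p, z} \<inter> {p, b}"
    if z: "z \<in> Z" "(p, z) \<notin> parcs D" and ab: "(p, b) \<in> parcs D" "b \<noteq> q" for z b
  proof -
    have bz: "b \<noteq> z" "b \<noteq> p" using z ab G(4) by auto
    have e: "P {q, z} \<inter> P {p, b} = {}"
      using dj[OF Zq(2)[OF z(1)] ab(1)] bz Zq(1)[OF z(1)] ab G(4)[OF pq] by (auto simp: doubleton_eq_iff)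
    have "x = p" if x: "x \<in> closed_segment p (w z)" "x \<in> P {p, b}" for x
    proof (rule ccontr)
      assume xp: "x \<noteq> p"
      have "x \<notin> R p b" using RK[OF ab(1)] segK[OF z(1)] x(1) bz ab(2) by blast
      then have "x \<in> closed_segment p (c p b)" using cR[OF ab(1)] x(2) by blast
      from segments_common_ray[OF x(1) this xp] show False
        using cnK[OF ab(1)] bz ab(2) segK[OF z(1)] cR[OF ab(1)] e TP[OF z(1)] wT[of z] by blast
    qed
    then show ?thesis using e TP[OF z(1)] unfolding N_def by blast
  qed
  have F4: "N z \<inter> P {a, b} \<subseteq> {p, z} \<inter> {a, b}"
    if z: "z \<in> Z" "(p, z) \<notin> parcs D" and ab: "(a, b) \<in> parcs D" "a \<noteq> q" "b \<noteq> q" for z a b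
  proof -
    consider "a = p" | "b = p" | "a \<noteq> p" "b \<noteq> p" by blast
    then show ?thesis
    proof cases
      case 1 then show ?thesis using F4p[OF z, of b] ab by auto
    next
      case 2 then show ?thesis using F4p[OF z, of a] ab G(3) by (auto simp: insert_commute)
    next
      case 3
      then have "P {a, b} \<inter> K = {}" using K(4) ab unfolding X_def by blast
      moreover have "P {q, z} \<inter> P {a, b} \<subseteq> {q, z} \<inter> {a, b}"
        using ab by (intro dj Zq(2) z) (auto simp: doubleton_eq_iff)
      ultimately show ?thesis using segK[OF z(1)] TP[OF z(1)] ab unfolding N_def by blast
    qed
  qed
  \<comment> \<open>A neighbour of both \<open>p\<close> and \<open>q\<close> keeps its old curve to
    \<open>p\<close>. For a genuinely new edge the union has exactly one member.\<close>
  define P' where "P' e = (if e \<in> edges D then P e else \<Union>z\<in>{z \<in> Z. e = {p, z}}. N z)" for e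
  have symD: "sym (parcs D)" using G(3) by (auto intro: symI)
  have old: "P' {a, b} = P {a, b}" if "(a, b) \<in> parcs D" for a b
    using that by (auto simp: P'_def edges_def)
  have new: "P' {p, z} = N z" if "z \<in> Z" "(p, z) \<notin> parcs D" for z
  proof -
    have "{y \<in> Z. {p, z} = {p, y}} = {z}" using that(1) by (auto simp: doubleton_eq_iff)
    then show ?thesis using that(2) by (simp add: P'_def edges_iff[OF symD])
  qed
  let ?M = "merge_into D p q"
  have Marc: "(\<exists>z\<in>Z. (p, z) \<notin> parcs D \<and> {a, b} = {p, z} \<and> P' {a, b} = N z \<and> pline a b (N z)) \<or>
      ((a, b) \<in> parcs D \<and> a \<noteq> q \<and> b \<noteq> q \<and> P' {a, b} = P {a, b})" if "(a, b) \<in> parcs ?M" for a b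
  proof (cases "(a, b) \<in> parcs D \<and> a \<noteq> q \<and> b \<noteq> q")
    case True then show ?thesis using old by auto
  next
    case False
    have "b \<in> Z \<and> a = p \<or> a \<in> Z \<and> b = p"
      using False that G(4)[OF pq] unfolding merge_into_def Z_def by auto
    then consider "b \<in> Z" "a = p" | "a \<in> Z" "b = p" by blast
    then show ?thesis
    proof cases
      case 1
      then have "(p, b) \<notin> parcs D" using False Zq(1)[OF 1(1)] G(4)[OF pq] by auto
      then show ?thesis using new[OF 1(1)] F1[OF 1(1)] 1 by auto
    next
      case 2
      then have "(p, a) \<notin> parcs D" using False Zq(1)[OF 2(1)] G(4)[OF pq] G(3) by auto
      then show ?thesis using new[OF 2(1)] pline_sym[OF F1[OF 2(1)]] 2 by (auto simp: insert_commute)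
    qed
  qed
  have "pdraw ?M P'"
    unfolding pdraw_def
  proof (intro conjI allI impI)
    have "p \<noteq> q" "(a, a) \<notin> parcs D" for a using G(4) pq by blast+
    then show "pair_graph ?M"
      using G(1-3) pq unfolding pair_graph_iff merge_into_def sym_def by auto
  next
    fix a b assume ab: "(a, b) \<in> parcs ?M"
    have V: "pverts ?M = pverts D - {q}" by (simp add: merge_into_def)
    show "pline a b (P' {a, b})" using Marc[OF ab] pl by auto
    from Marc[OF ab] show "P' {a, b} \<inter> pverts ?M \<subseteq> {a, b}"
    proof (elim disjE bexE conjE)
      fix z assume "z \<in> Z" "{a, b} = {p, z}" "P' {a, b} = N z"
      then show ?thesis using F2[of z] unfolding V by simp
    next
      assume "(a, b) \<in> parcs D" "P' {a, b} = P {a, b}"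
      then show ?thesis using vs[of a b] unfolding V by auto
    qed
  next
    fix a b c d assume ab: "(a, b) \<in> parcs ?M" and cd: "(c, d) \<in> parcs ?M" and ne: "{a, b} \<noteq> {c, d}"
    from Marc[OF ab] show "P' {a, b} \<inter> P' {c, d} \<subseteq> {a, b} \<inter> {c, d}"
    proof (elim disjE bexE conjE)
      fix z assume z: "z \<in> Z" "(p, z) \<notin> parcs D" "{a, b} = {p, z}" "P' {a, b} = N z"
      from Marc[OF cd] show ?thesis
      proof (elim disjE bexE conjE)
        fix z' assume "z' \<in> Z" "(p, z') \<notin> parcs D" "{c, d} = {p, z'}" "P' {c, d} = N z'"
        then show ?thesis using F3[OF z(1), of z'] z ne by auto
      next
        assume "(c, d) \<in> parcs D" "c \<noteq> q" "d \<noteq> q" "P' {c, d} = P {c, d}"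
        then show ?thesis using F4[OF z(1,2), of c d] z by auto
      qed
    next
      assume o: "(a, b) \<in> parcs D" "a \<noteq> q" "b \<noteq> q" "P' {a, b} = P {a, b}"
      from Marc[OF cd] show ?thesis
      proof (elim disjE bexE conjE)
        fix z' assume "z' \<in> Z" "(p, z') \<notin> parcs D" "{c, d} = {p, z'}" "P' {c, d} = N z'"
        then show ?thesis using F4[of z' a b] o by auto
      next
        assume "(c, d) \<in> parcs D" "P' {c, d} = P {c, d}"
        then show ?thesis using dj[OF o(1), of c d] ne o by auto
      qed
    qed
  qed
  then show ?thesis using that old by blast
qed

section \<open>Quotients of plane drawings by connected fibres\<close>

definition straight_arcs :: "complex pair_pre_digraph \<Rightarrow> (complex set \<Rightarrow> complex set) \<Rightarrow> complex rel" where
  "straight_arcs D P = {(a, b). (a, b) \<in> parcs D \<and> P {a, b} = closed_segment a b}"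

text \<open>Induction on the number of vertices. In a fibre with two vertices a straight edge
  \<open>pq\<close> is contracted such that the fibre without \<open>q\<close> stays connected
  through straight edges. These avoid \<open>q\<close>, so the contraction leaves their curves alone
  and the hypothesis survives, even though the new edges at \<open>p\<close> may be bent.\<close>

lemma pdraw_quotient:
  assumes "pdraw D P" and "\<And>x. x \<in> pverts D \<Longrightarrow> conn (straight_arcs D P) {y \<in> pverts D. f y = f x}"
  shows "\<exists>D'. planar D' \<and> pair_graph D' \<and> pverts D' \<subseteq> pverts D \<and> inj_on f (pverts D') \<and>
    f ` pverts D' = f ` pverts D \<and>
    (\<forall>a b. (a, b) \<in> parcs D \<longrightarrow> f a \<noteq> f b \<longrightarrow> (\<exists>a' b'. (a', b') \<in> parcs D' \<and> f a' = f a \<and> f b' = f b))"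
  using assms
proof (induction "card (pverts D)" arbitrary: D P rule: less_induct)
  case less
  note G = less.prems(1)[unfolded pdraw_def pair_graph_iff]
  show ?case
  proof (cases "inj_on f (pverts D)")
    case True
    then show ?thesis using less.prems(1) pdraw_planar[OF less.prems(1)]
      by (intro exI[of _ D]) (auto simp: pdraw_def)
  next
    case False
    then obtain x y where xy: "x \<in> pverts D" "y \<in> pverts D" "x \<noteq> y" "f x = f y" by (auto simp: inj_on_def)
    let ?S = "{y \<in> pverts D. f y = f x}"
    have fin: "finite ?S" using G by auto
    have "card {x, y} \<le> card ?S" using xy by (intro card_mono fin) auto
    then have c2: "card ?S \<ge> 2" using xy by simp
    have sy: "sym (straight_arcs D P)"
      using G by (auto simp: straight_arcs_def sym_def closed_segment_commute insert_commute)
    obtain p q where pq: "p \<in> ?S" "q \<in> ?S" "p \<noteq> q" "(p, q) \<in> straight_arcs D P"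
      "conn (straight_arcs D P) (?S - {q})"
      using conn_remove_vertex[OF less.prems(2)[OF xy(1)] fin sy c2] by blast
    let ?M = "merge_into D p q"
    have V: "pverts ?M = pverts D - {q}" by (simp add: merge_into_def)
    obtain P' where P': "pdraw ?M P'"
      "\<And>a b. (a, b) \<in> parcs D \<Longrightarrow> a \<noteq> q \<Longrightarrow> b \<noteq> q \<Longrightarrow> P' {a, b} = P {a, b}"
      using pdraw_contract[OF less.prems(1), of p q] pq(4) unfolding straight_arcs_def by blast
    have "card (pverts ?M) < card (pverts D)"
      using pq(2) G unfolding V by (intro psubset_card_mono) auto
    moreover have "conn (straight_arcs ?M P') {y \<in> pverts ?M. f y = f u}" if u: "u \<in> pverts ?M" for u
    proof -
      have sub: "straight_arcs D P \<inter> {y \<in> pverts ?M. f y = f u} \<times> {y \<in> pverts ?M. f y = f u} \<subseteq> straight_arcs ?M P'"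
        using P'(2) by (auto simp: straight_arcs_def merge_into_def)
      have "conn (straight_arcs D P) {y \<in> pverts ?M. f y = f u}"
      proof (cases "f u = f x")
        case True
        then have "{y \<in> pverts ?M. f y = f u} = ?S - {q}" unfolding V by auto
        then show ?thesis using pq(5) by simp
      next
        case False
        then have "{y \<in> pverts ?M. f y = f u} = {y \<in> pverts D. f y = f u}" using pq(2) unfolding V by auto
        then show ?thesis using less.prems(2)[of u] u unfolding V by simp
      qed
      from conn_mono[OF this sub] show ?thesis .
    qed
    ultimately obtain D' where D': "planar D'" "pair_graph D'" "pverts D' \<subseteq> pverts ?M" "inj_on f (pverts D')"
      "f ` pverts D' = f ` pverts ?M"
      and arc: "\<And>a b. (a, b) \<in> parcs ?M \<Longrightarrow> f a \<noteq> f b \<Longrightarrow> \<exists>a' b'. (a', b') \<in> parcs D' \<and> f a' = f a \<and> f b' = f b"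
      using less.hyps[OF _ P'(1)] by blast
    have fpq: "f p = f q" using pq by auto
    have "q \<in> pverts D" "p \<in> pverts D - {q}" using pq by auto
    then have "q \<in> pverts D" "f q \<in> f ` (pverts D - {q})" unfolding fpq[symmetric] by blast+
    then have "f ` (pverts D - {q}) = f ` pverts D"
      using image_insert[of f q "pverts D - {q}"] by (simp add: insert_absorb)
    moreover have "\<exists>a' b'. (a', b') \<in> parcs D' \<and> f a' = f a \<and> f b' = f b"
      if ab: "(a, b) \<in> parcs D" "f a \<noteq> f b" for a b
    proof -
      define m where "m u = (if u = q then p else u)" for u
      have m: "f (m u) = f u" for u by (simp add: m_def fpq)
      have "(b, a) \<in> parcs D" using G ab by (auto dest: symD)
      then have "(m a, m b) \<in> parcs ?M" using ab fpq by (auto simp: m_def merge_into_def)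
      from arc[OF this] show ?thesis using ab(2) m by metis
    qed
    ultimately show ?thesis using D' unfolding V by (intro exI[of _ D']) auto
  qed
qed

section \<open>Topological drawings can be made polygonal\<close>

abbreviation seg :: "complex list \<Rightarrow> nat \<Rightarrow> complex set" where
  "seg xs i \<equiv> closed_segment (xs ! i) (xs ! Suc i)"

definition schain :: "complex list \<Rightarrow> bool" where
  "schain xs \<longleftrightarrow> (\<forall>i. Suc i < length xs \<longrightarrow> xs ! i \<noteq> xs ! Suc i) \<and>
     (\<forall>i j. i < j \<longrightarrow> Suc j < length xs \<longrightarrow> seg xs i \<inter> seg xs j \<subseteq> (if j = Suc i then {xs ! j} else {}))"

abbreviation chain_in :: "complex set \<Rightarrow> complex list \<Rightarrow> bool" where
  "chain_in S \<equiv> successively (\<lambda>x y. closed_segment x y \<subseteq> S)"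

lemma chain_in_seg: "chain_in S xs \<Longrightarrow> Suc i < length xs \<Longrightarrow> seg xs i \<subseteq> S"
  by (simp add: successively_conv_nth)

lemma chain_splice:
  assumes "chain_in S xs" "i < j" "j < length xs" "chain_in S (xs ! i # zs @ [xs ! j])"
  shows "chain_in S (take (Suc i) xs @ zs @ drop j xs)"
    "hd (take (Suc i) xs @ zs @ drop j xs) = hd xs" "last (take (Suc i) xs @ zs @ drop j xs) = last xs"
    "length (take (Suc i) xs @ zs @ drop j xs) = Suc i + length zs + (length xs - j)"
proof -
  have "chain_in S (take (Suc i) xs @ drop (Suc i) xs)" "chain_in S (take j xs @ drop j xs)" using assms(1) by simp_all
  then have "chain_in S (take (Suc i) xs)" "chain_in S (drop j xs)"
    by (metis successively_append_iff)+
  moreover have "last (take (Suc i) xs) = xs ! i" "hd (drop j xs) = xs ! j"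
    using assms(2,3) by (simp_all add: take_Suc_conv_app_nth hd_drop_conv_nth)
  ultimately show "chain_in S (take (Suc i) xs @ zs @ drop j xs)"
    using assms(2-4) by (cases "zs = []") (auto simp: successively_append_iff successively_Cons)
qed (use assms in \<open>auto simp: hd_append\<close>)

text \<open>A chain with the fewest segments cannot meet itself, since any contact yields a shortcut.\<close>

lemma simple_chain_exists:
  assumes "xs0 \<noteq> []" "hd xs0 = a" "last xs0 = b" "chain_in S xs0" "a \<noteq> b"
  obtains xs where "schain xs" "chain_in S xs" "hd xs = a" "last xs = b" "2 \<le> length xs"
proof -
  define Q where "Q xs \<longleftrightarrow> xs \<noteq> [] \<and> hd xs = a \<and> last xs = b \<and> chain_in S xs" for xs
  have "Q xs0" using assms by (simp add: Q_def)
  then obtain xs where Q: "Q xs" and min: "\<And>ys. Q ys \<Longrightarrow> length xs \<le> length ys"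
    using ex_has_least_nat[of Q xs0 length] by blast
  then have xs: "xs \<noteq> []" "hd xs = a" "last xs = b" "chain_in S xs" by (auto simp: Q_def)
  have len: "2 \<le> length xs"
  proof (rule ccontr)
    assume "\<not> 2 \<le> length xs"
    moreover have "length xs \<noteq> 0" using xs(1) by simp
    ultimately have "length xs = 1" by linarith
    then show False using xs assms(5) by (cases xs) auto
  qed
  \<comment> \<open>By minimality a detour through \<open>zs\<close> has at least as many points as
    the stretch between positions \<open>i\<close> and \<open>j\<close> that it replaces.\<close>
  have splice: "j \<le> Suc i + length zs" if "i < j" "j < length xs" "chain_in S (xs ! i # zs @ [xs ! j])" for i j zs
  proof -
    have "Q (take (Suc i) xs @ zs @ drop j xs)"
      using chain_splice[OF xs(4) that] xs that unfolding Q_def by auto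
    from min[OF this] show ?thesis using chain_splice(4)[OF xs(4) that] that by linarith
  qed
  have shortcut: "\<not> closed_segment (xs ! i) (xs ! Suc (Suc i)) \<subseteq> S" if "Suc (Suc i) < length xs" for i
    using splice[of i "Suc (Suc i)" "[]"] that by auto
  have ne: "xs ! i \<noteq> xs ! Suc i" if i: "Suc i < length xs" for i
  proof
    assume eq: "xs ! i = xs ! Suc i"
    show False
    proof (cases "Suc (Suc i) < length xs")
      case True
      then show False using shortcut[OF True] chain_in_seg[OF xs(4) True] eq by simp
    next
      case False
      then have l: "length xs = Suc (Suc i)" using i by simp
      have "xs \<noteq> []" "take (Suc i) xs \<noteq> []" using xs by auto
      moreover have "last xs = xs ! Suc i" "last (take (Suc i) xs) = xs ! i"
        using xs(1) l by (simp_all add: last_conv_nth take_Suc_conv_app_nth)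
      then have "last (take (Suc i) xs) = b" using xs(3) eq by simp
      moreover have "chain_in S (take (Suc i) xs @ drop (Suc i) xs)" using xs(4) by simp
      then have "chain_in S (take (Suc i) xs)" unfolding successively_append_iff by blast
      ultimately have "Q (take (Suc i) xs)" using xs by (simp add: Q_def)
      from min[OF this] show False using l by simp
    qed
  qed
  \<comment> \<open>A second common point puts both segments on one ray from the joint, so the
    segment that skips the joint stays inside their union.\<close>
  have consecutive: "z = xs ! Suc i"
    if i: "Suc (Suc i) < length xs" and z: "z \<in> seg xs i" "z \<in> seg xs (Suc i)" for i z
  proof (rule ccontr)
    assume "z \<noteq> xs ! Suc i"
    moreover have "z \<in> closed_segment (xs ! Suc i) (xs ! i)" using z(1) by (simp add: closed_segment_commute)
    ultimately have "xs ! i \<in> seg xs (Suc i) \<or> xs ! Suc (Suc i) \<in> closed_segment (xs ! Suc i) (xs ! i)"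
      using segments_common_ray z(2) by blast
    then have "closed_segment (xs ! i) (xs ! Suc (Suc i)) \<subseteq> seg xs i \<union> seg xs (Suc i)"
      by (metis (no_types, lifting) closed_segment_commute ends_in_segment le_supI1 le_supI2 subset_closed_segment)
    then show False using shortcut[OF i] chain_in_seg[OF xs(4) i] chain_in_seg[OF xs(4), of i] i by auto
  qed
  \<comment> \<open>The detour through the contact point \<open>z\<close> replaces the positions
    \<open>Suc i\<close> to \<open>j\<close>, which are at least two.\<close>
  have far: "seg xs i \<inter> seg xs j = {}" if ij: "Suc i < j" "Suc j < length xs" for i j
  proof (rule ccontr)
    assume "\<not> ?thesis"
    then obtain z where z: "z \<in> seg xs i" "z \<in> seg xs j" by blast
    have "closed_segment (xs ! i) z \<subseteq> seg xs i" "closed_segment z (xs ! Suc j) \<subseteq> seg xs j"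
      using z by (simp_all add: subset_closed_segment)
    moreover have "seg xs i \<subseteq> S" "seg xs j \<subseteq> S" using ij by (auto intro!: chain_in_seg[OF xs(4)])
    ultimately have "chain_in S (xs ! i # [z] @ [xs ! Suc j])" by (auto simp: successively_Cons)
    from splice[OF _ _ this] ij show False by auto
  qed
  have "schain xs"
    unfolding schain_def
  proof (intro conjI allI impI)
    fix i j assume ij: "i < j" "Suc j < length xs"
    show "seg xs i \<inter> seg xs j \<subseteq> (if j = Suc i then {xs ! j} else {})"
    proof (cases "j = Suc i")
      case True
      then show ?thesis using consecutive[of i] ij by auto
    next
      case False
      then show ?thesis using far[of i j] ij by auto
    qed
  qed (use ne in auto)
  then show ?thesis using that xs len by blast
qed

lemma schain_mem:
  assumes "schain xs" "Suc i < length xs" "j < length xs" "xs ! j \<in> seg xs i"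
  shows "j = i \<or> j = Suc i"
proof (rule ccontr)
  assume n: "\<not> ?thesis"
  then consider "j < i" | "Suc i < j" by linarith
  then show False
  proof cases
    case 1
    then have "seg xs j \<inter> seg xs i \<subseteq> (if i = Suc j then {xs ! i} else {})" "Suc j < length xs"
      using assms(1,2) unfolding schain_def by auto
    note this(1)
    moreover have "xs ! j \<in> seg xs j \<inter> seg xs i" using assms(4) by simp
    ultimately have "xs ! j \<in> (if i = Suc j then {xs ! i} else {})" by blast
    then have "i = Suc j" "xs ! j = xs ! Suc j" by (auto split: if_splits)
    then show False using assms(1,2) 1 unfolding schain_def by auto
  next
    case 2
    then obtain k where k: "j = Suc k" "i < k" by (cases j) auto
    then have "seg xs i \<inter> seg xs k \<subseteq> (if k = Suc i then {xs ! k} else {})"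
      using assms unfolding schain_def by auto
    moreover have "xs ! j \<in> seg xs i \<inter> seg xs k" using assms(4) k by simp
    ultimately have "xs ! j \<in> (if k = Suc i then {xs ! k} else {})" by blast
    then have "xs ! Suc k = xs ! k" using k by (auto split: if_splits)
    then show False using assms k unfolding schain_def by force
  qed
qed

lemma schain_distinct:
  assumes "schain xs" shows "distinct xs"
  unfolding distinct_conv_nth
proof (intro allI impI)
  fix i j assume ij: "i < length xs" "j < length xs" "i \<noteq> j"
  have *: "xs ! i \<noteq> xs ! j" if "i < j" "j < length xs" for i j
  proof
    assume eq: "xs ! i = xs ! j"
    then have "xs ! j \<in> seg xs i" by (metis ends_in_segment(1))
    with schain_mem[OF assms, of i j] that have "j = Suc i" by auto
    then show False using assms eq that unfolding schain_def by auto
  qed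
  show "xs ! i \<noteq> xs ! j" using *[of i j] *[of j i] ij by (cases "i < j") auto
qed

lemma schain_pline:
  "schain xs \<Longrightarrow> 2 \<le> length xs \<Longrightarrow> pline (hd xs) (last xs) (\<Union>i\<in>{i. Suc i < length xs}. seg xs i)"
proof (induction xs)
  case (Cons x ys)
  show ?case
  proof (cases "length ys = 1")
    case True
    then obtain y where y: "ys = [y]" by (auto simp: length_Suc_conv)
    have "x \<noteq> y" using Cons.prems y by (force simp: schain_def)
    moreover have "{i. Suc i < length (x # ys)} = {0}" using y by auto
    ultimately show ?thesis using pline.segment[of x y] y by simp
  next
    case False
    then have l: "2 \<le> length ys" using Cons.prems(2) by auto
    have ne: "\<And>i. Suc i < length (x # ys) \<Longrightarrow> (x # ys) ! i \<noteq> (x # ys) ! Suc i"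
      and cr: "\<And>i j. i < j \<Longrightarrow> Suc j < length (x # ys) \<Longrightarrow> seg (x # ys) i \<inter> seg (x # ys) j \<subseteq> (if j = Suc i then {(x # ys) ! j} else {})"
      using Cons.prems(1) unfolding schain_def by blast+
    have "schain ys"
      unfolding schain_def
    proof (intro conjI allI impI)
      fix i assume "Suc i < length ys" then show "ys ! i \<noteq> ys ! Suc i" using ne[of "Suc i"] by simp
    next
      fix i j assume "i < j" "Suc j < length ys"
      then show "seg ys i \<inter> seg ys j \<subseteq> (if j = Suc i then {ys ! j} else {})" using cr[of "Suc i" "Suc j"] by (cases "j = Suc i") simp_all
    qed
    from Cons.IH[OF this l] have R: "pline (hd ys) (last ys) (\<Union>i\<in>{i. Suc i < length ys}. seg ys i)" (is "pline _ _ ?R") .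
    have hd: "hd ys = ys ! 0" using l by (cases ys) auto
    have "closed_segment x (hd ys) \<inter> seg ys i \<subseteq> {hd ys}" if "Suc i < length ys" for i
      using cr[of 0 "Suc i"] that by (auto simp: hd split: if_splits)
    then have "closed_segment x (hd ys) \<inter> ?R = {hd ys}" using pline_ends[OF R] by auto
    moreover have "x \<noteq> hd ys" using ne[of 0] l hd by (cases ys) auto
    ultimately have "pline x (last ys) (closed_segment x (hd ys) \<union> ?R)" using pline.step R by blast
    moreover have "(\<Union>i\<in>{i. Suc i < length (x # ys)}. seg (x # ys) i) = closed_segment x (hd ys) \<union> ?R"
    proof -
      have "{i. Suc i < length (x # ys)} = insert 0 (Suc ` {i. Suc i < length ys})"
        using l by (auto simp: image_iff gr0_conv_Suc) (metis not0_implies_Suc less_Suc_eq_0_disj)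
      then show ?thesis by (simp add: hd)
    qed
    ultimately show ?thesis using l by (simp) (auto)
  qed
qed simp

text \<open>Run backwards, the path is cut where it first reaches the circle, so the remaining piece
  touches the disc only at the cut.\<close>

lemma path_trim_start:
  fixes x :: complex
  assumes "path g" "dist x (pathstart g) \<le> r" "r < dist x (pathfinish g)" "0 < r"
  obtains h where "path h" "pathfinish h = pathfinish g" "path_image h \<subseteq> path_image g"
    "dist x (pathstart h) = r" "path_image h \<inter> cball x r = {pathstart h}"
proof -
  have "pathstart (reversepath g) \<in> closure (- cball x r)"
    using assms(3) closure_subset[of "- cball x r"] by auto
  moreover have "pathfinish (reversepath g) \<notin> - cball x r" using assms(2) by simp
  ultimately obtain h where h: "path h" "pathstart h = pathstart (reversepath g)" "path_image h \<subseteq> path_image (reversepath g)"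
    "path_image h - {pathfinish h} \<subseteq> interior (- cball x r)" "pathfinish h \<in> frontier (- cball x r)"
    using exists_path_subpath_to_frontier[of "reversepath g" "- cball x r"] assms(1) by (metis path_reversepath)
  have "dist x (pathfinish h) = r"
    using h(5) assms(4) by (simp add: frontier_complement)
  moreover have "path_image h \<inter> cball x r = {pathfinish h}"
    using h(4) interior_subset[of "- cball x r"] \<open>dist x (pathfinish h) = r\<close> by auto
  ultimately show ?thesis using that[of "reversepath h"] h by auto
qed

text \<open>The second cut is made on the reversed remainder and keeps its far end, which is the
  point of the first cut. The bound on \<open>2 * r\<close> puts that point outside the disc about
  \<open>y\<close>.\<close>

lemma path_trim:
  fixes x y :: complex
  assumes "path g" "pathstart g = x" "pathfinish g = y" "2 * r < dist x y" "0 < r"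
  obtains h where "path h" "path_image h \<subseteq> path_image g"
    "dist x (pathstart h) = r" "path_image h \<inter> cball x r = {pathstart h}"
    "dist y (pathfinish h) = r" "path_image h \<inter> cball y r = {pathfinish h}"
proof -
  obtain h where h: "path h" "pathfinish h = y" "path_image h \<subseteq> path_image g"
    "dist x (pathstart h) = r" "path_image h \<inter> cball x r = {pathstart h}"
    using path_trim_start[of g x r] assms by auto
  have "dist x y \<le> dist x (pathstart h) + dist y (pathstart h)" by (rule dist_triangle2)
  then have "r < dist y (pathstart h)" using h(4) assms(4) by simp
  then obtain k where k: "path k" "pathfinish k = pathstart h" "path_image k \<subseteq> path_image h"
    "dist y (pathstart k) = r" "path_image k \<inter> cball y r = {pathstart k}"
    using path_trim_start[of "reversepath h" y r] h assms(5) by auto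
  have "pathstart h \<in> path_image k" using k(2) by (metis pathfinish_in_path_image)
  then have "path_image k \<inter> cball x r = {pathstart h}" using h(5) k(3) by auto
  then show ?thesis using that[of "reversepath k"] h k by auto
qed

text \<open>By uniform continuity sufficiently dense samples of the path are less than
  \<open>e\<close> apart, so the segment between two successive samples lies in the ball about the
  earlier one.\<close>

lemma path_chain:
  fixes g :: "real \<Rightarrow> complex"
  assumes "path g" "0 < e"
  shows "(pathstart g, pathfinish g) \<in> {(x, y). closed_segment x y \<subseteq> (\<Union>c\<in>path_image g. ball c e)}\<^sup>*"
proof -
  have "uniformly_continuous_on {0..1} g"
    using assms(1) by (intro compact_uniformly_continuous) (auto simp: path_def)
  then obtain d where d: "d > 0" "\<And>s t. s \<in> {0..1} \<Longrightarrow> t \<in> {0..1} \<Longrightarrow> dist t s < d \<Longrightarrow> dist (g t) (g s) < e"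
    using assms(2) unfolding uniformly_continuous_on_def by meson
  obtain n :: nat where n: "n > 0" "1 / real n < d"
    using d(1) by (metis nat_approx_posE zero_less_Suc)
  let ?R = "{(x, y). closed_segment x y \<subseteq> (\<Union>c\<in>path_image g. ball c e)}"
  have "(g 0, g (real k / real n)) \<in> ?R\<^sup>*" if "k \<le> n" for k
    using that
  proof (induction k)
    case (Suc k)
    let ?s = "real k / real n" and ?t = "real (Suc k) / real n"
    have s: "?s \<in> {0..1}" "?t \<in> {0..1}" using Suc.prems n by auto
    have "dist ?t ?s = 1 / real n" using n by (simp add: dist_real_def field_simps)
    then have "dist (g ?s) (g ?t) < e" using d(2)[OF s] n(2) by (simp add: dist_commute)
    then have "closed_segment (g ?s) (g ?t) \<subseteq> ball (g ?s) e"
      using assms(2) by (intro closed_segment_subset) auto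
    moreover have "g ?s \<in> path_image g" using s(1) unfolding path_image_def by blast
    ultimately have "(g ?s, g ?t) \<in> ?R" by blast
    then show ?case using Suc by (meson Suc_leD rtrancl.rtrancl_into_rtrancl)
  qed simp
  from this[of n] show ?thesis using n by (simp add: pathstart_def pathfinish_def)
qed

section \<open>Replacing the curves of a plane drawing by polygonal chains\<close>

lemma finite_positive_lower_bound:
  "finite A \<Longrightarrow> (\<And>x. x \<in> A \<Longrightarrow> (0::real) < x) \<Longrightarrow> \<exists>r>0. \<forall>x\<in>A. r < x"
proof (induction A rule: finite_induct)
  case empty then show ?case by (intro exI[of _ 1]) auto
next
  case (insert a A)
  then obtain r where "r > 0" "\<forall>x\<in>A. r < x" by auto
  then show ?case using insert.prems[of a] by (intro exI[of _ "min r (a/2)"]) auto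
qed

definition poly :: "complex list \<Rightarrow> complex set" where
  "poly xs = (\<Union>i\<in>{i. Suc i < length xs}. seg xs i)"

lemma segment_far_end:
  fixes a b z :: complex
  assumes "z \<in> closed_segment a b" "dist a z = dist a b" shows "z = b"
  using assms between_mem_segment[of a b z] by (simp add: between)

lemma segment_in_cball:
  fixes a b z :: complex
  assumes "z \<in> closed_segment a b" shows "dist a z \<le> dist a b"
  using assms by (metis dist_commute dist_in_closed_segment)

lemma finite_Collect_pairs: "finite A \<Longrightarrow> finite B \<Longrightarrow> finite {(x, y). (x, y) \<in> A \<times> B \<and> Q x y}"
  by (rule finite_subset[of _ "A \<times> B"]) auto

text \<open>Near its two ends each curve is replaced by a spoke, a radius of a small disc about the
  vertex; between the discs it becomes a chain close to the trimmed curve. Trimmed curves of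
  different edges are disjoint compact sets and keep disjoint neighbourhoods. Spokes at one vertex
  end at different points of the circle, and so share only the centre.\<close>

lemma planar_polygonal:
  fixes D :: "'b pair_pre_digraph"
  assumes "pair_graph D" "planar D"
  obtains pt :: "'b \<Rightarrow> complex" and xs :: "'b set \<Rightarrow> complex list" where "inj_on pt (pverts D)"
    "\<And>e. e \<in> edges D \<Longrightarrow> schain (xs e) \<and> 2 \<le> length (xs e) \<and> {hd (xs e), last (xs e)} = pt ` e"
    "\<And>e v. e \<in> edges D \<Longrightarrow> v \<in> pverts D \<Longrightarrow> pt v \<in> poly (xs e) \<Longrightarrow> v \<in> e"
    "\<And>e f. e \<in> edges D \<Longrightarrow> f \<in> edges D \<Longrightarrow> e \<noteq> f \<Longrightarrow> poly (xs e) \<inter> poly (xs f) \<subseteq> pt ` (e \<inter> f)"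
proof -
  have G: "finite (pverts D)" "parcs D \<subseteq> pverts D \<times> pverts D" "\<And>a b. (a, b) \<in> parcs D \<Longrightarrow> a \<noteq> b"
    using assms(1) by (auto simp: pair_graph_iff)
  have finE: "finite (edges D)" using G(1,2) unfolding edges_def by (meson finite_SigmaI finite_imageI finite_subset)
  have sub: "e \<subseteq> pverts D" if "e \<in> edges D" for e using that G(2) by (auto simp: edges_def)
  obtain d where d: "is_drawing D d" "crossings D d = {}" using assms(2) by (auto simp: planar_def)
  define pt where "pt = vertex_point d"
  define g where "g = edge_curve d"
  have inj: "inj_on pt (pverts D)" and arc: "\<And>e. e \<in> edges D \<Longrightarrow> arc (g e)"
    and ends: "\<And>e. e \<in> edges D \<Longrightarrow> {pathstart (g e), pathfinish (g e)} = pt ` e"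
    and avoid: "\<And>e v. e \<in> edges D \<Longrightarrow> v \<in> pverts D \<Longrightarrow> v \<notin> e \<Longrightarrow> pt v \<notin> path_image (g e)"
    using d(1) by (auto simp: is_drawing_def pt_def g_def)
  have disj: "path_image (g e) \<inter> path_image (g f) \<subseteq> pt ` (e \<inter> f)"
    if "e \<in> edges D" "f \<in> edges D" "e \<noteq> f" for e f
    using d(2) that unfolding crossings_def pt_def g_def by blast
  have "\<exists>u w. {u, w} = e \<and> u \<noteq> w \<and> pt u = pathstart (g e) \<and> pt w = pathfinish (g e)" if e: "e \<in> edges D" for e
  proof -
    obtain a b where ab: "e = {a, b}" "(a, b) \<in> parcs D" using e by (rule edgesE)
    have "{pathstart (g e), pathfinish (g e)} = {pt a, pt b}" using ends[OF e] unfolding ab(1) by simp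
    then consider "pt a = pathstart (g e)" "pt b = pathfinish (g e)" | "pt b = pathstart (g e)" "pt a = pathfinish (g e)"
      unfolding doubleton_eq_iff by metis
    then show ?thesis
    proof cases
      case 1 then show ?thesis using ab G(3)[OF ab(2)] by (intro exI[of _ a] exI[of _ b]) simp
    next
      case 2 then show ?thesis using ab G(3)[OF ab(2)] by (intro exI[of _ b] exI[of _ a]) (simp add: insert_commute)
    qed
  qed
  then obtain u w where uw: "\<And>e. e \<in> edges D \<Longrightarrow> {u e, w e} = e \<and> u e \<noteq> w e \<and> pt (u e) = pathstart (g e) \<and> pt (w e) = pathfinish (g e)"
    by metis
  have uwV: "u e \<in> pverts D" "w e \<in> pverts D" if "e \<in> edges D" for e
    using sub[OF that] uw[OF that] by blast+
  \<comment> \<open>The radius \<open>r\<close> of the discs lies below half the distance of any two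
    vertices and below the distance from any vertex to any curve that does not end there.\<close>
  let ?A = "(\<lambda>(v, v'). dist (pt v) (pt v') / 2) ` {(v, v') \<in> pverts D \<times> pverts D. v \<noteq> v'} \<union>
    (\<lambda>(e, v). infdist (pt v) (path_image (g e))) ` {(e, v) \<in> edges D \<times> pverts D. v \<notin> e}"
  have "0 < infdist (pt v) (path_image (g e))" if "e \<in> edges D" "v \<in> pverts D" "v \<notin> e" for e v
    using avoid[OF that] arc[OF that(1)] by (intro infdist_pos_not_in_closed) (auto simp: closed_arc_image)
  moreover have "0 < dist (pt v) (pt v') / 2" if "v \<in> pverts D" "v' \<in> pverts D" "v \<noteq> v'" for v v'
    using inj_onD[OF inj _ that(1,2)] that(3) by auto
  ultimately have posA: "0 < x" if "x \<in> ?A" for x using that by (elim UnE imageE) auto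
  have finA: "finite ?A"
    by (intro finite_UnI finite_imageI finite_Collect_pairs G(1) finE)
  obtain r where r: "r > 0" "\<forall>x\<in>?A. r < x"
    using finite_positive_lower_bound[OF finA posA] by blast
  have sep: "2 * r < dist (pt v) (pt v')" if "v \<in> pverts D" "v' \<in> pverts D" "v \<noteq> v'" for v v'
  proof -
    have "dist (pt v) (pt v') / 2 \<in> ?A" using that by force
    then have "r < dist (pt v) (pt v') / 2" using r(2) by (rule bspec[rotated])
    then show ?thesis by simp
  qed
  have far0: "r < dist (pt v) z" if "e \<in> edges D" "v \<in> pverts D" "v \<notin> e" "z \<in> path_image (g e)" for e v z
  proof -
    have "infdist (pt v) (path_image (g e)) \<in> ?A" using that by force
    then have "r < infdist (pt v) (path_image (g e))" using r(2) by (rule bspec[rotated])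
    then show ?thesis using infdist_le[OF that(4), of "pt v"] by linarith
  qed
  have "\<exists>h. path h \<and> path_image h \<subseteq> path_image (g e) \<and>
    dist (pt (u e)) (pathstart h) = r \<and> path_image h \<inter> cball (pt (u e)) r = {pathstart h} \<and>
    dist (pt (w e)) (pathfinish h) = r \<and> path_image h \<inter> cball (pt (w e)) r = {pathfinish h}" if e: "e \<in> edges D" for e
  proof -
    have "path (g e)" using arc[OF e] by (rule arc_imp_path)
    moreover have "2 * r < dist (pt (u e)) (pt (w e))" using sep uwV[OF e] uw[OF e] by blast
    ultimately show ?thesis using path_trim[of "g e" "pt (u e)" "pt (w e)" r] uw[OF e] r(1) by metis
  qed
  then obtain c where c: "\<And>e. e \<in> edges D \<Longrightarrow> path (c e) \<and> path_image (c e) \<subseteq> path_image (g e) \<and>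
    dist (pt (u e)) (pathstart (c e)) = r \<and> path_image (c e) \<inter> cball (pt (u e)) r = {pathstart (c e)} \<and>
    dist (pt (w e)) (pathfinish (c e)) = r \<and> path_image (c e) \<inter> cball (pt (w e)) r = {pathfinish (c e)}"
    by metis
  define C where "C e = path_image (c e)" for e
  define sp where "sp e v = (if v = u e then pathstart (c e) else pathfinish (c e))" for e v
  have Cg: "C e \<subseteq> path_image (g e)" and Ccomp: "compact (C e)" if "e \<in> edges D" for e
    using c[OF that] by (auto simp: C_def compact_path_image)
  have sp: "dist (pt v) (sp e v) = r" "C e \<inter> cball (pt v) r = {sp e v}" if "e \<in> edges D" "v \<in> e" for e v
  proof -
    have "v = u e \<or> v = w e" using uw[OF that(1)] that(2) by blast
    then show "dist (pt v) (sp e v) = r" "C e \<inter> cball (pt v) r = {sp e v}"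
      using c[OF that(1)] uw[OF that(1)] by (auto simp: C_def sp_def)
  qed
  have spC: "sp e v \<in> C e" if "e \<in> edges D" "v \<in> e" for e v using sp(2)[OF that] by blast
  have far: "r < dist (pt v) z" if "e \<in> edges D" "v \<in> pverts D" "v \<notin> e" "z \<in> C e" for e v z
    using far0[OF that(1-3)] Cg[OF that(1)] that(4) by blast
  have CC: "C e \<inter> C f = {}" if ef: "e \<in> edges D" "f \<in> edges D" "e \<noteq> f" for e f
  proof (rule ccontr)
    assume "\<not> ?thesis"
    then obtain z where z: "z \<in> C e" "z \<in> C f" by blast
    then have "z \<in> pt ` (e \<inter> f)" using disj[OF ef] Cg[OF ef(1)] Cg[OF ef(2)] by blast
    then obtain v where v: "v \<in> e" "z = pt v" by blast
    then have "z \<in> C e \<inter> cball (pt v) r" using z r(1) by simp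
    then have "z = sp e v" using sp(2)[OF ef(1) v(1)] by simp
    then show False using sp(1)[OF ef(1) v(1)] v(2) r(1) by simp
  qed
  \<comment> \<open>The spoke of \<open>e\<close> at its end \<open>v\<close>, up to the point
    \<open>sp e v\<close> where the trimmed curve begins.\<close>
  define L where "L e v = closed_segment (pt v) (sp e v)" for e v
  have Lr: "dist (pt v) z \<le> r" if "e \<in> edges D" "v \<in> e" "z \<in> L e v" for e v z
    using segment_in_cball[of z "pt v" "sp e v"] sp(1)[OF that(1,2)] that(3) by (simp add: L_def)
  \<comment> \<open>A common point lies in the disc about \<open>v\<close>, which the trimmed curve
    of \<open>e\<close> meets only on the circle. The spoke reaches the circle only at its end, and
    that point belongs to \<open>C f\<close>.\<close>
  have CL: "C e \<inter> L f v = {}" if ef: "e \<in> edges D" "f \<in> edges D" "e \<noteq> f" and v: "v \<in> f" for e f v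
  proof (rule ccontr)
    assume "\<not> ?thesis"
    then obtain z where z: "z \<in> C e" "z \<in> L f v" by blast
    have le: "dist (pt v) z \<le> r" using Lr[OF ef(2) v z(2)] .
    have "v \<in> e"
    proof (rule ccontr)
      assume "v \<notin> e"
      then have "r < dist (pt v) z" using far[OF ef(1) _ _ z(1), of v] sub[OF ef(2)] v by blast
      then show False using le by simp
    qed
    moreover have "z \<in> C e \<inter> cball (pt v) r" using z(1) le by simp
    ultimately have "z = sp e v" using sp(2)[OF ef(1), of v] by simp
    then have "dist (pt v) z = dist (pt v) (sp f v)" using sp(1)[OF ef(1) \<open>v \<in> e\<close>] sp(1)[OF ef(2) v] by (simp only:)
    then have "z = sp f v" using segment_far_end z(2) by (simp add: L_def)
    then show False using CC[OF ef] z(1) spC[OF ef(2) v] by blast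
  qed
  \<comment> \<open>Discs about different vertices are disjoint. Two spokes from the same centre
    that overlap would make one contain the end of the other, contrary to \<open>CL\<close>.\<close>
  have LL: "L e v \<inter> L f v' \<subseteq> pt ` (e \<inter> f)"
    if ef: "e \<in> edges D" "f \<in> edges D" "e \<noteq> f" and v: "v \<in> e" "v' \<in> f" for e f v v'
  proof
    fix z assume z: "z \<in> L e v \<inter> L f v'"
    have "dist (pt v) (pt v') \<le> dist (pt v) z + dist (pt v') z" by (rule dist_triangle2)
    then have "dist (pt v) (pt v') \<le> 2 * r" using Lr[OF ef(1) v(1), of z] Lr[OF ef(2) v(2), of z] z by auto
    then have "\<not> 2 * r < dist (pt v) (pt v')" by simp
    then have vv: "v = v'" using sep[of v v'] sub[OF ef(1)] sub[OF ef(2)] v by blast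
    have "z = pt v"
    proof (rule ccontr)
      assume "z \<noteq> pt v"
      then have "sp f v \<in> L e v \<or> sp e v \<in> L f v"
        using segments_common_ray[of z "pt v" "sp f v" "sp e v"] z vv by (auto simp: L_def)
      then show False
        using CL[OF ef(2,1) ef(3)[symmetric] v(1)] CL[OF ef v(2)] spC[OF ef(1) v(1)] spC[OF ef(2) v(2)] vv by blast
    qed
    then show "z \<in> pt ` (e \<inter> f)" using v vv by blast
  qed
  define M where "M f = C f \<union> (\<Union>v\<in>f. L f v)" for f
  have "\<exists>\<delta>>0. \<forall>x\<in>C e. \<forall>y\<in>M f. \<delta> \<le> dist x y" if ef: "e \<in> edges D" "f \<in> edges D" "e \<noteq> f" for e f
  proof -
    have "compact (M f)" unfolding M_def L_def
      using Ccomp[OF ef(2)] finite_subset[OF sub[OF ef(2)] G(1)] by (intro compact_Un compact_UN) auto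
    moreover have "C e \<inter> M f = {}" using CC[OF ef] CL[OF ef] by (auto simp: M_def)
    ultimately show ?thesis
      using separate_compact_closed[OF Ccomp[OF ef(1)], of "M f"] compact_imp_closed by blast
  qed
  then obtain dd where dd: "\<And>e f. e \<in> edges D \<Longrightarrow> f \<in> edges D \<Longrightarrow> e \<noteq> f \<Longrightarrow> 0 < dd e f \<and> (\<forall>x\<in>C e. \<forall>y\<in>M f. dd e f \<le> dist x y)"
    by metis
  \<comment> \<open>\<open>\<epsilon>\<close> is below half the gap between any trimmed curve and
    the trimmed curve and spokes of any other edge. Being also below \<open>r\<close>, it keeps the
    neighbourhoods away from vertices that are not ends.\<close>
  let ?B = "insert r ((\<lambda>(e, f). dd e f / 2) ` {(e, f) \<in> edges D \<times> edges D. e \<noteq> f})"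
  have finB: "finite ?B" by (intro finite.insertI finite_imageI finite_Collect_pairs finE)
  have posB: "0 < x" if "x \<in> ?B" for x using that r(1) by (elim insertE imageE) (auto dest: dd)
  obtain \<epsilon> where eps: "\<epsilon> > 0" "\<forall>x\<in>?B. \<epsilon> < x"
    using finite_positive_lower_bound[OF finB posB] by blast
  have epsd: "2 * \<epsilon> < dd e f" if "e \<in> edges D" "f \<in> edges D" "e \<noteq> f" for e f
  proof -
    have "dd e f / 2 \<in> ?B" using that by force
    then have "\<epsilon> < dd e f / 2" using eps(2) by (rule bspec[rotated])
    then show ?thesis by simp
  qed
  define U where "U e = (\<Union>z\<in>C e. ball z \<epsilon>)" for e
  define S where "S e = (\<Union>v\<in>e. L e v) \<union> U e" for e
  have UU: "U e \<inter> U f = {}" if ef: "e \<in> edges D" "f \<in> edges D" "e \<noteq> f" for e f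
  proof (rule ccontr)
    assume "\<not> ?thesis"
    then obtain z x y where z: "x \<in> C e" "y \<in> C f" "dist x z < \<epsilon>" "dist y z < \<epsilon>" by (auto simp: U_def)
    have "dist x y \<le> dist x z + dist y z" by (rule dist_triangle2)
    moreover have "dd e f \<le> dist x y" using dd[OF ef] z by (auto simp: M_def)
    ultimately show False using z epsd[OF ef] by linarith
  qed
  have UL: "U e \<inter> L f v = {}" if ef: "e \<in> edges D" "f \<in> edges D" "e \<noteq> f" and v: "v \<in> f" for e f v
  proof (rule ccontr)
    assume "\<not> ?thesis"
    then obtain z x where z: "x \<in> C e" "z \<in> L f v" "dist x z < \<epsilon>" by (auto simp: U_def)
    have "dd e f \<le> dist x z" using dd[OF ef] z v by (auto simp: M_def)
    then show False using z epsd[OF ef] eps(1) by linarith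
  qed
  have SS: "S e \<inter> S f \<subseteq> pt ` (e \<inter> f)" if ef: "e \<in> edges D" "f \<in> edges D" "e \<noteq> f" for e f
    using UU[OF ef] UL[OF ef] UL[OF ef(2,1) ef(3)[symmetric]] LL[OF ef] unfolding S_def by fast
  have SV: "v \<in> e" if e: "e \<in> edges D" and v: "v \<in> pverts D" "pt v \<in> S e" for e v
  proof (rule ccontr)
    assume ve: "v \<notin> e"
    have "\<epsilon> < r" using eps(2) by (rule bspec) simp
    consider x where "x \<in> e" "pt v \<in> L e x" | x where "x \<in> C e" "dist x (pt v) < \<epsilon>"
      using v(2) unfolding S_def U_def by auto
    then show False
    proof cases
      case 1
      then have "dist (pt x) (pt v) \<le> r" using Lr[OF e] by blast
      moreover have "2 * r < dist (pt x) (pt v)" using sep[of x v] sub[OF e] 1 v(1) ve by auto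
      ultimately show False using r(1) by linarith
    next
      case 2
      then show False using far[OF e v(1) ve 2(1)] \<open>\<epsilon> < r\<close> by (simp add: dist_commute)
    qed
  qed
  have "\<exists>ys. schain ys \<and> 2 \<le> length ys \<and> {hd ys, last ys} = pt ` e \<and> poly ys \<subseteq> S e" if e: "e \<in> edges D" for e
  proof -
    let ?R = "{(x, y). closed_segment x y \<subseteq> S e}"
    have "(pathstart (c e), pathfinish (c e)) \<in> {(x, y). closed_segment x y \<subseteq> U e}\<^sup>*"
      unfolding U_def C_def using c[OF e] eps(1) by (intro path_chain) auto
    moreover have "{(x, y). closed_segment x y \<subseteq> U e}\<^sup>* \<subseteq> ?R\<^sup>*"
      by (intro rtrancl_mono) (auto simp: S_def)
    moreover have "(pt (u e), pathstart (c e)) \<in> ?R"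
      using uw[OF e] by (auto simp: S_def L_def sp_def)
    moreover have "closed_segment (pathfinish (c e)) (pt (w e)) = L e (w e)"
      using uw[OF e] by (auto simp: L_def sp_def closed_segment_commute)
    then have "(pathfinish (c e), pt (w e)) \<in> ?R"
      using uw[OF e] by (auto simp: S_def)
    ultimately have "(pt (u e), pt (w e)) \<in> ?R\<^sup>*"
      by (meson converse_rtrancl_into_rtrancl in_mono rtrancl.rtrancl_into_rtrancl)
    then obtain zs where zs: "zs \<noteq> []" "hd zs = pt (u e)" "last zs = pt (w e)"
      "\<And>i. Suc i < length zs \<Longrightarrow> (zs ! i, zs ! Suc i) \<in> ?R"
      by (rule rtrancl_simple_path) blast
    have ch: "chain_in (S e) zs" using zs(4) by (simp add: successively_conv_nth)
    have ne: "pt (u e) \<noteq> pt (w e)" using sep[OF uwV[OF e]] uw[OF e] r(1) by force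
    obtain ys where ys: "schain ys" "chain_in (S e) ys" "hd ys = pt (u e)" "last ys = pt (w e)" "2 \<le> length ys"
      by (rule simple_chain_exists[OF zs(1-3) ch ne])
    have "poly ys \<subseteq> S e" using chain_in_seg[OF ys(2)] by (auto simp: poly_def)
    moreover have "pt ` e = pt ` {u e, w e}" using uw[OF e] by simp
    then have "{hd ys, last ys} = pt ` e" using ys by simp
    ultimately show ?thesis using ys by blast
  qed
  then obtain xs where xs: "\<And>e. e \<in> edges D \<Longrightarrow> schain (xs e) \<and> 2 \<le> length (xs e) \<and> {hd (xs e), last (xs e)} = pt ` e \<and> poly (xs e) \<subseteq> S e"
    by metis
  show ?thesis
  proof (rule that[of pt xs])
    show "v \<in> e" if "e \<in> edges D" "v \<in> pverts D" "pt v \<in> poly (xs e)" for e v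
      using SV[OF that(1,2)] xs[OF that(1)] that(3) by blast
    show "poly (xs e) \<inter> poly (xs f) \<subseteq> pt ` (e \<inter> f)" if "e \<in> edges D" "f \<in> edges D" "e \<noteq> f" for e f
      using SS[OF that] xs[OF that(1)] xs[OF that(2)] by blast
  qed (use inj xs in auto)
qed

section \<open>Subdivision into straight segments\<close>

definition wedge :: "complex \<Rightarrow> complex \<Rightarrow> real" where
  "wedge u v = Re u * Im v - Im u * Re v"

lemma wedge_simps:
  "wedge (u + u') v = wedge u v + wedge u' v" "wedge u (v + v') = wedge u v + wedge u v'"
  "wedge (u - u') v = wedge u v - wedge u' v" "wedge u (v - v') = wedge u v - wedge u v'"
  "wedge (t *\<^sub>R u) v = t * wedge u v" "wedge u (t *\<^sub>R v) = t * wedge u v"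
  "wedge (- u) v = - wedge u v" "wedge u u = 0" "wedge u 0 = 0" "wedge 0 v = 0"
  by (simp_all add: wedge_def algebra_simps)

lemma wedge_times_i: "wedge u (\<i> * z) = inner u z"
  by (simp add: wedge_def inner_complex_def)

text \<open>The sum of the unit directions before and after the bend, turned by a quarter: it
  bisects the angle at \<open>b\<close> and points to the left of both segments.\<close>

definition bend_normal :: "complex \<Rightarrow> complex \<Rightarrow> complex \<Rightarrow> complex" where
  "bend_normal a b c = \<i> * (sgn (b - a) + sgn (c - b))"

text \<open>The value is \<open>norm u + inner u v / norm v\<close>. By Cauchy-Schwarz the second
  summand is at least \<open>- norm u\<close>, and the hypothesis excludes equality.\<close>

lemma bend_inner_pos:
  fixes u v :: complex
  assumes "u \<noteq> 0" "v \<noteq> 0" "inner u v \<noteq> - (norm u * norm v)"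
  shows "0 < inner u (sgn u + sgn v)"
proof -
  have "\<bar>inner u v\<bar> \<le> norm u * norm v" by (rule Cauchy_Schwarz_ineq2)
  then have "- (norm u * norm v) < inner u v" using assms(3) by linarith
  then have "- norm u < inner u v / norm v" using assms(2) by (simp add: field_simps)
  moreover have "inner u (sgn u + sgn v) = norm u + inner u v / norm v"
    using assms(1) by (simp add: sgn_div_norm inner_add_right dot_square_norm power2_eq_square divide_inverse_commute)
  ultimately show ?thesis by linarith
qed

text \<open>The equality case of Cauchy-Schwarz is a line that turns back on itself; then
  \<open>c\<close> lies on the segment before the bend or \<open>a\<close> on the one after
  it.\<close>

lemma bend_normal_pos:
  assumes "a \<noteq> b" "b \<noteq> c" "closed_segment a b \<inter> closed_segment b c \<subseteq> {b}"
  shows "0 < wedge (b - a) (bend_normal a b c)" "0 < wedge (c - b) (bend_normal a b c)"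
proof -
  let ?u = "b - a" and ?v = "c - b"
  have n: "inner ?u ?v \<noteq> - (norm ?u * norm ?v)"
  proof
    assume "inner ?u ?v = - (norm ?u * norm ?v)"
    then have "inner ?u (- ?v) = norm ?u * norm (- ?v)" by (simp only: inner_minus_right norm_minus_cancel)
    then have eq: "norm ?u *\<^sub>R (- ?v) = norm (- ?v) *\<^sub>R ?u" unfolding norm_cauchy_schwarz_eq .
    define t where "t = norm ?v / norm ?u"
    have t: "0 < t" using assms(1,2) by (simp add: t_def)
    have "(1 / norm ?u) *\<^sub>R (norm ?u *\<^sub>R (- ?v)) = (1 / norm ?u) *\<^sub>R (norm ?v *\<^sub>R ?u)"
      by (simp only: eq norm_minus_cancel)
    then have v: "- ?v = t *\<^sub>R ?u" using assms(1) by (simp add: t_def)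
    then have c: "c = b + t *\<^sub>R (a - b)" by (simp add: algebra_simps)
    show False
    proof (cases "t \<le> 1")
      case True
      then have "c \<in> closed_segment b a" using c t unfolding closed_segment_iff by (intro exI[of _ t]) simp
      then show False using assms by (auto simp: closed_segment_commute)
    next
      case False
      have "a = b + (1 / t) *\<^sub>R (c - b)" using c t by simp
      then have "a \<in> closed_segment b c" using False t unfolding closed_segment_iff
        by (intro exI[of _ "1/t"]) auto
      then show False using assms by auto
    qed
  qed
  show "0 < wedge ?u (bend_normal a b c)"
    unfolding bend_normal_def wedge_times_i using assms n by (intro bend_inner_pos) auto
  show "0 < wedge ?v (bend_normal a b c)"
    unfolding bend_normal_def wedge_times_i add.commute[of "sgn ?u"]
    using assms n by (intro bend_inner_pos) (auto simp: inner_commute mult.commute)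
qed

text \<open>Every vertex outside W is a bend of a polygonal edge; nu points to the same side along the
  whole edge.\<close>

definition bends :: "complex rel \<Rightarrow> complex set \<Rightarrow> (complex \<Rightarrow> complex) \<Rightarrow> bool" where
  "bends E W \<nu> \<longleftrightarrow>
    (\<forall>a b. (a, b) \<in> E \<longrightarrow> b \<notin> W \<longrightarrow> wedge (a - b) (\<nu> b) \<noteq> 0) \<and>
    (\<forall>a b c. (a, b) \<in> E \<longrightarrow> (c, b) \<in> E \<longrightarrow> a \<noteq> c \<longrightarrow> b \<notin> W \<longrightarrow> wedge (a - b) (\<nu> b) * wedge (c - b) (\<nu> b) < 0) \<and>
    (\<forall>a b. (a, b) \<in> E \<longrightarrow> a \<notin> W \<longrightarrow> b \<notin> W \<longrightarrow> 0 < wedge (b - a) (\<nu> a) * wedge (b - a) (\<nu> b))"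

abbreviation straight :: "complex pair_pre_digraph \<Rightarrow> bool" where
  "straight H \<equiv> pdraw H (\<lambda>e. convex hull e)"

text \<open>Every corner of a polygonal edge becomes a vertex, and \<open>own\<close> remembers
  which edge of \<open>D\<close> a corner subdivides. The two connectivity clauses concern the
  subdivided edge without its far end and with both ends: an edge may enter a set of vertices as a
  pendant path or as a link.\<close>

lemma straight_subdivision:
  fixes D :: "'b pair_pre_digraph"
  assumes "pair_graph D" "planar D"
  obtains H :: "complex pair_pre_digraph" and pt :: "'b \<Rightarrow> complex" and own :: "complex \<Rightarrow> 'b set" and \<nu> :: "complex \<Rightarrow> complex"
  where "straight H" "inj_on pt (pverts D)" "pt ` pverts D \<subseteq> pverts H"
    "\<And>b. b \<in> pverts H \<Longrightarrow> b \<notin> pt ` pverts D \<Longrightarrow> own b \<in> edges D"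
    "\<And>x y. (x, y) \<in> parcs D \<Longrightarrow> conn (parcs H) (insert (pt x) {b \<in> pverts H - pt ` pverts D. own b = {x, y}})"
    "\<And>x y. (x, y) \<in> parcs D \<Longrightarrow> conn (parcs H) ({pt x, pt y} \<union> {b \<in> pverts H - pt ` pverts D. own b = {x, y}})"
    "bends (parcs H) (pt ` pverts D) \<nu>"
proof -
  have G: "finite (pverts D)" "parcs D \<subseteq> pverts D \<times> pverts D" "\<And>a b. (a, b) \<in> parcs D \<Longrightarrow> a \<noteq> b"
    using assms(1) by (auto simp: pair_graph_iff)
  have finE: "finite (edges D)" using G(1,2) unfolding edges_def by (meson finite_SigmaI finite_imageI finite_subset)
  have sub: "e \<subseteq> pverts D" if "e \<in> edges D" for e using that G(2) by (auto simp: edges_def)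
  obtain pt :: "'b \<Rightarrow> complex" and xs where inj: "inj_on pt (pverts D)"
    and xs: "\<And>e. e \<in> edges D \<Longrightarrow> schain (xs e) \<and> 2 \<le> length (xs e) \<and> {hd (xs e), last (xs e)} = pt ` e"
    and av: "\<And>e v. e \<in> edges D \<Longrightarrow> v \<in> pverts D \<Longrightarrow> pt v \<in> poly (xs e) \<Longrightarrow> v \<in> e"
    and dj: "\<And>e f. e \<in> edges D \<Longrightarrow> f \<in> edges D \<Longrightarrow> e \<noteq> f \<Longrightarrow> poly (xs e) \<inter> poly (xs f) \<subseteq> pt ` (e \<inter> f)"
    using planar_polygonal[OF assms] by blast
  define n where "n e = length (xs e)" for e
  define X where "X e i = xs e ! i" for e i
  have n2: "2 \<le> n e" if "e \<in> edges D" for e using xs[OF that] by (simp add: n_def)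
  have ends: "{X e 0, X e (n e - 1)} = pt ` e" if "e \<in> edges D" for e
  proof -
    have "xs e \<noteq> []" using n2[OF that] by (auto simp: n_def)
    then show ?thesis using xs[OF that] by (simp add: X_def n_def hd_conv_nth last_conv_nth)
  qed
  have Xinj: "i = j" if "e \<in> edges D" "i < n e" "j < n e" "X e i = X e j" for e i j
    using schain_distinct[of "xs e"] xs[OF that(1)] that by (simp add: X_def n_def nth_eq_iff_index_eq)
  have Xne: "X e i \<noteq> X e (Suc i)" if "e \<in> edges D" "Suc i < n e" for e i
    using Xinj[OF that(1), of i "Suc i"] that by auto
  have segpoly: "closed_segment (X e i) (X e (Suc i)) \<subseteq> poly (xs e)" if "Suc i < n e" for e i
    using that by (auto simp: poly_def X_def n_def)
  have Xpoly: "X e i \<in> poly (xs e)" if "e \<in> edges D" "i < n e" for e i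
  proof (cases "Suc i < n e")
    case True then show ?thesis using segpoly[OF True] by auto
  next
    case False
    then have "Suc (i - 1) < n e" "Suc (i - 1) = i" using that n2[OF that(1)] by auto
    then show ?thesis using segpoly[of "i - 1" e] by auto
  qed
  let ?W = "pt ` pverts D"
  have XW: "i = 0 \<or> i = n e - 1" if e: "e \<in> edges D" "i < n e" "X e i \<in> ?W" for e i
  proof -
    obtain v where v: "v \<in> pverts D" "X e i = pt v" using e(3) by auto
    then have "v \<in> e" using av[OF e(1) v(1)] Xpoly[OF e(1,2)] by simp
    then have "X e i \<in> {X e 0, X e (n e - 1)}" using ends[OF e(1)] v by auto
    then show ?thesis using Xinj[OF e(1,2), of 0] Xinj[OF e(1,2), of "n e - 1"] n2[OF e(1)] by auto
  qed
  have WX: "X e 0 \<in> ?W" "X e (n e - 1) \<in> ?W" if "e \<in> edges D" for e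
    using ends[OF that] sub[OF that] by blast+
  have uniq: "e = f \<and> i = j"
    if "e \<in> edges D" "i < n e" "f \<in> edges D" "j < n f" "X e i = X f j" "X e i \<notin> ?W" for e f i j
  proof -
    have "e = f"
    proof (rule ccontr)
      assume "e \<noteq> f"
      then have "X e i \<in> pt ` (e \<inter> f)" using dj[OF that(1,3)] Xpoly[OF that(1,2)] Xpoly[OF that(3,4)] that(5) by auto
      then show False using that(6) sub[OF that(1)] by blast
    qed
    then show ?thesis using Xinj that by blast
  qed
  define HV where "HV = ?W \<union> (\<Union>e\<in>edges D. X e ` {..<n e})"
  define A where "A = {(a, b). \<exists>e i. e \<in> edges D \<and> Suc i < n e \<and> a = X e i \<and> b = X e (Suc i)}"
  define H where "H = \<lparr>pverts = HV, parcs = A \<union> A\<inverse>\<rparr>"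
  have HVmem: "X e i \<in> HV" if "e \<in> edges D" "i < n e" for e i using that by (auto simp: HV_def)
  have AE: "\<exists>e i. e \<in> edges D \<and> Suc i < n e \<and> {a, b} = {X e i, X e (Suc i)}" if "(a, b) \<in> parcs H" for a b
    using that by (auto simp: H_def A_def)
  have on_seg: "z \<in> {X e i, X e (Suc i)}"
    if e: "e \<in> edges D" "Suc i < n e" and z: "z \<in> HV" "z \<in> closed_segment (X e i) (X e (Suc i))" for e i z
  proof -
    have same: "z \<in> {X e i, X e (Suc i)}" if "z = X e j" "j < n e" for j
      using schain_mem[of "xs e" i j] xs[OF e(1)] e(2) z(2) that by (auto simp: X_def n_def)
    have zp: "z \<in> poly (xs e)" using segpoly[OF e(2)] z(2) by blast
    show ?thesis
    proof (cases "z \<in> ?W")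
      case True
      then obtain v where v: "v \<in> pverts D" "z = pt v" by auto
      then have "z \<in> {X e 0, X e (n e - 1)}" using av[OF e(1) v(1)] zp ends[OF e(1)] by auto
      then show ?thesis using same[of 0] same[of "n e - 1"] n2[OF e(1)] by auto
    next
      case False
      then obtain f j where f: "f \<in> edges D" "j < n f" "z = X f j" using z(1) by (auto simp: HV_def)
      have "f = e"
      proof (rule ccontr)
        assume "f \<noteq> e"
        then have "z \<in> pt ` (f \<inter> e)" using dj[OF f(1) e(1)] Xpoly[OF f(1,2)] f(3) zp by auto
        then show False using False sub[OF e(1)] by blast
      qed
      then show ?thesis using same f by blast
    qed
  qed
  have symH: "sym (parcs H)" by (auto simp: H_def sym_def)
  have "straight H"
    unfolding pdraw_def
  proof (intro conjI allI impI)
    have "finite HV" using G(1) finE by (auto simp: HV_def)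
    moreover have "parcs H \<subseteq> HV \<times> HV" by (auto simp: H_def A_def intro!: HVmem)
    moreover have "\<forall>a b. (a, b) \<in> parcs H \<longrightarrow> a \<noteq> b" using Xne by (fastforce simp: H_def A_def)
    ultimately show "pair_graph H" using symH unfolding pair_graph_iff by (simp add: H_def)
  next
    fix a b assume ab: "(a, b) \<in> parcs H"
    then obtain e i where ei: "e \<in> edges D" "Suc i < n e" "{a, b} = {X e i, X e (Suc i)}" using AE by blast
    have "a \<noteq> b" using ei Xne[OF ei(1,2)] by (auto simp: doubleton_eq_iff)
    then show "pline a b (convex hull {a, b})" using pline.segment[of a b] by (simp add: segment_convex_hull)
    have "convex hull {a, b} = closed_segment (X e i) (X e (Suc i))" unfolding ei(3) segment_convex_hull ..
    then show "convex hull {a, b} \<inter> pverts H \<subseteq> {a, b}"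
      using on_seg[OF ei(1,2)] ei(3) by (auto simp: H_def)
  next
    fix a b c d assume ab: "(a, b) \<in> parcs H" and cd: "(c, d) \<in> parcs H" and ne: "{a, b} \<noteq> {c, d}"
    obtain e i where ei: "e \<in> edges D" "Suc i < n e" "{a, b} = {X e i, X e (Suc i)}" using AE[OF ab] by blast
    obtain f j where fj: "f \<in> edges D" "Suc j < n f" "{c, d} = {X f j, X f (Suc j)}" using AE[OF cd] by blast
    have eq: "convex hull {a, b} = closed_segment (X e i) (X e (Suc i))" "convex hull {c, d} = closed_segment (X f j) (X f (Suc j))"
      unfolding ei(3) fj(3) segment_convex_hull by auto
    show "convex hull {a, b} \<inter> convex hull {c, d} \<subseteq> {a, b} \<inter> {c, d}"
    proof
      fix z assume z: "z \<in> convex hull {a, b} \<inter> convex hull {c, d}"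
      have zs: "z \<in> closed_segment (X e i) (X e (Suc i))" "z \<in> closed_segment (X f j) (X f (Suc j))"
        using z unfolding eq by auto
      have "z \<in> HV"
      proof (cases "e = f")
        case True
        have "i \<noteq> j" using ne ei fj True by auto
        have *: "z \<in> HV" if "i < j" "Suc j < n e" "z \<in> closed_segment (X e i) (X e (Suc i))" "z \<in> closed_segment (X e j) (X e (Suc j))" for i j
        proof -
          have "z \<in> (if j = Suc i then {X e j} else {})"
            using xs[OF ei(1)] that unfolding schain_def X_def n_def by blast
          then show ?thesis using HVmem[OF ei(1), of j] that by (auto split: if_splits)
        qed
        show ?thesis using *[of i j] *[of j i] \<open>i \<noteq> j\<close> zs ei(2) fj(2) True by (cases "i < j") auto
      next
        case False
        then have "z \<in> pt ` (e \<inter> f)"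
          using dj[OF ei(1) fj(1)] segpoly[OF ei(2)] segpoly[OF fj(2)] zs by blast
        then show ?thesis using sub[OF ei(1)] by (auto simp: HV_def)
      qed
      then show "z \<in> {a, b} \<inter> {c, d}"
        using on_seg[OF ei(1,2)] on_seg[OF fj(1,2)] zs unfolding ei(3) fj(3) by blast
    qed
  qed
  \<comment> \<open>Edge and position of an inner corner, which are determined by
    \<open>uniq\<close>.\<close>
  define loc where "loc b = (SOME p. fst p \<in> edges D \<and> 0 < snd p \<and> Suc (snd p) < n (fst p) \<and> b = X (fst p) (snd p))" for b
  have loc: "loc (X e i) = (e, i)" if e: "e \<in> edges D" "0 < i" "Suc i < n e" for e i
    unfolding loc_def
  proof (rule some_equality)
    fix p assume p: "fst p \<in> edges D \<and> 0 < snd p \<and> Suc (snd p) < n (fst p) \<and> X e i = X (fst p) (snd p)"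
    have "X e i \<notin> ?W" using XW[OF e(1), of i] e by auto
    then have "e = fst p \<and> i = snd p" using p e by (intro uniq) auto
    then show "p = (e, i)" by (auto simp: prod_eq_iff)
  qed (use e in auto)
  define own where "own b = fst (loc b)" for b
  \<comment> \<open>The normals of all corners of an edge are taken along the same direction of
    travel, hence all point to its left.\<close>
  define \<nu> where "\<nu> b = (case loc b of (e, i) \<Rightarrow> bend_normal (X e (i - 1)) (X e i) (X e (Suc i)))" for b
  have interior: "\<exists>e i. e \<in> edges D \<and> 0 < i \<and> Suc i < n e \<and> b = X e i" if b: "b \<in> HV" "b \<notin> ?W" for b
  proof -
    obtain e i where ei: "e \<in> edges D" "i < n e" "b = X e i" using b by (auto simp: HV_def)
    have "i \<noteq> 0" "i \<noteq> n e - 1" using WX[OF ei(1)] ei(3) b(2) by auto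
    then show ?thesis using ei by (intro exI[of _ e] exI[of _ i]) auto
  qed
  have own_set: "{b \<in> pverts H - ?W. own b = e} = X e ` {0<..<n e - 1}" if e: "e \<in> edges D" for e
  proof (intro set_eqI iffI)
    fix b assume b: "b \<in> {b \<in> pverts H - ?W. own b = e}"
    then obtain f i where f: "f \<in> edges D" "0 < i" "Suc i < n f" "b = X f i"
      using interior[of b] by (auto simp: H_def)
    then have "f = e" using loc[OF f(1-3)] b by (simp add: own_def)
    then show "b \<in> X e ` {0<..<n e - 1}" using f by auto
  next
    fix b assume "b \<in> X e ` {0<..<n e - 1}"
    then obtain i where i: "0 < i" "Suc i < n e" "b = X e i" by auto
    then have "b \<notin> ?W" using XW[OF e, of i] by auto
    moreover have "b \<in> HV" using HVmem[OF e, of i] i by simp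
    ultimately show "b \<in> {b \<in> pverts H - ?W. own b = e}" using loc[OF e i(1,2)] i by (simp add: own_def H_def)
  qed
  have interval: "conn (parcs H) (X e ` {l..h})" if e: "e \<in> edges D" and lh: "l \<le> h" "h < n e" for e l h
    using lh
  proof (induction h)
    case (Suc h)
    show ?case
    proof (cases "l = Suc h")
      case False
      then have "conn (parcs H) (X e ` {l..h})" using Suc by auto
      moreover have "(X e h, X e (Suc h)) \<in> parcs H" using Suc.prems e by (auto simp: H_def A_def)
      ultimately have "conn (parcs H) (X e ` {l..h} \<union> {X e (Suc h)})"
        using Suc.prems False by (intro conn_Un[OF symH, of _ _ "X e h" "X e (Suc h)"]) auto
      moreover have "{l..Suc h} = insert (Suc h) {l..h}" using Suc.prems by auto
      ultimately show ?thesis by simp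
    qed simp
  qed simp
  show ?thesis
  proof (rule that[OF \<open>straight H\<close> inj, of own \<nu>])
    show "?W \<subseteq> pverts H" by (auto simp: H_def HV_def)
    show "own b \<in> edges D" if "b \<in> pverts H" "b \<notin> ?W" for b
      using interior[of b] that loc by (force simp: own_def H_def)
    fix x y assume xy: "(x, y) \<in> parcs D"
    then have e: "{x, y} \<in> edges D" by (auto simp: edges_def)
    let ?e = "{x, y}"
    have I: "{0<..<n ?e - 1} \<union> {0} = {0..n ?e - 2}" "{0<..<n ?e - 1} \<union> {n ?e - 1} = {1..n ?e - 1}"
      "{0<..<n ?e - 1} \<union> {0, n ?e - 1} = {0..n ?e - 1}" using n2[OF e] by auto
    have pts: "{X ?e 0, X ?e (n ?e - 1)} = {pt x, pt y}" using ends[OF e] by simp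
    \<comment> \<open>It is not known which end of the chain is \<open>pt x\<close>, so the corners
      with \<open>pt x\<close> are either all positions but the last or all but the first.\<close>
    have "insert (pt x) (X ?e ` {0<..<n ?e - 1}) \<in> {X ?e ` {0..n ?e - 2}, X ?e ` {1..n ?e - 1}}"
      unfolding I[symmetric] image_Un using pts by (auto simp: doubleton_eq_iff)
    then show "conn (parcs H) (insert (pt x) {b \<in> pverts H - ?W. own b = {x, y}})"
      unfolding own_set[OF e] using interval[OF e, of 0 "n ?e - 2"] interval[OF e, of 1 "n ?e - 1"] n2[OF e] by auto
    have "{pt x, pt y} \<union> X ?e ` {0<..<n ?e - 1} = X ?e ` {0..n ?e - 1}"
      unfolding I(3)[symmetric] image_Un using pts by auto
    then show "conn (parcs H) ({pt x, pt y} \<union> {b \<in> pverts H - ?W. own b = {x, y}})"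
      unfolding own_set[OF e] using interval[OF e, of 0 "n ?e - 1"] n2[OF e] by auto
  next
    have pos: "0 < wedge (X e i - X e (i - 1)) (\<nu> (X e i))" "0 < wedge (X e (Suc i) - X e i) (\<nu> (X e i))"
      if e: "e \<in> edges D" "0 < i" "Suc i < n e" for e i
    proof -
      have "X e (i - 1) \<noteq> X e i" "X e i \<noteq> X e (Suc i)" using Xne[OF e(1), of "i - 1"] Xne[OF e(1,3)] e by auto
      moreover have "closed_segment (X e (i - 1)) (X e i) \<inter> closed_segment (X e i) (X e (Suc i)) \<subseteq> {X e i}"
      proof -
        have "seg (xs e) (i - 1) \<inter> seg (xs e) i \<subseteq> (if i = Suc (i - 1) then {xs e ! i} else {})"
          using xs[OF e(1)] e unfolding schain_def n_def by (metis diff_less zero_less_one)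
        then show ?thesis using e(2) by (simp add: X_def)
      qed
      ultimately show "0 < wedge (X e i - X e (i - 1)) (\<nu> (X e i))" "0 < wedge (X e (Suc i) - X e i) (\<nu> (X e i))"
        using bend_normal_pos unfolding \<nu>_def loc[OF e] by auto
    qed
    have nbr: "\<exists>e i. e \<in> edges D \<and> 0 < i \<and> Suc i < n e \<and> b = X e i \<and> (a = X e (i - 1) \<or> a = X e (Suc i))"
      if ab: "(a, b) \<in> parcs H" "b \<notin> ?W" for a b
    proof -
      have "b \<in> HV" using ab(1) \<open>straight H\<close> by (auto simp: pdraw_def pair_graph_iff H_def)
      then obtain e i where ei: "e \<in> edges D" "0 < i" "Suc i < n e" "b = X e i" using interior ab(2) by blast
      obtain f j where fj: "f \<in> edges D" "Suc j < n f" "{a, b} = {X f j, X f (Suc j)}" using AE[OF ab(1)] by blast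
      from fj(3) consider "a = X f j" "b = X f (Suc j)" | "a = X f (Suc j)" "b = X f j"
        unfolding doubleton_eq_iff by blast
      then show ?thesis
      proof cases
        case 1
        then have "e = f \<and> i = Suc j" using uniq[of e i f "Suc j"] ei fj(1,2) ab(2) by simp
        then show ?thesis using 1 ei by (intro exI[of _ e] exI[of _ i]) simp
      next
        case 2
        then have "e = f \<and> i = j" using uniq[of e i f j] ei fj(1,2) ab(2) by simp
        then show ?thesis using 2 ei by (intro exI[of _ e] exI[of _ i]) simp
      qed
    qed
    \<comment> \<open>Seen from an inner corner, the predecessor lies on the negative and the
      successor on the positive side of the line along the normal. The three clauses of
      \<open>bends\<close> are comparisons of these signs.\<close>
    have sgnb: "\<exists>e i. e \<in> edges D \<and> 0 < i \<and> Suc i < n e \<and> b = X e i \<and>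
      (a = X e (i - 1) \<and> wedge (a - b) (\<nu> b) < 0 \<or> a = X e (Suc i) \<and> 0 < wedge (a - b) (\<nu> b))"
      if ab: "(a, b) \<in> parcs H" "b \<notin> ?W" for a b
    proof -
      obtain e i where ei: "e \<in> edges D" "0 < i" "Suc i < n e" "b = X e i" "a = X e (i - 1) \<or> a = X e (Suc i)"
        using nbr[OF ab] by blast
      have "wedge (X e (i - 1) - X e i) (\<nu> (X e i)) = - wedge (X e i - X e (i - 1)) (\<nu> (X e i))"
        by (simp add: wedge_simps)
      then show ?thesis using ei pos[OF ei(1-3)] by (intro exI[of _ e] exI[of _ i]) auto
    qed
    show "bends (parcs H) ?W \<nu>"
      unfolding bends_def
    proof (intro conjI allI impI)
      fix a b assume "(a, b) \<in> parcs H" "b \<notin> ?W"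
      from sgnb[OF this] show "wedge (a - b) (\<nu> b) \<noteq> 0" by auto
    next
      fix a b c assume h: "(a, b) \<in> parcs H" "(c, b) \<in> parcs H" "a \<noteq> c" "b \<notin> ?W"
      obtain e i where ei: "e \<in> edges D" "0 < i" "Suc i < n e" "b = X e i"
        "a = X e (i - 1) \<and> wedge (a - b) (\<nu> b) < 0 \<or> a = X e (Suc i) \<and> 0 < wedge (a - b) (\<nu> b)"
        using sgnb[OF h(1,4)] by blast
      obtain f j where fj: "f \<in> edges D" "0 < j" "Suc j < n f" "b = X f j"
        "c = X f (j - 1) \<and> wedge (c - b) (\<nu> b) < 0 \<or> c = X f (Suc j) \<and> 0 < wedge (c - b) (\<nu> b)"
        using sgnb[OF h(2,4)] by blast
      have "e = f \<and> i = j" using uniq[of e i f j] ei fj h(4) by auto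
      then show "wedge (a - b) (\<nu> b) * wedge (c - b) (\<nu> b) < 0"
        using ei(5) fj(5) h(3) by (auto simp: mult_less_0_iff)
    next
      fix a b assume h: "(a, b) \<in> parcs H" "a \<notin> ?W" "b \<notin> ?W"
      obtain e i where ei: "e \<in> edges D" "0 < i" "Suc i < n e" "b = X e i"
        "a = X e (i - 1) \<and> wedge (a - b) (\<nu> b) < 0 \<or> a = X e (Suc i) \<and> 0 < wedge (a - b) (\<nu> b)"
        using sgnb[OF h(1,3)] by blast
      have ba: "(b, a) \<in> parcs H" using symH h(1) by (auto dest: symD)
      obtain f j where fj: "f \<in> edges D" "0 < j" "Suc j < n f" "a = X f j"
        "b = X f (j - 1) \<and> wedge (b - a) (\<nu> a) < 0 \<or> b = X f (Suc j) \<and> 0 < wedge (b - a) (\<nu> a)"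
        using sgnb[OF ba h(2)] by blast
      have w: "wedge (b - a) (\<nu> b) = - wedge (a - b) (\<nu> b)" by (simp add: wedge_simps)
      from ei(5) show "0 < wedge (b - a) (\<nu> a) * wedge (b - a) (\<nu> b)"
      proof
        assume l: "a = X e (i - 1) \<and> wedge (a - b) (\<nu> b) < 0"
        then have "f = e \<and> j = i - 1" using uniq[of f j e "i - 1"] ei fj h(2) by auto
        moreover have "X e (i - 1 - 1) \<noteq> X e i" using Xinj[OF ei(1), of "i - 1 - 1" i] ei by force
        ultimately have "0 < wedge (b - a) (\<nu> a)" using fj(5) ei by auto
        moreover have "0 < wedge (b - a) (\<nu> b)" using l w by linarith
        ultimately show ?thesis by (rule mult_pos_pos)
      next
        assume l: "a = X e (Suc i) \<and> 0 < wedge (a - b) (\<nu> b)"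
        then have "f = e \<and> j = Suc i" using uniq[of f j e "Suc i"] ei fj h(2) by auto
        moreover have "X e (Suc (Suc i)) \<noteq> X e i" using Xinj[OF ei(1), of "Suc (Suc i)" i] fj calculation by force
        ultimately have "wedge (b - a) (\<nu> a) < 0" using fj(5) ei by auto
        moreover have "wedge (b - a) (\<nu> b) < 0" using l w by linarith
        ultimately show ?thesis by (rule mult_neg_neg)
      qed
    qed
  qed
qed

section \<open>General position and parallel segments\<close>

lemma wedge_segment: "z \<in> closed_segment a b \<Longrightarrow> wedge (b - a) (z - a) = 0"
  unfolding closed_segment_iff by (auto simp: wedge_simps(6,8))

lemma wedge_rotate: "wedge (c - b) (a - b) = wedge (b - a) (c - a)" "wedge (c - a) (b - a) = - wedge (b - a) (c - a)"
  by (simp_all add: wedge_def algebra_simps)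

lemma wedge_eq_inner: "wedge u v = inner (\<i> * u) v"
  by (simp add: wedge_def inner_complex_def)

lemma segments_meet_at_common_end:
  assumes "wedge (b - a) (c - a) \<noteq> 0" "z \<in> closed_segment b a" "z \<in> closed_segment b c"
  shows "z = b"
proof (rule ccontr)
  assume "z \<noteq> b"
  from segments_common_ray[OF assms(2,3) this] have "wedge (c - b) (a - b) = 0"
    using wedge_segment[of a b c] wedge_segment[of c b a] wedge_rotate(2)[of c b a] by auto
  then show False using assms(1) wedge_rotate(1) by simp
qed

text \<open>Two common points force both segments onto one line, so \<open>c\<close> would lie on
  the line through \<open>a\<close> and \<open>b\<close>.\<close>

lemma segments_meet_once:
  assumes "wedge (b - a) (c - a) \<noteq> 0"
    "z \<in> closed_segment a b" "z \<in> closed_segment c d" "z' \<in> closed_segment a b" "z' \<in> closed_segment c d"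
  shows "z = z'"
proof (rule ccontr)
  assume "z \<noteq> z'"
  obtain s s' t t' where p: "z = a + s *\<^sub>R (b - a)" "z' = a + s' *\<^sub>R (b - a)" "z = c + t *\<^sub>R (d - c)" "z' = c + t' *\<^sub>R (d - c)"
    using assms(2-5) unfolding closed_segment_iff by blast
  have zz: "z' - z = (t' - t) *\<^sub>R (d - c)" unfolding p(3) p(4) by (simp add: algebra_simps)
  then have "t' \<noteq> t" using \<open>z \<noteq> z'\<close> by auto
  have "(t' - t) *\<^sub>R (z - c) = t *\<^sub>R (z' - z)" unfolding zz using p(3) by simp
  then have "(t' - t) * wedge (b - a) (z - c) = t * wedge (b - a) (z' - z)"
    by (metis wedge_simps(6))
  moreover have "wedge (b - a) (z' - z) = 0" "wedge (b - a) (z - a) = 0"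
  proof -
    have "z' - z = (s' - s) *\<^sub>R (b - a)" unfolding p(1) p(2) by (simp add: algebra_simps)
    then show "wedge (b - a) (z' - z) = 0" by (simp only: wedge_simps(6,8))
    show "wedge (b - a) (z - a) = 0" using wedge_segment[OF assms(2)] .
  qed
  ultimately have "wedge (b - a) (z - c) = 0" using \<open>t' \<noteq> t\<close> by simp
  then have "wedge (b - a) (c - a) = 0" using \<open>wedge (b - a) (z - a) = 0\<close> by (simp add: wedge_simps)
  with assms(1) show False by simp
qed

text \<open>Concurrency is excluded only for three segments with six distinct ends: by the second
  clause, segments that share just one end meet nowhere else.\<close>

definition generic :: "'i set \<Rightarrow> ('i \<Rightarrow> complex) \<Rightarrow> bool" where
  "generic I g \<longleftrightarrow> inj_on g I \<and>
    (\<forall>i\<in>I. \<forall>j\<in>I. \<forall>k\<in>I. i \<noteq> j \<longrightarrow> i \<noteq> k \<longrightarrow> j \<noteq> k \<longrightarrow> wedge (g j - g i) (g k - g i) \<noteq> 0) \<and>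
    (\<forall>a\<in>I. \<forall>b\<in>I. \<forall>c\<in>I. \<forall>d\<in>I. \<forall>e\<in>I. \<forall>f\<in>I. distinct [a, b, c, d, e, f] \<longrightarrow>
      closed_segment (g a) (g b) \<inter> closed_segment (g c) (g d) \<inter> closed_segment (g e) (g f) = {})"

lemma finite_if_all_eq: "(\<And>x y. x \<in> S \<Longrightarrow> y \<in> S \<Longrightarrow> x = y) \<Longrightarrow> finite S \<and> card S \<le> 1"
proof -
  assume "\<And>x y. x \<in> S \<Longrightarrow> y \<in> S \<Longrightarrow> x = y"
  then have "S = {} \<or> (\<exists>x. S = {x})" by blast
  then show ?thesis by auto
qed

text \<open>The bad positions of the new point are the old points and finitely many lines, each
  through an old point and through another old point or an intersection of two old segments.
  Together they are negligible, while a ball is not.\<close>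

lemma generic_insert:
  assumes gen: "generic I g" and fin: "finite I" and i: "i \<notin> I" and "0 < \<epsilon>"
  obtains z where "dist p z < \<epsilon>" "generic (insert i I) (g(i := z))"
proof -
  have inj: "inj_on g I"
    and ncol: "\<And>i j k. i \<in> I \<Longrightarrow> j \<in> I \<Longrightarrow> k \<in> I \<Longrightarrow> i \<noteq> j \<Longrightarrow> i \<noteq> k \<Longrightarrow> j \<noteq> k \<Longrightarrow> wedge (g j - g i) (g k - g i) \<noteq> 0"
    and nconc: "\<And>a b c d e f. a \<in> I \<Longrightarrow> b \<in> I \<Longrightarrow> c \<in> I \<Longrightarrow> d \<in> I \<Longrightarrow> e \<in> I \<Longrightarrow> f \<in> I \<Longrightarrow> distinct [a, b, c, d, e, f] \<Longrightarrow>
      closed_segment (g a) (g b) \<inter> closed_segment (g c) (g d) \<inter> closed_segment (g e) (g f) = {}"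
    using gen unfolding generic_def by simp_all
  define X where "X = (\<lambda>(a, b, c, d). if distinct [a, b, c, d]
    then closed_segment (g a) (g b) \<inter> closed_segment (g c) (g d) else {})"
  define Q where "Q = g ` I \<union> (\<Union>t\<in>I \<times> I \<times> I \<times> I. X t)"
  have "finite (X t)" if "t \<in> I \<times> I \<times> I \<times> I" for t
  proof -
    obtain a b c d where t: "t = (a, b, c, d)" by (cases t)
    show ?thesis
    proof (cases "distinct [a, b, c, d]")
      case True
      then have "wedge (g b - g a) (g c - g a) \<noteq> 0" using that t by (intro ncol) auto
      then have "x = y" if "x \<in> X t" "y \<in> X t" for x y
        using that True segments_meet_once[of "g b" "g a" "g c" x "g d" y] by (auto simp: X_def t)
      from finite_if_all_eq[OF this] show ?thesis by blast
    qed (auto simp: X_def t)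
  qed
  then have finQ: "finite Q" using fin by (auto simp: Q_def)
  define Bad where "Bad = g ` I \<union> (\<Union>(x, y)\<in>{(x, y). (x, y) \<in> g ` I \<times> Q \<and> x \<noteq> y}. {z. wedge (y - x) (z - x) = 0})"
  have "negligible {z. wedge (y - x) (z - x) = 0}" if "x \<noteq> y" for x y :: complex
  proof -
    have "{z. wedge (y - x) (z - x) = 0} = {z. inner (\<i> * (y - x)) z = inner (\<i> * (y - x)) x}"
      by (simp add: wedge_eq_inner inner_diff_right)
    moreover have "negligible {z. inner (\<i> * (y - x)) z = inner (\<i> * (y - x)) x}"
      using that by (intro negligible_hyperplane) auto
    ultimately show ?thesis by simp
  qed
  then have "negligible (\<Union>(x, y)\<in>{(x, y). (x, y) \<in> g ` I \<times> Q \<and> x \<noteq> y}. {z. wedge (y - x) (z - x) = 0})"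
    using fin by (intro negligible_Union finite_imageI finite_Collect_pairs finQ) auto
  then have "negligible Bad" unfolding Bad_def
    using negligible_finite[OF finite_imageI[OF fin]] negligible_Un by blast
  moreover have "\<not> negligible (ball p \<epsilon>)" using \<open>0 < \<epsilon>\<close> by (intro open_not_negligible) auto
  ultimately obtain z where z: "z \<in> ball p \<epsilon>" "z \<notin> Bad" using negligible_subset by blast
  have zI: "z \<noteq> g a" if "a \<in> I" for a using z(2) that by (auto simp: Bad_def)
  have zl: "wedge (y - g a) (z - g a) \<noteq> 0" if "a \<in> I" "y \<in> Q" "g a \<noteq> y" for a y
    using z(2) that by (force simp: Bad_def)
  let ?g = "g(i := z)"
  have new3: "wedge (g k - g j) (z - g j) \<noteq> 0" if "j \<in> I" "k \<in> I" "j \<noteq> k" for j k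
    using that inj_onD[OF inj, of j k] by (intro zl) (auto simp: Q_def)
  have c1: "wedge (?g b - ?g a) (?g c - ?g a) \<noteq> 0"
    if abc: "a \<in> insert i I" "b \<in> insert i I" "c \<in> insert i I" "a \<noteq> b" "a \<noteq> c" "b \<noteq> c" for a b c
  proof -
    consider "a = i" "b \<in> I" "c \<in> I" | "b = i" "a \<in> I" "c \<in> I" | "c = i" "a \<in> I" "b \<in> I" | "a \<in> I" "b \<in> I" "c \<in> I"
      using abc by blast
    then show ?thesis
    proof cases
      case 1
      then show ?thesis using new3[of b c] abc wedge_rotate(1)[where a = z and b = "g b" and c = "g c"] by auto
    next
      case 2
      then show ?thesis using new3[of a c] abc i wedge_rotate(2)[where a = "g a" and b = "g c" and c = z] by auto
    next
      case 3
      then show ?thesis using new3[of a b] abc by auto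
    next
      case 4
      then show ?thesis using ncol[of a b c] abc i by auto
    qed
  qed
  \<comment> \<open>A common point \<open>y\<close> of the two old segments belongs to
    \<open>Q\<close>, and the new segment passes through it only if \<open>z\<close> lies on the
    forbidden line through \<open>g b\<close> and \<open>y\<close>.\<close>
  have new6: "closed_segment z (g b) \<inter> closed_segment (g c) (g d) \<inter> closed_segment (g e) (g f) = {}"
    if I: "b \<in> I" "c \<in> I" "d \<in> I" "e \<in> I" "f \<in> I" and ds: "distinct [b, c, d, e, f]" for b c d e f
  proof (rule ccontr)
    assume "\<not> ?thesis"
    then obtain y where y: "y \<in> closed_segment z (g b)" "y \<in> closed_segment (g c) (g d)" "y \<in> closed_segment (g e) (g f)" by blast
    have "y \<in> X (c, d, e, f)" using y ds by (auto simp: X_def)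
    then have "y \<in> Q" using I unfolding Q_def by blast
    moreover have "g b \<noteq> y"
      using ncol[of c d b] wedge_segment[OF y(2)] I ds by auto
    ultimately have "wedge (y - g b) (z - g b) \<noteq> 0" using zl I by blast
    moreover have "wedge (z - g b) (y - g b) = 0" using y(1) by (intro wedge_segment) (simp add: closed_segment_commute)
    ultimately show False using wedge_rotate(2)[of y "g b" z] by simp
  qed
  have c2: "closed_segment (?g a) (?g b) \<inter> closed_segment (?g c) (?g d) \<inter> closed_segment (?g e) (?g f) = {}"
    if I: "a \<in> insert i I" "b \<in> insert i I" "c \<in> insert i I" "d \<in> insert i I" "e \<in> insert i I" "f \<in> insert i I"
      and ds: "distinct [a, b, c, d, e, f]" for a b c d e f
  proof -
    have n: "?g x = g x" if "x \<noteq> i" for x using that by simp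
    have I': "x \<in> I" if "x \<in> insert i I" "x \<noteq> i" for x using that by simp
    consider "a = i" | "b = i" | "c = i" | "d = i" | "e = i" | "f = i" | "i \<notin> {a, b, c, d, e, f}" by blast
    then show ?thesis
    proof cases
      case 1 then show ?thesis using new6[of b c d e f] I ds by auto
    next
      case 2 then show ?thesis using new6[of a c d e f] I ds by (auto simp: closed_segment_commute)
    next
      case 3 then show ?thesis using new6[of d a b e f] I ds by (auto simp: Int_ac)
    next
      case 4 then show ?thesis using new6[of c a b e f] I ds by (auto simp: Int_ac closed_segment_commute)
    next
      case 5 then show ?thesis using new6[of f a b c d] I ds by (auto simp: Int_ac)
    next
      case 6 then show ?thesis using new6[of e a b c d] I ds by (auto simp: Int_ac closed_segment_commute)
    next
      case 7 then show ?thesis using nconc[of a b c d e f] I ds by auto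
    qed
  qed
  have "inj_on ?g (insert i I)"
    using inj zI i by (auto simp: inj_on_def)
  then have "generic (insert i I) ?g"
    unfolding generic_def by (intro conjI ballI impI c1 c2)
  then show ?thesis using that z(1) by auto
qed

lemma generic_perturbation:
  fixes p :: "'i \<Rightarrow> complex"
  assumes "finite I" "0 < \<epsilon>"
  obtains g where "generic I g" "\<And>i. i \<in> I \<Longrightarrow> dist (p i) (g i) < \<epsilon>"
proof -
  have "\<exists>g. generic I g \<and> (\<forall>i\<in>I. dist (p i) (g i) < \<epsilon>)"
    using assms(1)
  proof (induction I rule: finite_induct)
    case empty
    then show ?case by (simp add: generic_def)
  next
    case (insert i I)
    then obtain g where g: "generic I g" "\<forall>i\<in>I. dist (p i) (g i) < \<epsilon>" by blast
    obtain z where "dist (p i) z < \<epsilon>" "generic (insert i I) (g(i := z))"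
      using generic_insert[OF g(1) insert(1,2) assms(2)] by blast
    then have "generic (insert i I) (g(i := z)) \<and> (\<forall>k\<in>insert i I. dist (p k) ((g(i := z)) k) < \<epsilon>)"
      using g(2) insert(2) by auto
    then show ?case by blast
  qed
  then show ?thesis using that by blast
qed

section \<open>Disjointness of segments under small displacements\<close>

lemma closed_segment_perturb:
  fixes a b a' b' :: complex
  assumes "z \<in> closed_segment a' b'" "dist a a' < \<epsilon>" "dist b b' < \<epsilon>"
  obtains y where "y \<in> closed_segment a b" "dist y z < \<epsilon>"
proof -
  obtain u where u: "0 \<le> u" "u \<le> 1" "z = (1 - u) *\<^sub>R a' + u *\<^sub>R b'" using assms(1) by (auto simp: in_segment)
  have "(1 - u) *\<^sub>R (a' - a) + u *\<^sub>R (b' - b) \<in> ball 0 \<epsilon>"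
    using u assms(2,3) by (intro convexD[OF convex_ball]) (auto simp: dist_norm norm_minus_commute)
  moreover have "z - ((1 - u) *\<^sub>R a + u *\<^sub>R b) = (1 - u) *\<^sub>R (a' - a) + u *\<^sub>R (b' - b)"
    using u(3) by (simp add: algebra_simps)
  ultimately have "dist z ((1 - u) *\<^sub>R a + u *\<^sub>R b) < \<epsilon>"
    by (simp only: dist_norm mem_ball diff_0 norm_minus_cancel)
  then have "dist ((1 - u) *\<^sub>R a + u *\<^sub>R b) z < \<epsilon>" by (simp only: dist_commute)
  then show ?thesis using that u by (auto simp: in_segment)
qed

text \<open>If the segments have distance \<open>\<delta>\<close>, moving all ends by less than half
  of it moves every point of either segment by less than half of it.\<close>

lemma disjoint_segments_stable:
  fixes a b c d :: complex
  assumes "closed_segment a b \<inter> closed_segment c d = {}"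
  obtains \<epsilon> where "0 < \<epsilon>" "\<And>a' b' c' d'. dist a a' < \<epsilon> \<Longrightarrow> dist b b' < \<epsilon> \<Longrightarrow> dist c c' < \<epsilon> \<Longrightarrow> dist d d' < \<epsilon> \<Longrightarrow>
    closed_segment a' b' \<inter> closed_segment c' d' = {}"
proof -
  obtain \<delta> where d: "\<delta> > 0" "\<And>x y. x \<in> closed_segment a b \<Longrightarrow> y \<in> closed_segment c d \<Longrightarrow> \<delta> \<le> dist x y"
    using separate_compact_closed[OF compact_segment closed_segment assms] by blast
  have "closed_segment a' b' \<inter> closed_segment c' d' = {}"
    if D: "dist a a' < \<delta>/2" "dist b b' < \<delta>/2" "dist c c' < \<delta>/2" "dist d d' < \<delta>/2" for a' b' c' d'
  proof (rule ccontr)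
    assume "\<not> ?thesis"
    then obtain z where z: "z \<in> closed_segment a' b'" "z \<in> closed_segment c' d'" by blast
    obtain x where x: "x \<in> closed_segment a b" "dist x z < \<delta>/2" using closed_segment_perturb[OF z(1) D(1,2)] .
    obtain y where y: "y \<in> closed_segment c d" "dist y z < \<delta>/2" using closed_segment_perturb[OF z(2) D(3,4)] .
    have "dist x y \<le> dist x z + dist y z" by (rule dist_triangle2)
    then show False using d(2)[OF x(1) y(1)] x(2) y(2) by linarith
  qed
  then show ?thesis using that[of "\<delta>/2"] d(1) by simp
qed

lemma eventually_disjoint_segments:
  fixes a b c d a' b' c' d' :: complex
  assumes "closed_segment a b \<inter> closed_segment c d = {}"
  shows "\<forall>\<^sub>F t in at_right 0. closed_segment (a + t *\<^sub>R a') (b + t *\<^sub>R b') \<inter> closed_segment (c + t *\<^sub>R c') (d + t *\<^sub>R d') = {}"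
proof -
  obtain \<epsilon> where e: "0 < \<epsilon>" "\<And>a' b' c' d'. dist a a' < \<epsilon> \<Longrightarrow> dist b b' < \<epsilon> \<Longrightarrow> dist c c' < \<epsilon> \<Longrightarrow> dist d d' < \<epsilon> \<Longrightarrow>
    closed_segment a' b' \<inter> closed_segment c' d' = {}" using disjoint_segments_stable[OF assms] by blast
  have "\<forall>\<^sub>F t in at_right 0. dist x (x + t *\<^sub>R x') < \<epsilon>" for x x' :: complex
  proof -
    have "((\<lambda>t. dist x (x + t *\<^sub>R x')) \<longlongrightarrow> dist x (x + 0 *\<^sub>R x')) (at_right 0)" by (intro tendsto_intros)
    then show ?thesis using e(1) by (intro order_tendstoD(2)[of _ 0]) auto
  qed
  note ev = this
  show ?thesis
    using ev[of a a'] ev[of b b'] ev[of c c'] ev[of d d'] by eventually_elim (rule e(2))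
qed

text \<open>Modulo the direction of the copy with multiplier \<open>j\<close>, a point of the other
  copy is displaced from it by a nonzero multiple of a convex combination of \<open>m\<close> and
  \<open>n\<close>. For small \<open>t\<close> both \<open>m\<close> and \<open>n\<close> lie on the
  same side of that direction, so no such combination is parallel to it.\<close>

lemma eventually_disjoint_parallel:
  assumes "0 < wedge (b - a) m * wedge (b - a) n" "j \<noteq> k"
  shows "\<forall>\<^sub>F t in at_right 0. closed_segment (a + t *\<^sub>R (j *\<^sub>R m)) (b + t *\<^sub>R (j *\<^sub>R n)) \<inter>
    closed_segment (a + t *\<^sub>R (k *\<^sub>R m)) (b + t *\<^sub>R (k *\<^sub>R n)) = {}"
proof -
  let ?w = "\<lambda>t. (b - a) + t *\<^sub>R (j *\<^sub>R (n - m))"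
  have "((\<lambda>t. wedge (?w t) m * wedge (?w t) n) \<longlongrightarrow> wedge (?w 0) m * wedge (?w 0) n) (at_right 0)"
    unfolding wedge_def by (intro tendsto_intros)
  then have "\<forall>\<^sub>F t in at_right 0. 0 < wedge (?w t) m * wedge (?w t) n"
    using assms(1) by (intro order_tendstoD(1)) simp_all
  moreover have "\<forall>\<^sub>F t in at_right (0::real). 0 < t" by (rule eventually_at_right_less)
  ultimately show ?thesis
  proof eventually_elim
    case (elim t)
    let ?v = "?w t"
    show ?case
    proof (rule ccontr)
      assume "\<not> ?thesis"
      then obtain z where z: "z \<in> closed_segment (a + t *\<^sub>R (j *\<^sub>R m)) (b + t *\<^sub>R (j *\<^sub>R n))"
        "z \<in> closed_segment (a + t *\<^sub>R (k *\<^sub>R m)) (b + t *\<^sub>R (k *\<^sub>R n))" by blast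
      obtain s where s: "0 \<le> s" "s \<le> 1"
        "z = (a + t *\<^sub>R (k *\<^sub>R m)) + s *\<^sub>R ((b + t *\<^sub>R (k *\<^sub>R n)) - (a + t *\<^sub>R (k *\<^sub>R m)))"
        using z(2) unfolding closed_segment_iff by blast
      have "(b + t *\<^sub>R (j *\<^sub>R n)) - (a + t *\<^sub>R (j *\<^sub>R m)) = ?v" by (simp add: algebra_simps)
      with wedge_segment[OF z(1)] have "wedge ?v (z - (a + t *\<^sub>R (j *\<^sub>R m))) = 0" by (simp only:)
      moreover have "z - (a + t *\<^sub>R (j *\<^sub>R m)) = s *\<^sub>R ?v + (t * (k - j)) *\<^sub>R ((1 - s) *\<^sub>R m + s *\<^sub>R n)"
        unfolding s(3) by (simp add: algebra_simps)
      ultimately have "(t * (k - j)) * ((1 - s) * wedge ?v m + s * wedge ?v n) = 0"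
        by (simp add: wedge_simps(2,6,8))
      then have 0: "(1 - s) * wedge ?v m + s * wedge ?v n = 0" using elim(2) assms(2) by simp
      then have "((1 - s) * wedge ?v m + s * wedge ?v n) * wedge ?v m = 0" by simp
      then have "(1 - s) * (wedge ?v m)\<^sup>2 + s * (wedge ?v m * wedge ?v n) = 0"
        by (simp add: algebra_simps power2_eq_square)
      moreover have "0 \<le> (1 - s) * (wedge ?v m)\<^sup>2" "0 \<le> s * (wedge ?v m * wedge ?v n)" using s elim(1) by auto
      ultimately have "s * (wedge ?v m * wedge ?v n) = 0" "(1 - s) * (wedge ?v m)\<^sup>2 = 0" by linarith+
      then show False using elim(1) s by (auto simp: zero_less_mult_iff)
    qed
  qed
qed

text \<open>The line through \<open>b\<close> with direction \<open>n\<close> separates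
  \<open>a\<close> from \<open>c\<close>, also after small displacements. The shifted copies of
  \<open>b\<close> lie on this line, so the two segments could only meet in them, and these copies
  differ.\<close>

lemma eventually_disjoint_at_bend:
  fixes a b c :: complex
  assumes "wedge (a - b) n * wedge (c - b) n < 0" "j \<noteq> k"
  shows "\<forall>\<^sub>F t in at_right 0. closed_segment (a + t *\<^sub>R a') (b + t *\<^sub>R (j *\<^sub>R n)) \<inter>
    closed_segment (c + t *\<^sub>R c') (b + t *\<^sub>R (k *\<^sub>R n)) = {}"
proof -
  define \<phi> where "\<phi> z = wedge (z - b) n" for z
  have "((\<lambda>t. \<phi> (a + t *\<^sub>R a') * \<phi> (c + t *\<^sub>R c')) \<longlongrightarrow> \<phi> (a + 0 *\<^sub>R a') * \<phi> (c + 0 *\<^sub>R c')) (at_right 0)"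
    unfolding \<phi>_def wedge_def by (intro tendsto_intros)
  then have "\<forall>\<^sub>F t in at_right 0. \<phi> (a + t *\<^sub>R a') * \<phi> (c + t *\<^sub>R c') < 0"
    using assms(1) by (intro order_tendstoD(2)) (simp_all add: \<phi>_def)
  moreover have "\<forall>\<^sub>F t in at_right (0::real). 0 < t" by (rule eventually_at_right_less)
  ultimately show ?thesis
  proof eventually_elim
    case (elim t)
    have aff: "\<exists>s. 0 \<le> s \<and> s \<le> 1 \<and> \<phi> z = s * \<phi> x \<and> (s = 0 \<longrightarrow> z = b + t *\<^sub>R (j *\<^sub>R n))"
      if "z \<in> closed_segment x (b + t *\<^sub>R (j *\<^sub>R n))" for x z j
    proof -
      obtain s where s: "0 \<le> s" "s \<le> 1" "z = (1 - s) *\<^sub>R x + s *\<^sub>R (b + t *\<^sub>R (j *\<^sub>R n))"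
        using \<open>z \<in> _\<close> by (auto simp: in_segment)
      have "z - b = (1 - s) *\<^sub>R (x - b) + (s * (t * j)) *\<^sub>R n" unfolding s(3) by (simp add: algebra_simps)
      then have "\<phi> z = (1 - s) * \<phi> x" unfolding \<phi>_def by (simp only: wedge_simps)
      then show ?thesis using s by (intro exI[of _ "1 - s"]) auto
    qed
    show ?case
    proof (rule ccontr)
      assume "\<not> ?thesis"
      then obtain z where z: "z \<in> closed_segment (a + t *\<^sub>R a') (b + t *\<^sub>R (j *\<^sub>R n))"
        "z \<in> closed_segment (c + t *\<^sub>R c') (b + t *\<^sub>R (k *\<^sub>R n))" by blast
      let ?x = "\<phi> (a + t *\<^sub>R a')" and ?y = "\<phi> (c + t *\<^sub>R c')"
      obtain s where s: "0 \<le> s" "\<phi> z = s * ?x" "s = 0 \<longrightarrow> z = b + t *\<^sub>R (j *\<^sub>R n)" using aff[OF z(1)] by blast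
      obtain r where r: "0 \<le> r" "\<phi> z = r * ?y" "r = 0 \<longrightarrow> z = b + t *\<^sub>R (k *\<^sub>R n)" using aff[OF z(2)] by blast
      have "(\<phi> z)\<^sup>2 = (s * r) * (?x * ?y)" using s(2) r(2) by (metis mult.assoc mult.left_commute power2_eq_square)
      moreover have "(s * r) * (?x * ?y) \<le> 0" using mult_nonneg_nonpos[OF mult_nonneg_nonneg[OF s(1) r(1)] less_imp_le[OF elim(1)]] .
      ultimately have "\<phi> z = 0" by (metis power2_less_eq_zero_iff)
      moreover have "?x \<noteq> 0" "?y \<noteq> 0" using elim(1) by auto
      ultimately have "s = 0" "r = 0" using s(2) r(2) by auto
      then have "b + t *\<^sub>R (j *\<^sub>R n) = b + t *\<^sub>R (k *\<^sub>R n)" using s(3) r(3) by metis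
      moreover have "n \<noteq> 0" using assms(1) by (auto simp: wedge_simps)
      ultimately show False using elim(2) assms(2) by simp
    qed
  qed
qed

section \<open>Drawing a graph along a straight plane graph\<close>

lemma uniform_epsilon:
  assumes "finite S" and "\<And>s. s \<in> S \<Longrightarrow> \<exists>\<epsilon>>0. \<forall>\<delta>. \<delta> \<le> (\<epsilon>::real) \<longrightarrow> P s \<delta>"
  shows "\<exists>\<epsilon>>0. \<forall>s\<in>S. P s \<epsilon>"
proof -
  obtain f where f: "\<And>s. s \<in> S \<Longrightarrow> 0 < f s \<and> (\<forall>\<delta>. \<delta> \<le> f s \<longrightarrow> P s \<delta>)"
    using assms(2) by metis
  have "\<exists>r>0. \<forall>x\<in>f ` S. r < x"
    using assms(1) f by (intro finite_positive_lower_bound) auto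
  then obtain r where "r > 0" "\<forall>x\<in>f ` S. r < x" by blast
  then show ?thesis using f by (intro exI[of _ r]) force
qed

text \<open>The degenerate cases occur because an edge of \<open>G\<close> may be routed with both
  ends at one vertex of \<open>H\<close>.\<close>

lemma straight_vertices_disjoint:
  assumes "straight H" "a \<in> pverts H" "b \<in> pverts H" "c \<in> pverts H" "d \<in> pverts H"
    "a = b \<or> (a, b) \<in> parcs H" "c = d \<or> (c, d) \<in> parcs H" "{a, b} \<inter> {c, d} = {}"
  shows "closed_segment a b \<inter> closed_segment c d = {}"
proof -
  have v: "closed_segment x y \<inter> pverts H \<subseteq> {x, y}" if "(x, y) \<in> parcs H" for x y
    using assms(1) that unfolding pdraw_def segment_convex_hull by blast
  show ?thesis
  proof (cases "a = b \<or> c = d")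
    case True
    then show ?thesis using v[of a b] v[of c d] assms(2-8) by auto
  next
    case False
    then have "(a, b) \<in> parcs H" "(c, d) \<in> parcs H" "{a, b} \<noteq> {c, d}" using assms(6-8) by auto
    from pdraw_disjoint[OF assms(1) this] show ?thesis using assms(8) by (simp add: segment_convex_hull)
  qed
qed

text \<open>The edge e is drawn as a polygonal line through points near the vertices h e 0, ..., h e (n e)
  of a path of H; each G-vertex gets one point, each inner vertex of the path of e its own point.\<close>

locale routing =
  fixes G :: "'a pair_pre_digraph" and H :: "complex pair_pre_digraph" and W :: "complex set"
    and \<nu> :: "complex \<Rightarrow> complex" and home :: "'a \<Rightarrow> complex" and u w :: "'a set \<Rightarrow> 'a"
    and n :: "'a set \<Rightarrow> nat" and h :: "'a set \<Rightarrow> nat \<Rightarrow> complex" and k :: nat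
  assumes G: "pair_graph G" and H: "straight H" and bends: "bends (parcs H) W \<nu>" and WH: "W \<subseteq> pverts H"
    and home: "v \<in> pverts G \<Longrightarrow> home v \<in> W"
    and uw: "e \<in> edges G \<Longrightarrow> {u e, w e} = e"
    and n_pos: "e \<in> edges G \<Longrightarrow> 0 < n e"
    and h_ends: "e \<in> edges G \<Longrightarrow> h e 0 = home (u e)" "e \<in> edges G \<Longrightarrow> h e (n e) = home (w e)"
    and h_step: "e \<in> edges G \<Longrightarrow> i < n e \<Longrightarrow>
      (n e = 1 \<and> h e i = h e (Suc i)) \<or> ((h e i, h e (Suc i)) \<in> parcs H \<and> inj_on (h e) {..n e})"
    and load: "x \<in> W \<Longrightarrow> card {e \<in> edges G. x \<in> h e ` {..n e}} \<le> k"
begin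

text \<open>Names for the points of the curves: the two outer ones are shared by all edges at that
  vertex of \<open>G\<close>, the inner ones belong to a single edge. As \<open>n e\<close> is
  positive even for a path of one vertex, the two ends of an edge always have different
  names.\<close>

definition idx :: "'a set \<Rightarrow> nat \<Rightarrow> 'a + 'a set \<times> nat" where
  "idx e i = (if i = 0 then Inl (u e) else if i = n e then Inl (w e) else Inr (e, i))"

definition host :: "'a + 'a set \<times> nat \<Rightarrow> complex" where
  "host x = (case x of Inl v \<Rightarrow> home v | Inr (e, i) \<Rightarrow> h e i)"

definition I :: "('a + 'a set \<times> nat) set" where
  "I = Inl ` pverts G \<union> (\<Union>e\<in>edges G. idx e ` {..n e})"

definition seg_of :: "('a + 'a set \<times> nat \<Rightarrow> complex) \<Rightarrow> 'a set \<times> nat \<Rightarrow> complex set" where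
  "seg_of p s = closed_segment (p (idx (fst s) (snd s))) (p (idx (fst s) (Suc (snd s))))"

definition SG :: "('a set \<times> nat) set" where
  "SG = (SIGMA e:edges G. {..<n e})"

definition iends :: "'a set \<times> nat \<Rightarrow> ('a + 'a set \<times> nat) set" where
  "iends s = {idx (fst s) (snd s), idx (fst s) (Suc (snd s))}"

definition hends :: "'a set \<times> nat \<Rightarrow> complex set" where
  "hends s = {h (fst s) (snd s), h (fst s) (Suc (snd s))}"

text \<open>The pairs of segments that the drawing has to keep disjoint. Any other pair shares a
  point of the drawing or runs to a common vertex in \<open>W\<close>, where
  \<open>crossing_pairs\<close> accounts for it.\<close>

definition free :: "'a set \<times> nat \<Rightarrow> 'a set \<times> nat \<Rightarrow> bool" where
  "free s t \<longleftrightarrow> iends s \<inter> iends t = {} \<and> hends s \<inter> hends t \<inter> W = {}"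

lemma finE: "finite (edges G)" "finite (pverts G)"
proof -
  have "finite (pverts G)" "parcs G \<subseteq> pverts G \<times> pverts G" using G by (auto simp: pair_graph_iff)
  then show "finite (edges G)" "finite (pverts G)"
    unfolding edges_def by (meson finite_SigmaI finite_imageI finite_subset)+
qed

lemma edge_verts: "e \<in> edges G \<Longrightarrow> u e \<in> pverts G \<and> w e \<in> pverts G \<and> u e \<noteq> w e"
proof -
  assume e: "e \<in> edges G"
  then obtain a b where ab: "e = {a, b}" "(a, b) \<in> parcs G" by (rule edgesE)
  then have "a \<in> pverts G" "b \<in> pverts G" "a \<noteq> b" using G by (auto simp: pair_graph_iff)
  then show ?thesis using uw[OF e] ab(1) by (auto simp: doubleton_eq_iff)
qed

lemma finite_I: "finite I" and finite_SG: "finite SG"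
  using finE by (auto simp: I_def SG_def)

lemma host_idx: "e \<in> edges G \<Longrightarrow> i \<le> n e \<Longrightarrow> host (idx e i) = h e i"
  using h_ends n_pos[of e] by (auto simp: host_def idx_def)

lemma idx_I: "e \<in> edges G \<Longrightarrow> i \<le> n e \<Longrightarrow> idx e i \<in> I"
  by (auto simp: I_def)

lemma idx_inj: "e \<in> edges G \<Longrightarrow> i \<le> n e \<Longrightarrow> j \<le> n e \<Longrightarrow> idx e i = idx e j \<longleftrightarrow> i = j"
  using edge_verts[of e] by (auto simp: idx_def)

lemma idx_shared:
  assumes "e \<in> edges G" "f \<in> edges G" "e \<noteq> f" "idx e i = idx f j"
  shows "\<exists>v. idx e i = Inl v \<and> v \<in> e \<inter> f"
  using assms uw[OF assms(1)] uw[OF assms(2)] by (auto simp: idx_def split: if_splits)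

lemma other_end:
  assumes "s \<in> SG" "b \<in> iends s"
  shows "\<exists>a\<in>I. iends s = {b, a} \<and> a \<noteq> b \<and> seg_of g s = closed_segment (g b) (g a)"
proof -
  obtain e i where s: "s = (e, i)" "e \<in> edges G" "i < n e" using assms(1) by (auto simp: SG_def)
  then have I: "idx e i \<in> I" "idx e (Suc i) \<in> I" "idx e i \<noteq> idx e (Suc i)"
    using idx_I[OF s(2)] idx_inj[OF s(2)] by auto
  consider "b = idx e i" | "b = idx e (Suc i)" using assms(2) s(1) by (auto simp: iends_def)
  then show ?thesis
  proof cases
    case 1
    then show ?thesis using I s(1) by (intro bexI[of _ "idx e (Suc i)"]) (auto simp: iends_def seg_of_def)
  next
    case 2
    then show ?thesis using I s(1)
      by (intro bexI[of _ "idx e i"]) (auto simp: iends_def seg_of_def closed_segment_commute)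
  qed
qed

lemma h_verts: "e \<in> edges G \<Longrightarrow> i \<le> n e \<Longrightarrow> h e i \<in> pverts H"
proof -
  assume e: "e \<in> edges G" "i \<le> n e"
  have P: "parcs H \<subseteq> pverts H \<times> pverts H" using H by (auto simp: pdraw_def pair_graph_iff)
  show ?thesis
  proof (cases "n e = 1")
    case True
    then have "h e i = home (u e) \<or> h e i = home (w e)" using h_ends[OF e(1)] e(2) by (cases i) auto
    then show ?thesis using home edge_verts[OF e(1)] WH by auto
  next
    case False
    show ?thesis
    proof (cases "i = n e")
      case True then show ?thesis using h_ends[OF e(1)] home edge_verts[OF e(1)] WH by auto
    next
      case i: False
      then have "(h e i, h e (Suc i)) \<in> parcs H" using h_step[OF e(1), of i] False e(2) by auto
      then show ?thesis using P by auto
    qed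
  qed
qed

text \<open>Curves begin and end at vertices of \<open>W\<close>, so at any other vertex of
  \<open>H\<close> a curve has an inner point \<open>p\<close> of its own. The degenerate one-step
  route is thereby excluded and the route is a simple path.\<close>

lemma shared_bend:
  assumes s: "s \<in> SG" "x \<in> hends s" "x \<notin> W"
  obtains p q y where "iends s = {p, q}" "host p = x" "host q = y" "(y, x) \<in> parcs H" "hends s = {x, y}"
    "p = Inr (fst s, snd s) \<or> p = Inr (fst s, Suc (snd s))" "\<And>z. q = Inr z \<Longrightarrow> fst z = fst s" "p \<noteq> q"
    "inj_on (h (fst s)) {..n (fst s)}"
proof -
  obtain e i where ei: "s = (e, i)" "e \<in> edges G" "i < n e" using s(1) by (auto simp: SG_def)
  have sy: "sym (parcs H)" using H by (auto simp: pdraw_def pair_graph_iff)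
  have W: "h e 0 \<in> W" "h e (n e) \<in> W" using h_ends[OF ei(2)] home edge_verts[OF ei(2)] by auto
  have "\<not> (n e = 1 \<and> h e i = h e (Suc i))" using s(2,3) W ei by (auto simp: hends_def)
  then have st: "(h e i, h e (Suc i)) \<in> parcs H" "inj_on (h e) {..n e}" using h_step[OF ei(2,3)] by auto
  have q: "fst z = e" if "idx e j = Inr z" for j z using that by (auto simp: idx_def split: if_splits)
  have ne: "idx e i \<noteq> idx e (Suc i)" using idx_inj[OF ei(2), of i "Suc i"] ei(3) by auto
  have hh: "host (idx e i) = h e i" "host (idx e (Suc i)) = h e (Suc i)"
    using host_idx[OF ei(2)] ei(3) by auto
  consider "x = h e i" | "x = h e (Suc i)" using s(2) ei(1) by (auto simp: hends_def)
  then show ?thesis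
  proof cases
    case 1
    then have "i \<noteq> 0" using s(3) W(1) by metis
    then have "idx e i = Inr (e, i)" using ei(3) by (simp add: idx_def)
    moreover have "(h e (Suc i), h e i) \<in> parcs H" using sy st(1) by (auto dest: symD)
    ultimately show ?thesis
      by (intro that[of "idx e i" "idx e (Suc i)" "h e (Suc i)"])
        (use 1 ei(1) st(2) q ne hh in \<open>auto simp: iends_def hends_def\<close>)
  next
    case 2
    then have "Suc i \<noteq> n e" using s(3) W(2) by metis
    then have "idx e (Suc i) = Inr (e, Suc i)" by (simp add: idx_def)
    then show ?thesis
      by (intro that[of "idx e (Suc i)" "idx e i" "h e i"])
        (use 2 ei(1) st q ne hh in \<open>auto simp: iends_def hends_def\<close>)
  qed
qed

text \<open>The distinct numbers \<open>j e\<close> give the curves distinct lanes along each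
  polygonal edge; the points of the vertices of \<open>G\<close> do not move.\<close>

definition off :: "('a set \<Rightarrow> nat) \<Rightarrow> 'a + 'a set \<times> nat \<Rightarrow> complex" where
  "off j x = (case x of Inl v \<Rightarrow> 0 | Inr (e, i) \<Rightarrow> real (j e) *\<^sub>R \<nu> (h e i))"

text \<open>Segments with disjoint hosts stay disjoint by stability. Otherwise they share a bend
  outside \<open>W\<close>: if they lead to different neighbours, the line along the normal
  separates them. If they lead to the same neighbour, that neighbour is outside \<open>W\<close> as
  well since the pair is free, and the segments are parallel copies in different lanes.\<close>

lemma eventually_free_disjoint:
  assumes j: "inj_on j (edges G)" and s: "s \<in> SG" and t: "t \<in> SG" and fr: "free s t"
  shows "\<forall>\<^sub>F \<delta> in at_right 0. seg_of (\<lambda>x. host x + \<delta> *\<^sub>R off j x) s \<inter> seg_of (\<lambda>x. host x + \<delta> *\<^sub>R off j x) t = {}"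
proof (cases "hends s \<inter> hends t = {}")
  case True
  obtain e i where e: "s = (e, i)" "e \<in> edges G" "i < n e" using s by (auto simp: SG_def)
  obtain f l where f: "t = (f, l)" "f \<in> edges G" "l < n f" using t by (auto simp: SG_def)
  have "closed_segment (h e i) (h e (Suc i)) \<inter> closed_segment (h f l) (h f (Suc l)) = {}"
    using e f True h_step[OF e(2,3)] h_step[OF f(2,3)]
    by (intro straight_vertices_disjoint[OF H] h_verts) (auto simp: hends_def)
  from eventually_disjoint_segments[OF this]
  show ?thesis using e f host_idx[OF e(2)] host_idx[OF f(2)] by (simp add: seg_of_def)
next
  case False
  then obtain x where x: "x \<in> hends s" "x \<in> hends t" by blast
  then have xW: "x \<notin> W" using fr by (auto simp: free_def)
  obtain p q y where p: "iends s = {p, q}" "host p = x" "host q = y" "(y, x) \<in> parcs H" "hends s = {x, y}"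
    "p = Inr (fst s, snd s) \<or> p = Inr (fst s, Suc (snd s))" "\<And>z. q = Inr z \<Longrightarrow> fst z = fst s" "p \<noteq> q"
    "inj_on (h (fst s)) {..n (fst s)}"
    using shared_bend[OF s x(1) xW] by blast
  obtain p' q' y' where p': "iends t = {p', q'}" "host p' = x" "host q' = y'" "(y', x) \<in> parcs H" "hends t = {x, y'}"
    "p' = Inr (fst t, snd t) \<or> p' = Inr (fst t, Suc (snd t))" "\<And>z. q' = Inr z \<Longrightarrow> fst z = fst t" "p' \<noteq> q'"
    "inj_on (h (fst t)) {..n (fst t)}"
    using shared_bend[OF t x(2) xW] by blast
  let ?e = "fst s" and ?f = "fst t"
  have E: "?e \<in> edges G" "?f \<in> edges G" "snd s < n ?e" "snd t < n ?f" using s t by (auto simp: SG_def)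
  have seg: "seg_of g s = closed_segment (g q) (g p)" "seg_of g t = closed_segment (g q') (g p')" for g
  proof -
    have "seg_of g s = convex hull (g ` iends s)" "seg_of g t = convex hull (g ` iends t)"
      by (auto simp: seg_of_def iends_def segment_convex_hull)
    then show "seg_of g s = closed_segment (g q) (g p)" "seg_of g t = closed_segment (g q') (g p')"
      unfolding p(1) p'(1) by (auto simp: segment_convex_hull insert_commute)
  qed
  \<comment> \<open>A route visits \<open>x\<close> only once, so two segments of the same curve at
    \<open>x\<close> would share the point named there, contrary to \<open>free\<close>.\<close>
  have "?e \<noteq> ?f"
  proof
    assume ef: "?e = ?f"
    obtain i i' where i: "p = Inr (?e, i)" "i \<le> n ?e" "p' = Inr (?e, i')" "i' \<le> n ?e"
      using p(6) p'(6) E ef by (metis Suc_leI less_imp_le)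
    have "h ?e i = h ?e i'" using p(2) p'(2) i by (simp add: host_def)
    then have "i = i'" using inj_onD[OF p(9)] i by auto
    then show False using fr p(1) p'(1) i by (auto simp: free_def)
  qed
  then have jne: "real (j ?e) \<noteq> real (j ?f)" using inj_onD[OF j] E by auto
  have offp: "off j p = real (j ?e) *\<^sub>R \<nu> x" "off j p' = real (j ?f) *\<^sub>R \<nu> x"
    using p(2,6) p'(2,6) by (auto simp: off_def host_def split: prod.splits)
  show ?thesis
  proof (cases "y = y'")
    case False
    have "wedge (y - x) (\<nu> x) * wedge (y' - x) (\<nu> x) < 0"
      using bends p(4) p'(4) False xW unfolding bends_def by blast
    from eventually_disjoint_at_bend[OF this jne] show ?thesis
      unfolding seg p(2,3) p'(2,3) offp .
  next
    case True
    then have yW: "y \<notin> W" using fr p(5) p'(5) by (auto simp: free_def)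
    have "\<exists>z. q = Inr z \<and> h (fst z) (snd z) = y"
    proof (cases q)
      case (Inl v)
      have "v \<in> pverts G"
        using Inl p(1) edge_verts[OF E(1)] by (auto simp: iends_def idx_def doubleton_eq_iff split: if_splits)
      then show ?thesis using home yW Inl p(3) by (auto simp: host_def)
    next
      case (Inr z) then show ?thesis using p(3) by (auto simp: host_def split: prod.splits)
    qed
    then have oq: "off j q = real (j ?e) *\<^sub>R \<nu> y" using p(7) by (auto simp: off_def split: prod.splits)
    have "\<exists>z. q' = Inr z \<and> h (fst z) (snd z) = y"
    proof (cases q')
      case (Inl v)
      have "v \<in> pverts G"
        using Inl p'(1) edge_verts[OF E(2)] by (auto simp: iends_def idx_def doubleton_eq_iff split: if_splits)
      then show ?thesis using home yW Inl p'(3) True by (auto simp: host_def)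
    next
      case (Inr z) then show ?thesis using p'(3) True by (auto simp: host_def split: prod.splits)
    qed
    then have oq': "off j q' = real (j ?f) *\<^sub>R \<nu> y" using p'(7) by (auto simp: off_def split: prod.splits)
    have "0 < wedge (x - y) (\<nu> y) * wedge (x - y) (\<nu> x)"
      using bends p(4) xW yW unfolding bends_def by blast
    from eventually_disjoint_parallel[OF this jne] show ?thesis
      unfolding seg p(2,3) p'(2,3) offp oq oq' True[symmetric] .
  qed
qed

text \<open>There are finitely many free pairs, and their disjointness after the shift tolerates a
  sufficiently small displacement, which is spent on reaching general position.\<close>

lemma generic_positions:
  obtains g where "generic I g" "\<And>s t. s \<in> SG \<Longrightarrow> t \<in> SG \<Longrightarrow> free s t \<Longrightarrow> seg_of g s \<inter> seg_of g t = {}"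
proof -
  obtain j :: "'a set \<Rightarrow> nat" where j: "inj_on j (edges G)"
    using finite_imp_inj_to_nat_seg[OF finE(1)] by blast
  let ?F = "{(s, t). (s, t) \<in> SG \<times> SG \<and> free s t}"
  have finF: "finite ?F" by (intro finite_Collect_pairs finite_SG)
  let ?p = "\<lambda>\<delta> x. host x + \<delta> *\<^sub>R off j x"
  have "\<forall>\<^sub>F \<delta> in at_right 0. \<forall>(s, t)\<in>?F. seg_of (?p \<delta>) s \<inter> seg_of (?p \<delta>) t = {}"
    using eventually_free_disjoint[OF j] by (intro eventually_ball_finite finF) auto
  then obtain \<delta> where d: "\<And>s t. s \<in> SG \<Longrightarrow> t \<in> SG \<Longrightarrow> free s t \<Longrightarrow> seg_of (?p \<delta>) s \<inter> seg_of (?p \<delta>) t = {}"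
    using eventually_happens[of _ "at_right (0::real)"] by (fastforce simp: trivial_limit_at_right_real)
  define p where "p = ?p \<delta>"
  have "\<exists>\<epsilon>>0. \<forall>st\<in>?F. \<forall>g. (\<forall>i\<in>I. dist (p i) (g i) < \<epsilon>) \<longrightarrow> seg_of g (fst st) \<inter> seg_of g (snd st) = {}"
  proof (rule uniform_epsilon[OF finF])
    fix st assume st: "st \<in> ?F"
    obtain s t where s: "st = (s, t)" "s \<in> SG" "t \<in> SG" "free s t" using st by auto
    have m: "idx (fst r) (snd r) \<in> I" "idx (fst r) (Suc (snd r)) \<in> I" if "r \<in> SG" for r
      using that idx_I by (auto simp: SG_def)
    have "seg_of p s \<inter> seg_of p t = {}" using d[OF s(2-4)] by (simp add: p_def)
    then obtain \<epsilon> where e: "0 < \<epsilon>" "\<And>a' b' c' d'. dist (p (idx (fst s) (snd s))) a' < \<epsilon> \<Longrightarrow> dist (p (idx (fst s) (Suc (snd s)))) b' < \<epsilon> \<Longrightarrow>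
      dist (p (idx (fst t) (snd t))) c' < \<epsilon> \<Longrightarrow> dist (p (idx (fst t) (Suc (snd t)))) d' < \<epsilon> \<Longrightarrow>
      closed_segment a' b' \<inter> closed_segment c' d' = {}"
      unfolding seg_of_def by (rule disjoint_segments_stable) blast
    have "seg_of g (fst st) \<inter> seg_of g (snd st) = {}" if "\<delta> \<le> \<epsilon>" "\<forall>i\<in>I. dist (p i) (g i) < \<delta>" for \<delta> g
    proof -
      have "dist (p i) (g i) < \<epsilon>" if "i \<in> I" for i using \<open>\<forall>i\<in>I. _\<close> \<open>\<delta> \<le> \<epsilon>\<close> that by force
      then show ?thesis unfolding seg_of_def s(1) fst_conv snd_conv
        by (intro e(2)) (use m[OF s(2)] m[OF s(3)] in auto)
    qed
    then show "\<exists>\<epsilon>>0. \<forall>\<delta>. \<delta> \<le> \<epsilon> \<longrightarrow> (\<forall>g. (\<forall>i\<in>I. dist (p i) (g i) < \<delta>) \<longrightarrow> seg_of g (fst st) \<inter> seg_of g (snd st) = {})"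
      using e(1) by blast
  qed
  then obtain \<epsilon> where e: "0 < \<epsilon>" "\<And>st g. st \<in> ?F \<Longrightarrow> \<forall>i\<in>I. dist (p i) (g i) < \<epsilon> \<Longrightarrow> seg_of g (fst st) \<inter> seg_of g (snd st) = {}"
    by blast
  obtain g where g: "generic I g" "\<And>i. i \<in> I \<Longrightarrow> dist (p i) (g i) < \<epsilon>"
    using generic_perturbation[OF finite_I e(1)] by blast
  show ?thesis using that[OF g(1)] e(2)[of "(_, _)" g] g(2) by auto
qed

text \<open>At most \<open>k\<close> curves visit a given vertex of \<open>W\<close>, each with at
  most two segments there, and ordered pairs of such segments are counted.\<close>

lemma crossing_pairs:
  "card {(s, t). (s, t) \<in> SG \<times> SG \<and> hends s \<inter> hends t \<inter> W \<noteq> {}} \<le> card W * (2 * k)\<^sup>2"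
proof -
  have finW: "finite W" using WH H finite_subset by (auto simp: pdraw_def pair_graph_iff)
  define T where "T x = {s \<in> SG. x \<in> hends s}" for x
  have finT: "finite (T x)" for x using finite_SG by (simp add: T_def)
  have T_le: "card (T x) \<le> 2 * k" if x: "x \<in> W" for x
  proof -
    let ?E = "{e \<in> edges G. x \<in> h e ` {..n e}}"
    let ?J = "\<lambda>e. {i. i < n e \<and> x \<in> hends (e, i)}"
    have sub: "T x \<subseteq> (SIGMA e:?E. ?J e)"
      by (auto simp: T_def SG_def hends_def image_iff)
    have J2: "card (?J e) \<le> 2" if e: "e \<in> ?E" for e
    proof (cases "n e = 1")
      case True
      then have "?J e \<subseteq> {0}" by auto
      then have "card (?J e) \<le> card {0::nat}" by (intro card_mono) auto
      then show ?thesis by simp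
    next
      case False
      then have inj: "inj_on (h e) {..n e}" using h_step[of e 0] n_pos[of e] e by auto
      from e have "x \<in> h e ` {..n e}" by simp
      then obtain i0 where i0: "i0 \<le> n e" "x = h e i0" by (elim imageE) simp
      \<comment> \<open>The segments before and after the only visit of \<open>x\<close>; at the
        start of the route \<open>i0 = 0\<close>, and truncated subtraction merges the two.\<close>
      have "?J e \<subseteq> {i0, i0 - 1}"
      proof
        fix i assume i: "i \<in> ?J e"
        then have "i < n e" "h e i = h e i0 \<or> h e (Suc i) = h e i0" unfolding hends_def i0(2) by auto
        then have "i = i0 \<or> Suc i = i0" using inj_on_eq_iff[OF inj] i0(1) by auto
        then show "i \<in> {i0, i0 - 1}" by auto
      qed
      then have "card (?J e) \<le> card {i0, i0 - 1}" by (intro card_mono) auto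
      also have "\<dots> \<le> 2" by (simp add: card_insert_if)
      finally show ?thesis .
    qed
    have finS: "finite (SIGMA e:?E. ?J e)" using finE by (intro finite_SigmaI) auto
    have "card (T x) \<le> card (SIGMA e:?E. ?J e)" by (rule card_mono[OF finS sub])
    also have "\<dots> = (\<Sum>e\<in>?E. card (?J e))" using finE by (intro card_SigmaI) auto
    also have "\<dots> \<le> card ?E * 2" using sum_bounded_above[of ?E "\<lambda>e. card (?J e)" 2] J2 by simp
    also have "\<dots> \<le> 2 * k" using load[OF x] by simp
    finally show ?thesis .
  qed
  have sq: "card (T x \<times> T x) \<le> (2 * k)\<^sup>2" if "x \<in> W" for x
    unfolding card_cartesian_product power2_eq_square by (intro mult_mono T_le that) auto
  have "{(s, t). (s, t) \<in> SG \<times> SG \<and> hends s \<inter> hends t \<inter> W \<noteq> {}} \<subseteq> (\<Union>x\<in>W. T x \<times> T x)"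
    by (auto simp: T_def)
  then have "card {(s, t). (s, t) \<in> SG \<times> SG \<and> hends s \<inter> hends t \<inter> W \<noteq> {}} \<le> card (\<Union>x\<in>W. T x \<times> T x)"
    using finW finT by (intro card_mono) auto
  also have "\<dots> \<le> (\<Sum>x\<in>W. card (T x \<times> T x))" by (rule card_UN_le[OF finW])
  also have "\<dots> \<le> card W * (2 * k)\<^sup>2" using sum_bounded_above[of W "\<lambda>x. card (T x \<times> T x)" "(2 * k)\<^sup>2"] sq by simp
  finally show ?thesis .
qed

text \<open>A crossing lies on two segments of different edges. They are not free and share no end,
  so the pair is counted in \<open>crossing_pairs\<close>, and general position lets it contribute
  one point at most.\<close>

lemma drawing_exists:
  "\<exists>d. is_drawing G d \<and> finite (crossings G d) \<and> card (crossings G d) \<le> card W * (2 * k)\<^sup>2"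
proof -
  obtain g where gen: "generic I g" and fr: "\<And>s t. s \<in> SG \<Longrightarrow> t \<in> SG \<Longrightarrow> free s t \<Longrightarrow> seg_of g s \<inter> seg_of g t = {}"
    by (rule generic_positions) blast
  have inj: "inj_on g I"
    and ncol: "\<And>i j k. i \<in> I \<Longrightarrow> j \<in> I \<Longrightarrow> k \<in> I \<Longrightarrow> i \<noteq> j \<Longrightarrow> i \<noteq> k \<Longrightarrow> j \<noteq> k \<Longrightarrow> wedge (g j - g i) (g k - g i) \<noteq> 0"
    and nconc: "\<And>a b c d e f. a \<in> I \<Longrightarrow> b \<in> I \<Longrightarrow> c \<in> I \<Longrightarrow> d \<in> I \<Longrightarrow> e \<in> I \<Longrightarrow> f \<in> I \<Longrightarrow> distinct [a, b, c, d, e, f] \<Longrightarrow>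
      closed_segment (g a) (g b) \<inter> closed_segment (g c) (g d) \<inter> closed_segment (g e) (g f) = {}"
    using gen unfolding generic_def by simp_all
  have share: "z = g b" if "a \<in> I" "b \<in> I" "c \<in> I" "a \<noteq> b" "b \<noteq> c" "a \<noteq> c"
    "z \<in> closed_segment (g b) (g a)" "z \<in> closed_segment (g b) (g c)" for a b c z
    using segments_meet_at_common_end[OF ncol[of a b c]] that by blast
  have "\<exists>\<gamma>. arc \<gamma> \<and> pathstart \<gamma> = g (Inl (u e)) \<and> pathfinish \<gamma> = g (Inl (w e)) \<and>
      path_image \<gamma> = (\<Union>i\<in>{..<n e}. seg_of g (e, i))" if e: "e \<in> edges G" for e
  proof -
    define xs where "xs = map (\<lambda>i. g (idx e i)) [0..<Suc (n e)]"
    have len: "length xs = Suc (n e)" by (simp add: xs_def)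
    have nth: "xs ! i = g (idx e i)" if "i \<le> n e" for i
      unfolding xs_def using that by (subst nth_map) (auto simp del: upt_Suc)
    have sg: "seg xs i = seg_of g (e, i)" if "i < n e" for i
      using that nth by (simp add: seg_of_def)
    have "schain xs"
      unfolding schain_def
    proof (intro conjI allI impI)
      fix i assume "Suc i < length xs"
      then show "xs ! i \<noteq> xs ! Suc i"
        using nth[of i] nth[of "Suc i"] inj_onD[OF inj, of "idx e i" "idx e (Suc i)"] idx_I[OF e] idx_inj[OF e, of i "Suc i"] len by auto
    next
      fix i j assume ij: "i < j" "Suc j < length xs"
      then have ij': "i < n e" "j < n e" using len by auto
      show "seg xs i \<inter> seg xs j \<subseteq> (if j = Suc i then {xs ! j} else {})"
      proof (cases "j = Suc i")
        case True
        have "idx e i \<noteq> idx e j" "idx e j \<noteq> idx e (Suc j)" "idx e i \<noteq> idx e (Suc j)"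
          using idx_inj[OF e] ij ij' by auto
        then have "z = g (idx e j)" if "z \<in> seg xs i" "z \<in> seg xs j" for z
          using that share[of "idx e i" "idx e j" "idx e (Suc j)" z] idx_I[OF e] ij' True sg
          by (auto simp: seg_of_def closed_segment_commute)
        then have "z = xs ! j" if "z \<in> seg xs i" "z \<in> seg xs j" for z
          using that nth[OF less_imp_le[OF ij'(2)]] by simp
        then show ?thesis unfolding if_P[OF True] by blast
      next
        case False
        then have inje: "inj_on (h e) {..n e}" using h_step[OF e ij'(1)] ij ij' by auto
        have "free (e, i) (e, j)"
          using idx_inj[OF e] inj_on_eq_iff[OF inje] ij ij' False by (auto simp: free_def iends_def hends_def)
        then show ?thesis using fr[of "(e, i)" "(e, j)"] ij' e False sg by (auto simp: SG_def)
      qed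
    qed
    then have "pline (hd xs) (last xs) (\<Union>i\<in>{i. Suc i < length xs}. seg xs i)"
      using n_pos[OF e] len by (intro schain_pline) auto
    moreover have "hd xs = g (Inl (u e))" "last xs = g (Inl (w e))"
    proof -
      have "xs \<noteq> []" using len by auto
      then show "hd xs = g (Inl (u e))" "last xs = g (Inl (w e))"
        using nth[of 0] nth[of "n e"] n_pos[OF e] len by (simp_all add: idx_def hd_conv_nth last_conv_nth)
    qed
    moreover have "(\<Union>i\<in>{i. Suc i < length xs}. seg xs i) = (\<Union>i\<in>{..<n e}. seg_of g (e, i))"
      using sg len by auto
    ultimately show ?thesis using pline_arc by metis
  qed
  then obtain \<gamma> where \<gamma>: "\<And>e. e \<in> edges G \<Longrightarrow> arc (\<gamma> e) \<and> pathstart (\<gamma> e) = g (Inl (u e)) \<and> pathfinish (\<gamma> e) = g (Inl (w e)) \<and>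
      path_image (\<gamma> e) = (\<Union>i\<in>{..<n e}. seg_of g (e, i))"
    by metis
  let ?d = "\<lparr>vertex_point = \<lambda>v. g (Inl v), edge_curve = \<gamma>\<rparr>"
  have imgE: "\<exists>i. (e, i) \<in> SG \<and> z \<in> seg_of g (e, i)" if "e \<in> edges G" "z \<in> path_image (\<gamma> e)" for e z
    using \<gamma>[OF that(1)] that by (auto simp: SG_def)
  \<comment> \<open>A name shared by two edges is that of a common vertex. The other ends of the two
    segments differ, as otherwise both edges would be the same pair of vertices; general position
    then lets the segments meet only at the shared point.\<close>
  have two: "z \<in> (\<lambda>v. g (Inl v)) ` (e \<inter> f) \<or> iends (e, i) \<inter> iends (f, j) = {}"
    if s: "(e, i) \<in> SG" "(f, j) \<in> SG" "e \<noteq> f" and z: "z \<in> seg_of g (e, i)" "z \<in> seg_of g (f, j)" for e f i j z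
  proof (rule disjCI)
    assume "iends (e, i) \<inter> iends (f, j) \<noteq> {}"
    then obtain b where b: "b \<in> iends (e, i)" "b \<in> iends (f, j)" by blast
    have E: "e \<in> edges G" "f \<in> edges G" "i < n e" "j < n f" using s by (auto simp: SG_def)
    obtain v where v: "b = Inl v" "v \<in> e \<inter> f"
      using idx_shared[OF E(1,2) s(3)] b by (auto simp: iends_def) metis+
    obtain a where a: "a \<in> I" "iends (e, i) = {b, a}" "a \<noteq> b" "seg_of g (e, i) = closed_segment (g b) (g a)"
      using other_end[OF s(1) b(1)] by blast
    obtain c where c: "c \<in> I" "iends (f, j) = {b, c}" "c \<noteq> b" "seg_of g (f, j) = closed_segment (g b) (g c)"
      using other_end[OF s(2) b(2)] by blast
    have bI: "b \<in> I" using b(1) idx_I[OF E(1)] E(3) by (auto simp: iends_def)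
    have "a \<noteq> c"
    proof
      assume ac: "a = c"
      have "\<exists>v'. a = Inl v' \<and> v' \<in> e \<inter> f"
      proof -
        have "a \<in> iends (e, i)" "a \<in> iends (f, j)" using a(2) c(2) ac by auto
        then show ?thesis using idx_shared[OF E(1,2) s(3)] by (auto simp: iends_def)
      qed
      then obtain v' where v': "a = Inl v'" "v' \<in> e \<inter> f" by blast
      then have "v \<noteq> v'" using a(3) v(1) by auto
      have pair: "{v, v'} = x" if "x \<in> edges G" "v \<in> x" "v' \<in> x" for x
      proof -
        have "v \<in> {u x, w x}" "v' \<in> {u x, w x}" using uw[OF that(1)] that by simp_all
        then have "{u x, w x} = {v, v'}" using \<open>v \<noteq> v'\<close> by auto
        then show ?thesis using uw[OF that(1)] by simp
      qed
      show False using pair[OF E(1)] pair[OF E(2)] v(2) v'(2) s(3) by simp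
    qed
    then have "z = g b" using share[of a b c z] a c bI z by auto
    then show "z \<in> (\<lambda>v. g (Inl v)) ` (e \<inter> f)" using v by auto
  qed
  have sub: "e \<subseteq> pverts G" if "e \<in> edges G" for e
  proof -
    have "{u e, w e} \<subseteq> pverts G" using edge_verts[OF that] by auto
    then show ?thesis unfolding uw[OF that] .
  qed
  have dr: "is_drawing G ?d"
    unfolding is_drawing_def
  proof (intro conjI ballI impI)
    show "inj_on (vertex_point ?d) (pverts G)"
      using inj by (auto simp: inj_on_def I_def)
  next
    fix e assume e: "e \<in> edges G"
    show "arc (edge_curve ?d e)" using \<gamma>[OF e] by simp
    have "vertex_point ?d ` e = vertex_point ?d ` {u e, w e}" using uw[OF e] by simp
    then show "{pathstart (edge_curve ?d e), pathfinish (edge_curve ?d e)} = vertex_point ?d ` e"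
      using \<gamma>[OF e] by simp
    fix v assume v: "v \<in> pverts G - e"
    show "vertex_point ?d v \<notin> edge_image ?d e"
    proof
      assume "vertex_point ?d v \<in> edge_image ?d e"
      then obtain i where i: "(e, i) \<in> SG" "g (Inl v) \<in> seg_of g (e, i)" using imgE[OF e] by auto
      then have "i < n e" by (auto simp: SG_def)
      have "u e \<in> e" "w e \<in> e" using uw[OF e] by (metis insertI1, metis insertI1 insertI2)
      then have "u e \<noteq> v" "w e \<noteq> v" using v by auto
      then have "idx e i \<noteq> Inl v" "idx e (Suc i) \<noteq> Inl v" by (auto simp: idx_def)
      moreover have "idx e i \<noteq> idx e (Suc i)" "idx e i \<in> I" "idx e (Suc i) \<in> I"
        using idx_inj[OF e] idx_I[OF e] \<open>i < n e\<close> by auto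
      moreover have "Inl v \<in> I" using v by (auto simp: I_def)
      ultimately have "wedge (g (idx e (Suc i)) - g (idx e i)) (g (Inl v) - g (idx e i)) \<noteq> 0"
        by (intro ncol)
      then show False using wedge_segment i(2) by (auto simp: seg_of_def)
    qed
  next
    fix e f l assume E: "e \<in> edges G" "f \<in> edges G" "l \<in> edges G" "e \<noteq> f" "e \<noteq> l" "f \<noteq> l"
    show "edge_image ?d e \<inter> edge_image ?d f \<inter> edge_image ?d l \<subseteq> vertex_point ?d ` pverts G"
    proof
      fix z assume z: "z \<in> edge_image ?d e \<inter> edge_image ?d f \<inter> edge_image ?d l"
      obtain i where i: "(e, i) \<in> SG" "z \<in> seg_of g (e, i)" using imgE[OF E(1)] z by auto
      obtain j where j: "(f, j) \<in> SG" "z \<in> seg_of g (f, j)" using imgE[OF E(2)] z by auto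
      obtain m where m: "(l, m) \<in> SG" "z \<in> seg_of g (l, m)" using imgE[OF E(3)] z by auto
      show "z \<in> vertex_point ?d ` pverts G"
      proof (rule ccontr)
        assume nz: "z \<notin> vertex_point ?d ` pverts G"
        have "iends (e, i) \<inter> iends (f, j) = {}" using two[OF i(1) j(1) E(4) i(2) j(2)] sub[OF E(1)] nz by auto
        moreover have "iends (e, i) \<inter> iends (l, m) = {}" using two[OF i(1) m(1) E(5) i(2) m(2)] sub[OF E(1)] nz by auto
        moreover have "iends (f, j) \<inter> iends (l, m) = {}" using two[OF j(1) m(1) E(6) j(2) m(2)] sub[OF E(2)] nz by auto
        moreover have "idx e i \<noteq> idx e (Suc i)" "idx f j \<noteq> idx f (Suc j)" "idx l m \<noteq> idx l (Suc m)"
          using idx_inj[OF E(1)] idx_inj[OF E(2)] idx_inj[OF E(3)] i(1) j(1) m(1) by (auto simp: SG_def)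
        ultimately have "distinct [idx e i, idx e (Suc i), idx f j, idx f (Suc j), idx l m, idx l (Suc m)]"
          by (auto simp: iends_def)
        then have "seg_of g (e, i) \<inter> seg_of g (f, j) \<inter> seg_of g (l, m) = {}"
          unfolding seg_of_def fst_conv snd_conv using idx_I[OF E(1)] idx_I[OF E(2)] idx_I[OF E(3)] i(1) j(1) m(1)
          by (intro nconc) (auto simp: SG_def)
        then show False using i(2) j(2) m(2) by blast
      qed
    qed
  qed
  define CP where "CP = {(s, t). (s, t) \<in> SG \<times> SG \<and> hends s \<inter> hends t \<inter> W \<noteq> {}}"
  \<comment> \<open>Segments of different edges that share an end meet only in the point of a common
    vertex of the two edges, which is no crossing; hence the empty set.\<close>
  define X where "X = (\<lambda>(s, t). if iends s \<inter> iends t = {} then seg_of g s \<inter> seg_of g t else {})"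
  have finCP: "finite CP" unfolding CP_def by (intro finite_Collect_pairs finite_SG)
  have X1: "finite (X st) \<and> card (X st) \<le> 1" if "st \<in> CP" for st
  proof -
    obtain e i f j where st: "st = ((e, i), (f, j))" by (metis prod.collapse)
    have E: "e \<in> edges G" "i < n e" "f \<in> edges G" "j < n f" using that st by (auto simp: CP_def SG_def)
    show ?thesis
    proof (cases "iends (e, i) \<inter> iends (f, j) = {}")
      case True
      have "wedge (g (idx e (Suc i)) - g (idx e i)) (g (idx f j) - g (idx e i)) \<noteq> 0"
        using True E idx_inj[OF E(1), of i "Suc i"] idx_I[OF E(1)] idx_I[OF E(3)] by (intro ncol) (auto simp: iends_def)
      then have "x = y" if "x \<in> X st" "y \<in> X st" for x y
        using segments_meet_once that True by (auto simp: X_def st seg_of_def)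
      then show ?thesis by (rule finite_if_all_eq)
    qed (simp add: X_def st)
  qed
  have "crossings G ?d \<subseteq> (\<Union>st\<in>CP. X st)"
  proof
    fix z assume "z \<in> crossings G ?d"
    then obtain e f where ef: "e \<in> edges G" "f \<in> edges G" "e \<noteq> f" "z \<in> path_image (\<gamma> e)" "z \<in> path_image (\<gamma> f)"
      "z \<notin> (\<lambda>v. g (Inl v)) ` (e \<inter> f)" by (auto simp: crossings_def)
    obtain i where i: "(e, i) \<in> SG" "z \<in> seg_of g (e, i)" using imgE[OF ef(1,4)] by blast
    obtain j where j: "(f, j) \<in> SG" "z \<in> seg_of g (f, j)" using imgE[OF ef(2,5)] by blast
    have disj: "iends (e, i) \<inter> iends (f, j) = {}" using two[OF i(1) j(1) ef(3) i(2) j(2)] ef(6) by blast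
    have "\<not> free (e, i) (f, j)" using fr[OF i(1) j(1)] i(2) j(2) by blast
    then have "((e, i), (f, j)) \<in> CP" using disj i j by (auto simp: CP_def free_def)
    moreover have "z \<in> X ((e, i), (f, j))" using disj i j by (simp add: X_def)
    ultimately show "z \<in> (\<Union>st\<in>CP. X st)" by blast
  qed
  moreover have finU: "finite (\<Union>st\<in>CP. X st)" using finCP X1 by blast
  ultimately have "finite (crossings G ?d)" "card (crossings G ?d) \<le> card (\<Union>st\<in>CP. X st)"
    by (auto intro: finite_subset card_mono)
  moreover have "card (\<Union>st\<in>CP. X st) \<le> (\<Sum>st\<in>CP. card (X st))" by (rule card_UN_le[OF finCP])
  moreover have "(\<Sum>st\<in>CP. card (X st)) \<le> card CP" using sum_bounded_above[of CP "\<lambda>st. card (X st)" 1] X1 by simp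
  moreover have "card CP \<le> card W * (2 * k)\<^sup>2" unfolding CP_def by (rule crossing_pairs)
  ultimately show ?thesis using dr by (intro exI[of _ ?d]) linarith
qed

end

section \<open>Crossings from decompositions, planar quotients\<close>

text \<open>\<open>F\<close> selects the edges whose inner vertices are added. Those with both ends
  in \<open>S\<close> carry the connections of \<open>S\<close> over to \<open>H\<close>, and the
  others hang as paths on an end in \<open>S\<close>. Routing uses all edges that meet
  \<open>S\<close>, the quotient a choice of one end for each edge.\<close>

lemma subdivision_conn:
  fixes D :: "'b pair_pre_digraph" and H :: "complex pair_pre_digraph"
  assumes symH: "sym (parcs H)"
    and c1: "\<And>x y. (x, y) \<in> parcs D \<Longrightarrow> conn (parcs H) (insert (pt x) {b \<in> B. own b = {x, y}})"
    and c2: "\<And>x y. (x, y) \<in> parcs D \<Longrightarrow> conn (parcs H) ({pt x, pt y} \<union> {b \<in> B. own b = {x, y}})"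
    and own: "\<And>b. b \<in> B \<Longrightarrow> own b \<in> edges D" and sym_D: "sym (parcs D)"
    and S: "conn (parcs D) S"
    and F: "\<And>e. e \<in> edges D \<Longrightarrow> e \<in> F \<Longrightarrow> e \<inter> S \<noteq> {}" "\<And>e. e \<in> edges D \<Longrightarrow> e \<subseteq> S \<Longrightarrow> e \<in> F"
  shows "conn (parcs H) (pt ` S \<union> {b \<in> B. own b \<in> F})" (is "conn _ ?T")
proof -
  obtain r where r: "r \<in> S" using conn_nonempty[OF S] by auto
  have root: "(pt r, pt x) \<in> (parcs H \<inter> ?T \<times> ?T)\<^sup>*" if "x \<in> S" for x
    using connD[OF S r that]
  proof (induction rule: rtrancl_induct)
    case (step x y)
    then have e: "{x, y} \<in> edges D" "{x, y} \<subseteq> S" "(x, y) \<in> parcs D" by (auto simp: edges_def)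
    then have "{pt x, pt y} \<union> {b \<in> B. own b = {x, y}} \<subseteq> ?T" using F(2)[OF e(1,2)] by auto
    from conn_rtrancl_mono[OF connD[OF c2[OF e(3)]] this, of "pt x" "pt y"]
    have "(pt x, pt y) \<in> (parcs H \<inter> ?T \<times> ?T)\<^sup>*" by simp
    with step.IH show ?case by (rule rtrancl_trans)
  qed simp
  show ?thesis
  proof (rule conn_via_root[OF symH, of "pt r"])
    fix b assume "b \<in> ?T"
    then consider x where "x \<in> S" "b = pt x" | "b \<in> B" "own b \<in> F" by blast
    then show "(pt r, b) \<in> (parcs H \<inter> ?T \<times> ?T)\<^sup>*"
    proof cases
      case 1 then show ?thesis using root by simp
    next
      case 2
      obtain x y where xy: "own b = {x, y}" "x \<in> S" "(x, y) \<in> parcs D"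
      proof -
        obtain u v where uv: "own b = {u, v}" "(u, v) \<in> parcs D" using own[OF 2(1)] by (rule edgesE)
        have "(v, u) \<in> parcs D" using uv(2) sym_D by (auto dest: symD)
        moreover have "u \<in> S \<or> v \<in> S" using F(1)[OF own[OF 2(1)] 2(2)] uv(1) by auto
        ultimately show ?thesis using that[of u v] that[of v u] uv by (auto simp: insert_commute)
      qed
      have "insert (pt x) {b \<in> B. own b = {x, y}} \<subseteq> ?T" using xy 2 by auto
      from conn_rtrancl_mono[OF connD[OF c1[OF xy(3)]] this, of "pt x" b]
      have "(pt x, b) \<in> (parcs H \<inter> ?T \<times> ?T)\<^sup>*" using 2 xy(1) by simp
      with root[OF xy(2)] show ?thesis by (rule rtrancl_trans)
    qed
  qed (use r in auto)
qed

text \<open>The curve of an edge \<open>vw\<close> visits only those vertices of \<open>D\<close>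
  whose bag contains \<open>v\<close> or \<open>w\<close>. A bag has at most \<open>k\<close>
  members with at most \<open>\<Delta>\<close> edges each, so at most \<open>k * \<Delta>\<close>
  curves visit a vertex of \<open>D\<close>.\<close>

lemma decomposition_crossing_bound:
  fixes G :: "'a pair_pre_digraph" and D :: "'b pair_pre_digraph"
  assumes G: "pair_graph G" and dec: "decomposition G D bag" and "planar D"
    and width: "\<And>x. x \<in> pverts D \<Longrightarrow> card (bag x) \<le> k"
    and deg: "\<And>v. v \<in> pverts G \<Longrightarrow> card {w. (v, w) \<in> parcs G} \<le> \<Delta>"
  shows "\<exists>d. is_drawing G d \<and> finite (crossings G d) \<and> card (crossings G d) \<le> card (pverts D) * (2 * (k * \<Delta>))\<^sup>2"
proof -
  have D: "pair_graph D" using dec by (simp add: decomposition_def)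
  have sym_D: "sym (parcs D)" using D by (simp add: pair_graph_iff)
  have symG: "sym (parcs G)" and finG: "finite (pverts G)" and PG: "parcs G \<subseteq> pverts G \<times> pverts G"
    using G by (auto simp: pair_graph_iff)
  have finGE: "finite (edges G)" using finG PG unfolding edges_def by (meson finite_SigmaI finite_imageI finite_subset)
  let ?B = "bags_containing D bag"
  have bagG: "\<And>x. x \<in> pverts D \<Longrightarrow> bag x \<subseteq> pverts G"
    and connB: "\<And>v. v \<in> pverts G \<Longrightarrow> conn (parcs D) (?B v)"
    and touchB: "\<And>v w. (v, w) \<in> parcs G \<Longrightarrow> touch D (?B v) (?B w)"
    using dec unfolding decomposition_iff[OF sym_D] by auto
  have BD: "?B v \<subseteq> pverts D" for v by (auto simp: bags_containing_def)
  obtain H :: "complex pair_pre_digraph" and pt :: "'b \<Rightarrow> complex" and own :: "complex \<Rightarrow> 'b set" and \<nu>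
    where H: "straight H" and inj: "inj_on pt (pverts D)" and ptH: "pt ` pverts D \<subseteq> pverts H"
    and own: "\<And>b. b \<in> pverts H \<Longrightarrow> b \<notin> pt ` pverts D \<Longrightarrow> own b \<in> edges D"
    and c1: "\<And>x y. (x, y) \<in> parcs D \<Longrightarrow> conn (parcs H) (insert (pt x) {b \<in> pverts H - pt ` pverts D. own b = {x, y}})"
    and c2: "\<And>x y. (x, y) \<in> parcs D \<Longrightarrow> conn (parcs H) ({pt x, pt y} \<union> {b \<in> pverts H - pt ` pverts D. own b = {x, y}})"
    and bd: "bends (parcs H) (pt ` pverts D) \<nu>"
    by (rule straight_subdivision[OF D \<open>planar D\<close>]) blast
  have symH: "sym (parcs H)" using H by (simp add: pdraw_def pair_graph_iff)
  have "\<exists>v. \<forall>e\<in>edges G. \<exists>w'. {v e, w'} = e \<and> (v e, w') \<in> parcs G"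
    by (rule bchoice) (auto elim!: edgesE)
  then obtain u where "\<forall>e\<in>edges G. \<exists>w'. {u e, w'} = e \<and> (u e, w') \<in> parcs G" by blast
  then obtain w where uw: "\<And>e. e \<in> edges G \<Longrightarrow> {u e, w e} = e \<and> (u e, w e) \<in> parcs G" by metis
  have uwV: "u e \<in> pverts G" "w e \<in> pverts G" if "e \<in> edges G" for e using uw[OF that] PG by auto
  define home where "home v = pt (SOME x. x \<in> ?B v)" for v
  have home: "home v \<in> pt ` ?B v" if "v \<in> pverts G" for v
    using some_in_eq[of "?B v"] conn_nonempty[OF connB[OF that]] by (auto simp: home_def)
  define S where "S e = ?B (u e) \<union> ?B (w e)" for e
  \<comment> \<open>The load counts only visits to vertices of \<open>D\<close>, so the route may
    use the subdivision of every edge that meets \<open>S e\<close>.\<close>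
  define T where "T e = pt ` S e \<union> {b \<in> pverts H - pt ` pverts D. own b \<in> {f. f \<inter> S e \<noteq> {}}}" for e
  have "\<exists>xs. xs \<noteq> [] \<and> hd xs = home (u e) \<and> last xs = home (w e) \<and> distinct xs \<and>
      (\<forall>i. Suc i < length xs \<longrightarrow> (xs ! i, xs ! Suc i) \<in> parcs H \<inter> T e \<times> T e)" if e: "e \<in> edges G" for e
  proof -
    have "\<exists>s\<in>?B (u e). \<exists>t\<in>?B (w e). s = t \<or> (s, t) \<in> parcs D"
      using touchB[of "u e" "w e"] uw[OF e] by (auto simp: touch_def)
    then have cS: "conn (parcs D) (S e)"
      unfolding S_def using conn_Un[OF sym_D connB[OF uwV(1)[OF e]] connB[OF uwV(2)[OF e]]] by blast
    have "conn (parcs H) (T e)"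
      unfolding T_def
    proof (rule subdivision_conn[OF symH c1 c2 _ sym_D cS])
      show "f \<in> {f. f \<inter> S e \<noteq> {}}" if "f \<in> edges D" "f \<subseteq> S e" for f
        using that by (auto simp: edges_def)
    qed (use own in auto)
    moreover have "home (u e) \<in> T e" "home (w e) \<in> T e" using home uwV[OF e] by (auto simp: T_def S_def)
    ultimately have "(home (u e), home (w e)) \<in> (parcs H \<inter> T e \<times> T e)\<^sup>*" by (rule connD)
    then show ?thesis by (rule rtrancl_simple_path) blast
  qed
  then obtain \<pi> where \<pi>: "\<And>e. e \<in> edges G \<Longrightarrow> \<pi> e \<noteq> [] \<and> hd (\<pi> e) = home (u e) \<and> last (\<pi> e) = home (w e) \<and> distinct (\<pi> e) \<and>
      (\<forall>i. Suc i < length (\<pi> e) \<longrightarrow> (\<pi> e ! i, \<pi> e ! Suc i) \<in> parcs H \<inter> T e \<times> T e)"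
    by metis
  have \<pi>_ends: "\<pi> e ! 0 = home (u e)" "\<pi> e ! (length (\<pi> e) - 1) = home (w e)" if "e \<in> edges G" for e
    using \<pi>[OF that] by (metis hd_conv_nth, metis last_conv_nth)
  \<comment> \<open>A path consisting of one vertex is padded to one degenerate step, and
    \<open>h\<close> repeats the last vertex to match.\<close>
  define n where "n e = max 1 (length (\<pi> e) - 1)" for e
  define h where "h e i = \<pi> e ! min i (length (\<pi> e) - 1)" for e i
  have hT: "h e i \<in> T e" if e: "e \<in> edges G" for e i
  proof -
    let ?i = "min i (length (\<pi> e) - 1)"
    have len: "?i < length (\<pi> e)" using \<pi>[OF e] by (cases "\<pi> e") auto
    show ?thesis
    proof (cases "Suc ?i < length (\<pi> e)")
      case True
      then show ?thesis using \<pi>[OF e] by (auto simp: h_def)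
    next
      case False
      then have "?i = length (\<pi> e) - 1" using len by linarith
      then have "h e i = home (w e)" unfolding h_def using \<pi>_ends(2)[OF e] by (simp only:)
      then show ?thesis using home uwV[OF e] by (auto simp: T_def S_def)
    qed
  qed
  interpret routing G H "pt ` pverts D" \<nu> home u w n h "k * \<Delta>"
  proof (rule routing.intro)
    show "home v \<in> pt ` pverts D" if "v \<in> pverts G" for v using home[OF that] BD by auto
  next
    fix e assume e: "e \<in> edges G"
    show "{u e, w e} = e" using uw[OF e] by simp
    show "0 < n e" by (simp add: n_def)
    show "h e 0 = home (u e)" using \<pi>_ends(1)[OF e] by (simp add: h_def)
    have "min (n e) (length (\<pi> e) - 1) = length (\<pi> e) - 1" by (simp add: n_def)
    then show "h e (n e) = home (w e)" unfolding h_def using \<pi>_ends(2)[OF e] by (simp only:)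
    fix i assume i: "i < n e"
    show "(n e = 1 \<and> h e i = h e (Suc i)) \<or> ((h e i, h e (Suc i)) \<in> parcs H \<and> inj_on (h e) {..n e})"
    proof (cases "length (\<pi> e) \<le> 1")
      case True
      then have "length (\<pi> e) - 1 = 0" by simp
      then show ?thesis by (simp add: n_def h_def)
    next
      case False
      then have n: "n e = length (\<pi> e) - 1" by (simp add: n_def)
      have "inj_on (h e) {..n e}"
        using \<pi>[OF e] False by (auto simp: inj_on_def h_def n nth_eq_iff_index_eq)
      moreover have "(h e i, h e (Suc i)) \<in> parcs H" using \<pi>[OF e] i False by (simp add: h_def n)
      ultimately show ?thesis by blast
    qed
  next
    fix x assume "x \<in> pt ` pverts D"
    then obtain z where z: "z \<in> pverts D" "x = pt z" by auto
    have "{e \<in> edges G. x \<in> h e ` {..n e}} \<subseteq> (\<Union>v\<in>bag z. (\<lambda>w'. {v, w'}) ` {w'. (v, w') \<in> parcs G})"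
    proof
      fix e assume "e \<in> {e \<in> edges G. x \<in> h e ` {..n e}}"
      then have e: "e \<in> edges G" "x \<in> T e" using hT by auto
      then have "pt z \<in> pt ` S e" using z by (auto simp: T_def)
      then have "z \<in> S e" using inj_on_image_mem_iff[OF inj z(1), of "S e"] BD by (auto simp: S_def)
      then have "u e \<in> bag z \<or> w e \<in> bag z" by (auto simp: S_def bags_containing_def)
      then obtain v where v: "v \<in> bag z" "v = u e \<or> v = w e" by blast
      have "(w e, u e) \<in> parcs G" using uw[OF e(1)] symG by (auto dest: symD)
      then have "\<exists>w'. {v, w'} = e \<and> (v, w') \<in> parcs G"
        using v(2) uw[OF e(1)] by (auto simp: insert_commute)
      then show "e \<in> (\<Union>v\<in>bag z. (\<lambda>w'. {v, w'}) ` {w'. (v, w') \<in> parcs G})" using v(1) by blast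
    qed
    moreover have fin: "finite (bag z)" "finite {w'. (v, w') \<in> parcs G}" for v
      using finite_subset[OF bagG[OF z(1)] finG] finite_subset[of "{w'. (v, w') \<in> parcs G}" "pverts G"] PG finG by auto
    ultimately have "card {e \<in> edges G. x \<in> h e ` {..n e}} \<le> card (\<Union>v\<in>bag z. (\<lambda>w'. {v, w'}) ` {w'. (v, w') \<in> parcs G})"
      by (intro card_mono) auto
    also have "\<dots> \<le> (\<Sum>v\<in>bag z. card ((\<lambda>w'. {v, w'}) ` {w'. (v, w') \<in> parcs G}))" by (rule card_UN_le[OF fin(1)])
    also have "\<dots> \<le> (\<Sum>v\<in>bag z. \<Delta>)"
    proof (rule sum_mono)
      fix v assume "v \<in> bag z"
      then have "card {w'. (v, w') \<in> parcs G} \<le> \<Delta>" using deg bagG[OF z(1)] by auto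
      then show "card ((\<lambda>w'. {v, w'}) ` {w'. (v, w') \<in> parcs G}) \<le> \<Delta>" using card_image_le[OF fin(2)] order_trans by blast
    qed
    also have "\<dots> \<le> k * \<Delta>" using width[OF z(1)] by simp
    finally show "card {e \<in> edges G. x \<in> h e ` {..n e}} \<le> k * \<Delta>" .
  qed (fact G, fact H, fact bd, fact ptH)
  show ?thesis using drawing_exists card_image[OF inj] by simp
qed

text \<open>All inner vertices of a subdivided edge are sent to the class of one chosen end
  \<open>en\<close>. They then hang on a vertex of that class, so the classes remain connected in
  the straight subdivision, where they can be contracted.\<close>

lemma planar_quotient:
  fixes D :: "'b pair_pre_digraph" and f :: "'b \<Rightarrow> 'c"
  assumes D: "pair_graph D" "planar D"
    and fib: "\<And>x. x \<in> pverts D \<Longrightarrow> conn (parcs D) {y \<in> pverts D. f y = f x}"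
  obtains D' :: "complex pair_pre_digraph" and g where "planar D'" "pair_graph D'" "inj_on g (pverts D')"
    "g ` pverts D' = f ` pverts D"
    "\<forall>a b. (a, b) \<in> parcs D \<longrightarrow> f a \<noteq> f b \<longrightarrow> (\<exists>a' b'. (a', b') \<in> parcs D' \<and> g a' = f a \<and> g b' = f b)"
proof -
  have sym_D: "sym (parcs D)" and PD: "parcs D \<subseteq> pverts D \<times> pverts D" using D by (auto simp: pair_graph_iff)
  obtain H :: "complex pair_pre_digraph" and pt :: "'b \<Rightarrow> complex" and own :: "complex \<Rightarrow> 'b set" and \<nu>
    where H: "straight H" and inj: "inj_on pt (pverts D)" and ptH: "pt ` pverts D \<subseteq> pverts H"
    and own: "\<And>b. b \<in> pverts H \<Longrightarrow> b \<notin> pt ` pverts D \<Longrightarrow> own b \<in> edges D"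
    and c1: "\<And>x y. (x, y) \<in> parcs D \<Longrightarrow> conn (parcs H) (insert (pt x) {b \<in> pverts H - pt ` pverts D. own b = {x, y}})"
    and c2: "\<And>x y. (x, y) \<in> parcs D \<Longrightarrow> conn (parcs H) ({pt x, pt y} \<union> {b \<in> pverts H - pt ` pverts D. own b = {x, y}})"
    and bd: "bends (parcs H) (pt ` pverts D) \<nu>"
    by (rule straight_subdivision[OF D]) blast
  let ?W = "pt ` pverts D"
  have symH: "sym (parcs H)" using H by (simp add: pdraw_def pair_graph_iff)
  define en where "en e = (SOME x. x \<in> (e :: 'b set))" for e
  have en: "en e \<in> e" "en e \<in> pverts D" if "e \<in> edges D" for e
  proof -
    have "e \<noteq> {}" "e \<subseteq> pverts D" using that PD by (auto simp: edges_def)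
    then show "en e \<in> e" "en e \<in> pverts D" using some_in_eq[of e] by (auto simp: en_def)
  qed
  define g where "g p = (if p \<in> ?W then f (inv_into (pverts D) pt p) else f (en (own p)))" for p
  have gpt: "g (pt x) = f x" if "x \<in> pverts D" for x using that inj by (simp add: g_def)
  have gim: "g ` pverts H = f ` pverts D"
  proof
    show "g ` pverts H \<subseteq> f ` pverts D"
    proof
      fix c assume "c \<in> g ` pverts H"
      then obtain p where p: "p \<in> pverts H" "c = g p" by auto
      show "c \<in> f ` pverts D"
        using p gpt en(2)[OF own[OF p(1)]] by (cases "p \<in> ?W") (auto simp: g_def)
    qed
    show "f ` pverts D \<subseteq> g ` pverts H"
    proof
      fix c assume "c \<in> f ` pverts D"
      then obtain x where "x \<in> pverts D" "c = f x" by auto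
      then show "c \<in> g ` pverts H" using gpt[of x] ptH by (metis image_eqI image_subset_iff)
    qed
  qed
  have fibH: "conn (straight_arcs H (\<lambda>e. convex hull e)) {q \<in> pverts H. g q = g p}" if p: "p \<in> pverts H" for p
  proof -
    have "g p \<in> f ` pverts D" using gim p by blast
    then obtain x where x: "x \<in> pverts D" "g p = f x" by auto
    let ?S = "{y \<in> pverts D. f y = f x}"
    let ?F = "{e. f (en e) = f x}"
    have "{q \<in> pverts H. g q = g p} = pt ` ?S \<union> {b \<in> pverts H - ?W. own b \<in> ?F}"
    proof (rule set_eqI)
      fix q
      show "q \<in> {q \<in> pverts H. g q = g p} \<longleftrightarrow> q \<in> pt ` ?S \<union> {b \<in> pverts H - ?W. own b \<in> ?F}"
      proof (cases "q \<in> ?W")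
        case True
        then obtain y where y: "y \<in> pverts D" "q = pt y" by auto
        have "q \<in> pt ` ?S \<longleftrightarrow> y \<in> ?S" unfolding y(2) by (rule inj_on_image_mem_iff[OF inj y(1)]) auto
        then show ?thesis using True y gpt[OF y(1)] ptH x(2) by auto
      next
        case False
        then have "q \<notin> pt ` ?S" by auto
        then show ?thesis using False x(2) by (simp add: g_def)
      qed
    qed
    moreover have "conn (parcs H) (pt ` ?S \<union> {b \<in> pverts H - ?W. own b \<in> ?F})"
    proof (rule subdivision_conn[OF symH c1 c2 _ sym_D fib[OF x(1)]])
      show "e \<inter> ?S \<noteq> {}" if "e \<in> edges D" "e \<in> ?F" for e using en[OF that(1)] that(2) by blast
      show "e \<in> ?F" if "e \<in> edges D" "e \<subseteq> ?S" for e using en[OF that(1)] that(2) by blast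
    qed (use own in auto)
    moreover have "straight_arcs H (\<lambda>e. convex hull e) = parcs H"
      by (auto simp: straight_arcs_def segment_convex_hull)
    ultimately show ?thesis by simp
  qed
  obtain D' where D': "planar D'" "pair_graph D'" "inj_on g (pverts D')" "g ` pverts D' = g ` pverts H"
    and arc: "\<And>a b. (a, b) \<in> parcs H \<Longrightarrow> g a \<noteq> g b \<Longrightarrow> \<exists>a' b'. (a', b') \<in> parcs D' \<and> g a' = g a \<and> g b' = g b"
    using pdraw_quotient[OF H fibH] by blast
  have "\<exists>a' b'. (a', b') \<in> parcs D' \<and> g a' = f x \<and> g b' = f y" if xy: "(x, y) \<in> parcs D" "f x \<noteq> f y" for x y
  proof -
    let ?C = "{pt x, pt y} \<union> {b \<in> pverts H - ?W. own b = {x, y}}"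
    have V: "x \<in> pverts D" "y \<in> pverts D" using xy PD by auto
    have "{x, y} \<in> edges D" using xy by (auto simp: edges_def)
    then have "en {x, y} \<in> {x, y}" by (rule en)
    then have vals: "g p = f x \<or> g p = f y" if "p \<in> ?C" for p
      using that gpt V by (auto simp: g_def)
    \<comment> \<open>Along the subdivided edge the class changes from that of \<open>x\<close> to
      that of \<open>y\<close>, and an arc at which it changes survives the quotient.\<close>
    let ?T = "{p \<in> ?C. g p = f x}"
    have "pt x \<in> ?T" "pt y \<notin> ?T" using gpt V xy(2) by auto
    then obtain a b where ab: "a \<in> ?T" "b \<in> ?C - ?T" "(a, b) \<in> parcs H"
      using conn_crossing_arc[OF c2[OF xy(1)], of ?T] by blast
    then have "g a = f x" "g b = f y" using vals[of b] by auto
    then show ?thesis using arc[OF ab(3)] xy(2) by auto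
  qed
  then show ?thesis using that[OF D'(1-3)] D'(4) gim by auto
qed

section \<open>Coarsening a decomposition\<close>

lemma planar_subgraph:
  assumes "planar D" "pverts D' \<subseteq> pverts D" "parcs D' \<subseteq> parcs D" "parcs D' \<subseteq> pverts D' \<times> pverts D'"
  shows "planar D'"
proof -
  obtain d where d: "is_drawing D d" "crossings D d = {}" using assms(1) by (auto simp: planar_def)
  have E: "edges D' \<subseteq> edges D" using assms(3) by (auto simp: edges_def)
  have c: "crossings D' d = {}" using d(2) E unfolding crossings_def by blast
  have sub: "e \<subseteq> pverts D'" if "e \<in> edges D'" for e using that assms(4) by (auto simp: edges_def)
  have "is_drawing D' d"
    unfolding is_drawing_def
  proof (intro conjI ballI impI)
    show "inj_on (vertex_point d) (pverts D')" using d(1) assms(2) by (auto simp: is_drawing_def intro: inj_on_subset)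
  next
    fix e assume e: "e \<in> edges D'"
    then have e': "e \<in> edges D" using E by auto
    show "arc (edge_curve d e)" "{pathstart (edge_curve d e), pathfinish (edge_curve d e)} = vertex_point d ` e"
      using d(1) e' by (auto simp: is_drawing_def)
    fix v assume "v \<in> pverts D' - e"
    then have "v \<in> pverts D - e" using assms(2) by auto
    then show "vertex_point d v \<notin> edge_image d e" using d(1) e' unfolding is_drawing_def by blast
  next
    fix e f g assume h: "e \<in> edges D'" "f \<in> edges D'" "e \<noteq> f"
    have "z \<in> vertex_point d ` pverts D'" if "z \<in> edge_image d e" "z \<in> edge_image d f" for z
    proof -
      have "z \<in> vertex_point d ` (e \<inter> f)" using c h that unfolding crossings_def by blast
      then show ?thesis using sub[OF h(1)] by auto
    qed
    then show "edge_image d e \<inter> edge_image d f \<inter> edge_image d g \<subseteq> vertex_point d ` pverts D'" by blast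
  qed
  then show ?thesis using c by (auto simp: planar_def)
qed

text \<open>Conditions (2) and (3) ask for decompositions with vertices in \<open>nat\<close>, while
  the constructions produce points of the plane. The drawing is reused by reading its points and
  curves through the inverse of the renaming.\<close>

lemma decomposition_on_nat:
  fixes G :: "'a pair_pre_digraph" and D :: "'b pair_pre_digraph"
  assumes dec: "decomposition G D bag" and pl: "planar D"
  obtains D' :: "nat pair_pre_digraph" and bag' where "decomposition G D' bag'" "planar D'"
    "card (pverts D') = card (pverts D)" "bag' ` pverts D' = bag ` pverts D"
proof -
  have D: "pair_graph D" using dec by (simp add: decomposition_def)
  have symm: "sym (parcs D)" and finD: "finite (pverts D)" and PD: "parcs D \<subseteq> pverts D \<times> pverts D" and nl: "\<And>a b. (a, b) \<in> parcs D \<Longrightarrow> a \<noteq> b"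
    using D by (auto simp: pair_graph_iff)
  obtain \<beta> :: "'b \<Rightarrow> nat" where b: "inj_on \<beta> (pverts D)" using finite_imp_inj_to_nat_seg[OF finD] by blast
  define \<alpha> where "\<alpha> = inv_into (pverts D) \<beta>"
  have ab: "\<alpha> (\<beta> x) = x" if "x \<in> pverts D" for x using b that by (simp add: \<alpha>_def)
  define D' where "D' = \<lparr>pverts = \<beta> ` pverts D, parcs = (\<lambda>(x, y). (\<beta> x, \<beta> y)) ` parcs D\<rparr>"
  have arc': "(p, q) \<in> parcs D' \<longleftrightarrow> (\<exists>x y. p = \<beta> x \<and> q = \<beta> y \<and> (x, y) \<in> parcs D)" for p q
    by (auto simp: D'_def)
  have symm': "sym (parcs D')" using symm unfolding sym_def arc' by blast
  have D'g: "pair_graph D'"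
    unfolding pair_graph_iff
  proof (intro conjI allI impI)
    fix p q assume "(p, q) \<in> parcs D'"
    then obtain x y where xy: "p = \<beta> x" "q = \<beta> y" "(x, y) \<in> parcs D" by (auto simp: arc')
    then show "p \<noteq> q" using nl[OF xy(3)] PD inj_onD[OF b, of x y] by auto
  qed (use finD PD symm' in \<open>auto simp: D'_def\<close>)
  have B: "bags_containing D' (bag \<circ> \<alpha>) v = \<beta> ` bags_containing D bag v" for v
    by (auto simp: bags_containing_def D'_def ab)
  have "decomposition G D' (bag \<circ> \<alpha>)"
    unfolding decomposition_iff[OF symm'] B
  proof (intro conjI ballI)
    show "pair_graph D'" by (rule D'g)
    show "(bag \<circ> \<alpha>) p \<subseteq> pverts G" if "p \<in> pverts D'" for p
      using that dec by (auto simp: D'_def ab decomposition_def)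
    show "conn (parcs D') (\<beta> ` bags_containing D bag v)" if "v \<in> pverts G" for v
      using dec that unfolding decomposition_iff[OF symm] by (intro conn_image[of "parcs D"]) (auto simp: arc')
    fix vw assume vw: "vw \<in> parcs G"
    obtain v w where [simp]: "vw = (v, w)" by (cases vw)
    have "touch D (bags_containing D bag v) (bags_containing D bag w)"
      using dec vw unfolding decomposition_iff[OF symm] by auto
    then have "touch D' (\<beta> ` bags_containing D bag v) (\<beta> ` bags_containing D bag w)"
      unfolding touch_def arc' by blast
    then show "case vw of (v, w) \<Rightarrow> touch D' (\<beta> ` bags_containing D bag v) (\<beta> ` bags_containing D bag w)" by simp
  qed
  moreover have "planar D'"
  proof -
    obtain d where d: "is_drawing D d" "crossings D d = {}" using pl by (auto simp: planar_def)
    have inj: "inj_on (vertex_point d) (pverts D)" using d(1) by (simp add: is_drawing_def)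
    have dj: "edge_image d E \<inter> edge_image d F \<subseteq> vertex_point d ` (E \<inter> F)"
      if "E \<in> edges D" "F \<in> edges D" "E \<noteq> F" for E F
      using d(2) that unfolding crossings_def by blast
    have img: "\<alpha> ` {\<beta> x, \<beta> y} = {x, y}" if "(x, y) \<in> parcs D" for x y using that PD ab by auto
    show ?thesis
    proof (rule planarI_arcs[OF D'g, of "vertex_point d \<circ> \<alpha>" "\<lambda>E. edge_image d (\<alpha> ` E)"])
      show "inj_on (vertex_point d \<circ> \<alpha>) (pverts D')"
        using inj b by (intro comp_inj_on) (auto simp: inj_on_def D'_def ab)
    next
      fix p q assume "(p, q) \<in> parcs D'"
      then obtain x y where xy: "p = \<beta> x" "q = \<beta> y" "(x, y) \<in> parcs D" by (auto simp: arc')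
      then have e: "{x, y} \<in> edges D" and V: "x \<in> pverts D" "y \<in> pverts D" using PD by (auto simp: edges_def)
      have h: "arc (edge_curve d {x, y})"
        "{pathstart (edge_curve d {x, y}), pathfinish (edge_curve d {x, y})} = vertex_point d ` {x, y}"
        "\<And>v. v \<in> pverts D - {x, y} \<Longrightarrow> vertex_point d v \<notin> edge_image d {x, y}"
        using d(1) e unfolding is_drawing_def by blast+
      show "\<exists>\<gamma>. arc \<gamma> \<and> {pathstart \<gamma>, pathfinish \<gamma>} = {(vertex_point d \<circ> \<alpha>) p, (vertex_point d \<circ> \<alpha>) q} \<and>
          path_image \<gamma> = edge_image d (\<alpha> ` {p, q})"
        unfolding xy(1,2) img[OF xy(3)] using h(1,2) V by (intro exI[of _ "edge_curve d {x, y}"]) (simp add: ab)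
      fix r assume r: "r \<in> pverts D'" "(vertex_point d \<circ> \<alpha>) r \<in> edge_image d (\<alpha> ` {p, q})"
      then obtain z where z: "r = \<beta> z" "z \<in> pverts D" by (auto simp: D'_def)
      have "vertex_point d z \<in> edge_image d {x, y}"
        using r(2) unfolding xy(1,2) img[OF xy(3)] z(1) comp_apply ab[OF z(2)] .
      then have "z \<in> {x, y}" using h(3)[of z] z(2) by blast
      then show "r \<in> {p, q}" unfolding z(1) xy(1,2) by blast
    next
      fix p q p' q' assume "(p, q) \<in> parcs D'" "(p', q') \<in> parcs D'" and ne: "{p, q} \<noteq> {p', q'}"
      then obtain x y x' y' where xy: "p = \<beta> x" "q = \<beta> y" "(x, y) \<in> parcs D" "p' = \<beta> x'" "q' = \<beta> y'" "(x', y') \<in> parcs D"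
        by (auto simp: arc')
      then have e: "{x, y} \<in> edges D" "{x', y'} \<in> edges D" by (auto simp: edges_def)
      have "{x, y} \<noteq> {x', y'}"
      proof
        assume "{x, y} = {x', y'}"
        then have "\<beta> ` {x, y} = \<beta> ` {x', y'}" by (rule arg_cong)
        then show False using ne unfolding xy(1,2,4,5) by simp
      qed
      note dj[OF e this]
      moreover have "vertex_point d ` ({x, y} \<inter> {x', y'}) \<subseteq> vertex_point d ` (\<alpha> ` ({p, q} \<inter> {p', q'}))"
      proof (rule image_mono)
        have "z \<in> \<alpha> ` ({p, q} \<inter> {p', q'})" if z: "z \<in> {x, y}" "z \<in> {x', y'}" for z
        proof -
          have "z \<in> pverts D" using z(1) xy(3) PD by auto
          then have "z = \<alpha> (\<beta> z)" by (simp add: ab)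
          moreover have "\<beta> z \<in> \<beta> ` {x, y}" "\<beta> z \<in> \<beta> ` {x', y'}" using z by blast+
          then have "\<beta> z \<in> {p, q} \<inter> {p', q'}" unfolding xy(1,2,4,5) by simp
          ultimately show ?thesis by (rule image_eqI)
        qed
        then show "{x, y} \<inter> {x', y'} \<subseteq> \<alpha> ` ({p, q} \<inter> {p', q'})" by blast
      qed
      ultimately show "edge_image d (\<alpha> ` {p, q}) \<inter> edge_image d (\<alpha> ` {p', q'}) \<subseteq> (vertex_point d \<circ> \<alpha>) ` ({p, q} \<inter> {p', q'})"
        unfolding xy(1,2,4,5) img[OF xy(3)] img[OF xy(6)] image_comp[symmetric] by (rule order_trans)
    qed
  qed
  moreover have "card (pverts D') = card (pverts D)" using card_image[OF b] by (simp add: D'_def)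
  moreover have "(bag \<circ> \<alpha>) ` pverts D' = bag ` pverts D" by (auto simp: D'_def ab image_image)
  ultimately show ?thesis using that by blast
qed

text \<open>For symmetric \<open>E\<close> these are the unions of connected components. Unlike
  connectedness the property passes to all unions, which allows small components to be
  pooled.\<close>

definition arc_closed :: "'b rel \<Rightarrow> 'b set \<Rightarrow> bool" where
  "arc_closed E A \<longleftrightarrow> (\<forall>a\<in>A. \<forall>b. (a, b) \<in> E \<longrightarrow> b \<in> A)"

text \<open>Take a partition into few parts that are small and connected or small and a union of
  components. Two adjacent light parts could be merged, so every light part that is not a union of
  components is absorbed by an adjacent heavy one.\<close>

lemma balanced_partition:
  fixes H :: "'b pair_pre_digraph"
  assumes H: "pair_graph H" and deg: "\<And>x. x \<in> pverts H \<Longrightarrow> card {y. (x, y) \<in> parcs H} \<le> \<delta>" and s: "1 \<le> s"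
  obtains f :: "'b \<Rightarrow> 'b set" where
    "\<And>x. x \<in> pverts H \<Longrightarrow> conn (parcs H) {y \<in> pverts H. f y = f x} \<or> arc_closed (parcs H) {y \<in> pverts H. f y = f x}"
    "\<And>x. x \<in> pverts H \<Longrightarrow> card {y \<in> pverts H. f y = f x} \<le> 2 * s + 2 * s * \<delta> * s"
    "card (f ` pverts H) * s \<le> card (pverts H) + s"
proof -
  let ?V = "pverts H" and ?E = "parcs H"
  have symm: "sym ?E" and finV: "finite ?V" and PE: "?E \<subseteq> ?V \<times> ?V" using H by (auto simp: pair_graph_iff)
  define good where "good A \<longleftrightarrow> card A < 2 * s \<and> (conn ?E A \<or> arc_closed ?E A)" for A
  define ok where "ok P \<longleftrightarrow> partition_on ?V P \<and> (\<forall>A\<in>P. good A)" for P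
  have "ok ((\<lambda>x. {x}) ` ?V)"
    using s by (auto simp: ok_def good_def partition_on_def disjoint_def)
  \<comment> \<open>With the fewest parts possible, the union of two parts is never admissible; the
    size bound \<open>2 * s\<close> leaves room for two parts of size below
    \<open>s\<close>.\<close>
  then obtain P where ok: "ok P" and min: "\<And>P'. ok P' \<Longrightarrow> card P \<le> card P'"
    using ex_has_least_nat[of ok "(\<lambda>x. {x}) ` ?V" card] by blast
  have part: "partition_on ?V P" and good: "\<And>A. A \<in> P \<Longrightarrow> good A" using ok by (auto simp: ok_def)
  have finP: "finite P" using finite_elements[OF finV part] .
  have PV: "A \<subseteq> ?V" if "A \<in> P" for A using part that by (auto simp: partition_on_def)
  have finA: "finite A" if "A \<in> P" for A using finite_subset[OF PV[OF that] finV] .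
  have disj: "A \<inter> B = {}" if "A \<in> P" "B \<in> P" "A \<noteq> B" for A B
    using part that by (auto simp: partition_on_def disjoint_def)
  have no_merge: "\<not> good (A \<union> B)" if AB: "A \<in> P" "B \<in> P" "A \<noteq> B" for A B
  proof
    assume g: "good (A \<union> B)"
    let ?P = "insert (A \<union> B) (P - {A, B})"
    have "\<Union>?P = \<Union>P" using AB by auto
    then have "\<Union>?P = ?V" using part by (simp add: partition_on_def)
    moreover have "{} \<notin> ?P" using part AB by (auto simp: partition_on_def)
    moreover have "disjoint ?P"
      unfolding disjoint_def
    proof (intro ballI impI)
      fix X Y assume X: "X \<in> ?P" and Y: "Y \<in> ?P" and "X \<noteq> Y"
      have new: "(A \<union> B) \<inter> Z = {}" if "Z \<in> P - {A, B}" for Z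
        using disj[of A Z] disj[of B Z] AB that by auto
      consider "X = A \<union> B" "Y \<in> P - {A, B}" | "Y = A \<union> B" "X \<in> P - {A, B}" | "X \<in> P" "Y \<in> P"
        using X Y \<open>X \<noteq> Y\<close> by blast
      then show "X \<inter> Y = {}"
      proof cases
        case 1 then show ?thesis using new by simp
      next
        case 2 then show ?thesis using new[OF 2(2)] by (simp add: Int_commute)
      next
        case 3 then show ?thesis using disj \<open>X \<noteq> Y\<close> by simp
      qed
    qed
    ultimately have "partition_on ?V ?P" by (simp add: partition_on_def)
    then have "ok ?P" using good g by (auto simp: ok_def)
    moreover have "card ?P < card P"
    proof -
      have "card (P - {A, B}) = card P - 2" "2 \<le> card P"
        using AB finP card_mono[OF finP, of "{A, B}"] by (simp_all add: card_Diff_subset)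
      moreover have "card ?P \<le> Suc (card (P - {A, B}))" using finP by (simp add: card_insert_if)
      ultimately show ?thesis by linarith
    qed
    ultimately show False using min[of ?P] by linarith
  qed
  have adj: "\<not> (card A < s \<and> card B < s)" if AB: "A \<in> P" "B \<in> P" "A \<noteq> B" "a \<in> A" "b \<in> B" "(a, b) \<in> ?E" for A B a b
  proof
    assume l: "card A < s \<and> card B < s"
    have "b \<notin> A" "a \<notin> B" using disj[OF AB(1-3)] AB by auto
    moreover have "(b, a) \<in> ?E" using symm AB(6) by (auto dest: symD)
    ultimately have "\<not> arc_closed ?E A" "\<not> arc_closed ?E B" using AB unfolding arc_closed_def by blast+
    then have "conn ?E A" "conn ?E B" using good[OF AB(1)] good[OF AB(2)] by (auto simp: good_def)
    then have "conn ?E (A \<union> B)" using conn_Un[OF symm] AB by blast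
    moreover have "card (A \<union> B) < 2 * s" using card_Un_le[of A B] l by linarith
    ultimately show False using no_merge[OF AB(1-3)] by (simp add: good_def)
  qed
  \<comment> \<open>Two light unions of components could be pooled. The one that may remain causes
    the summand \<open>s\<close> in the bound on the number of parts.\<close>
  have one_closed: "A = B" if AB: "A \<in> P" "B \<in> P" "card A < s" "card B < s" "arc_closed ?E A" "arc_closed ?E B" for A B
  proof (rule ccontr)
    assume "A \<noteq> B"
    have "arc_closed ?E (A \<union> B)" using AB unfolding arc_closed_def by blast
    moreover have "card (A \<union> B) < 2 * s" using card_Un_le[of A B] AB by linarith
    ultimately show False using no_merge[OF AB(1,2) \<open>A \<noteq> B\<close>] by (simp add: good_def)
  qed
  define L where "L = {A \<in> P. card A < s \<and> \<not> arc_closed ?E A}"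
  have "\<exists>B a b. B \<in> P \<and> \<not> card B < s \<and> a \<in> A \<and> b \<in> B \<and> (a, b) \<in> ?E" if A: "A \<in> L" for A
  proof -
    have AP: "A \<in> P" "card A < s" using A by (auto simp: L_def)
    obtain a b where ab: "a \<in> A" "(a, b) \<in> ?E" "b \<notin> A" using A by (auto simp: L_def arc_closed_def)
    then have "b \<in> \<Union>P" using PE part by (auto simp: partition_on_def)
    then obtain B where B: "B \<in> P" "b \<in> B" by auto
    then have "A \<noteq> B" using ab by auto
    then have "\<not> card B < s" using adj[OF AP(1) B(1) _ ab(1) B(2) ab(2)] AP by auto
    then show ?thesis using B ab by blast
  qed
  then obtain h a b where h: "\<And>A. A \<in> L \<Longrightarrow> h A \<in> P \<and> \<not> card (h A) < s \<and> a A \<in> A \<and> b A \<in> h A \<and> (a A, b A) \<in> ?E"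
    by metis
  have hL: "h A \<notin> L" if "A \<in> L" for A using h[OF that] by (auto simp: L_def)
  have LP: "A \<in> P" if "A \<in> L" for A using that by (simp add: L_def)
  define q where "q x = (SOME A. A \<in> P \<and> x \<in> A)" for x
  have q: "q x \<in> P \<and> x \<in> q x" if "x \<in> ?V" for x
  proof -
    have "\<exists>A. A \<in> P \<and> x \<in> A" using that part by (auto simp: partition_on_def)
    then show ?thesis unfolding q_def by (rule someI_ex)
  qed
  have q_eq: "q x = A" if "A \<in> P" "x \<in> A" for x A
  proof (rule ccontr)
    assume "q x \<noteq> A"
    then show False using disj[of "q x" A] q[of x] that PV[OF that(1)] by blast
  qed
  define f where "f x = (if q x \<in> L then h (q x) else q x)" for x
  have fP: "f x \<in> P - L" if "x \<in> ?V" for x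
    using q[OF that] h[of "q x"] hL[of "q x"] by (auto simp: f_def)
  let ?K = "\<lambda>c. {A \<in> L. h A = c}"
  have fiber: "{y \<in> ?V. f y = c} = c \<union> \<Union>(?K c)" if c: "c \<in> P - L" for c
  proof (intro set_eqI iffI)
    fix y assume "y \<in> {y \<in> ?V. f y = c}"
    then have y: "y \<in> ?V" "f y = c" by auto
    show "y \<in> c \<union> \<Union>(?K c)"
    proof (cases "q y \<in> L")
      case True then show ?thesis using y q[OF y(1)] by (auto simp: f_def)
    next
      case False then show ?thesis using y q[OF y(1)] by (auto simp: f_def)
    qed
  next
    fix y assume "y \<in> c \<union> \<Union>(?K c)"
    then consider "y \<in> c" | A where "A \<in> L" "h A = c" "y \<in> A" by blast
    then show "y \<in> {y \<in> ?V. f y = c}"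
    proof cases
      case 1 then show ?thesis using c q_eq[of c y] PV[of c] by (auto simp: f_def)
    next
      case 2 then show ?thesis using q_eq[of A y] PV[of A] LP by (auto simp: f_def)
    qed
  qed
  show ?thesis
  proof (rule that[of f])
    fix x assume x: "x \<in> ?V"
    define c where "c = f x"
    have c: "c \<in> P - L" using fP[OF x] by (simp add: c_def)
    have F: "{y \<in> ?V. f y = f x} = c \<union> \<Union>(?K c)" using fiber[OF c] by (simp add: c_def)
    have finK: "finite (?K c)" using finP by (auto simp: L_def)
    have K: "conn ?E A \<and> a A \<in> A \<and> b A \<in> c \<and> (a A, b A) \<in> ?E \<and> (b A, a A) \<in> ?E \<and> a A \<notin> c" if "A \<in> ?K c" for A
    proof -
      have A: "A \<in> L" "A \<in> P" "c = h A" using that LP by auto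
      have "conn ?E A" using good[OF A(2)] A(1) by (auto simp: good_def L_def)
      moreover have "A \<noteq> c" using c A(1) by blast
      then have "A \<inter> c = {}" using disj[OF A(2), of c] c by blast
      then have "a A \<notin> c" using h[OF A(1)] by blast
      ultimately show ?thesis using h[OF A(1)] A(3) symm by (auto dest: symD)
    qed
    show "conn ?E {y \<in> ?V. f y = f x} \<or> arc_closed ?E {y \<in> ?V. f y = f x}"
    proof (cases "?K c = {}")
      case True
      show ?thesis unfolding F True using good[of c] c by (simp add: good_def)
    next
      case False
      then obtain A0 where A0: "A0 \<in> ?K c" by blast
      have "\<not> arc_closed ?E c" using K[OF A0] unfolding arc_closed_def by blast
      then have cc: "conn ?E c" using good[of c] c by (auto simp: good_def)
      have "conn ?E (c \<union> (\<Union>A\<in>?K c. {b A} \<union> A))"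
      proof (rule conn_UNION[OF symm cc])
        fix A assume A: "A \<in> ?K c"
        have "conn ?E ({b A} \<union> A)" using K[OF A] by (intro conn_Un[OF symm, of _ _ "b A" "a A"]) auto
        then show "conn ?E ({b A} \<union> A) \<and> c \<inter> ({b A} \<union> A) \<noteq> {}" using K[OF A] by auto
      qed
      moreover have "c \<union> (\<Union>A\<in>?K c. {b A} \<union> A) = c \<union> \<Union>(?K c)" using K by auto
      ultimately show ?thesis unfolding F by simp
    qed
    have cs: "card c \<le> 2 * s" using good[of c] c by (auto simp: good_def)
    have finN: "finite {y. (v, y) \<in> ?E}" for v using finite_subset[of "{y. (v, y) \<in> ?E}" ?V] PE finV by auto
    \<comment> \<open>Distinct absorbed parts contain distinct neighbours of \<open>c\<close>. As
      \<open>c\<close> has fewer than \<open>2 * s\<close> vertices of degree at most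
      \<open>\<delta>\<close>, it absorbs at most \<open>2 * s * \<delta>\<close> parts.\<close>
    have "inj_on a (?K c)"
    proof (rule inj_onI)
      fix A B assume AB: "A \<in> ?K c" "B \<in> ?K c" "a A = a B"
      then have "a A \<in> A \<inter> B" using K[OF AB(1)] K[OF AB(2)] by auto
      then show "A = B" using disj[of A B] LP AB by blast
    qed
    then have "card (?K c) = card (a ` ?K c)" by (rule card_image[symmetric])
    also have "\<dots> \<le> card (\<Union>v\<in>c. {y. (v, y) \<in> ?E})"
      using K finA[of c] c finN by (intro card_mono) auto
    also have "\<dots> \<le> (\<Sum>v\<in>c. card {y. (v, y) \<in> ?E})" using finA[of c] c by (intro card_UN_le) auto
    also have "\<dots> \<le> (\<Sum>v\<in>c. \<delta>)" using deg PV[of c] c by (intro sum_mono) auto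
    also have "\<dots> \<le> 2 * s * \<delta>" using cs by simp
    finally have cK: "card (?K c) \<le> 2 * s * \<delta>" .
    have "card (c \<union> \<Union>(?K c)) \<le> card c + card (\<Union>A\<in>?K c. A)" using card_Un_le[of c "\<Union>(?K c)"] by simp
    also have "card (\<Union>A\<in>?K c. A) \<le> (\<Sum>A\<in>?K c. card A)" by (rule card_UN_le[OF finK])
    also have "(\<Sum>A\<in>?K c. card A) \<le> (\<Sum>A\<in>?K c. s)" by (intro sum_mono) (auto simp: L_def)
    also have "\<dots> \<le> 2 * s * \<delta> * s" using cK by simp
    finally show "card {y \<in> ?V. f y = f x} \<le> 2 * s + 2 * s * \<delta> * s" unfolding F using cs by linarith
  next
    let ?heavy = "{A \<in> P. \<not> card A < s}" and ?cl = "{A \<in> P. card A < s \<and> arc_closed ?E A}"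
    have "f ` ?V \<subseteq> ?heavy \<union> ?cl" using fP by (auto simp: L_def)
    then have "card (f ` ?V) \<le> card (?heavy \<union> ?cl)" using finP by (intro card_mono) auto
    also have "\<dots> \<le> card ?heavy + card ?cl" by (rule card_Un_le)
    also have "card ?cl \<le> 1" using finite_if_all_eq[of ?cl] one_closed by blast
    finally have 1: "card (f ` ?V) \<le> card ?heavy + 1" by simp
    have "card ?heavy * s = (\<Sum>A\<in>?heavy. s)" by simp
    also have "\<dots> \<le> (\<Sum>A\<in>?heavy. card A)" by (intro sum_mono) auto
    also have "\<dots> \<le> (\<Sum>A\<in>P. card A)" using finP by (intro sum_mono2) auto
    also have "\<dots> = card (\<Union>P)" using finA disj by (intro card_Union_disjoint[symmetric]) (auto simp: pairwise_def disjnt_def)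
    also have "\<dots> = card ?V" using part by (simp add: partition_on_def)
    finally have 2: "card ?heavy * s \<le> card ?V" .
    have "card (f ` ?V) * s \<le> (card ?heavy + 1) * s" using 1 by (rule mult_le_mono1)
    then show "card (f ` ?V) * s \<le> card ?V + s" using 2 by simp
  qed
qed

text \<open>A fibre that is not connected cannot be contracted, but it is a union of components, so
  no arc leaves it and a single isolated vertex can stand for it. Only the connected fibres go
  through the planar quotient.\<close>

lemma decomposition_coarsen:
  fixes G :: "'a pair_pre_digraph" and H :: "'b pair_pre_digraph" and f :: "'b \<Rightarrow> 'c"
  assumes dec: "decomposition G H bag" and pl: "planar H" and bag: "\<And>x. x \<in> pverts H \<Longrightarrow> card (bag x) \<le> k"
    and fib: "\<And>x. x \<in> pverts H \<Longrightarrow> conn (parcs H) {y \<in> pverts H. f y = f x} \<or> arc_closed (parcs H) {y \<in> pverts H. f y = f x}"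
    and fc: "\<And>x. x \<in> pverts H \<Longrightarrow> card {y \<in> pverts H. f y = f x} \<le> C"
  obtains D :: "complex pair_pre_digraph" and bag' where "decomposition G D bag'" "planar D"
    "\<forall>z\<in>pverts D. card (bag' z) \<le> C * k" "card (pverts D) = card (f ` pverts H)"
proof -
  let ?V = "pverts H" and ?E = "parcs H"
  have H: "pair_graph H" using dec by (simp add: decomposition_def)
  have symm: "sym ?E" and finV: "finite ?V" and PE: "?E \<subseteq> ?V \<times> ?V" and nl: "\<And>a b. (a, b) \<in> ?E \<Longrightarrow> a \<noteq> b"
    using H by (auto simp: pair_graph_iff)
  let ?F = "\<lambda>x. {y \<in> ?V. f y = f x}"
  define V1 where "V1 = {x \<in> ?V. conn ?E (?F x)}"
  define r where "r c = (SOME x. x \<in> ?V \<and> f x = c)" for c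
  have r: "r (f x) \<in> ?V \<and> f (r (f x)) = f x" if "x \<in> ?V" for x
    unfolding r_def by (rule someI[of _ x]) (use that in simp)
  define R where "R = (\<lambda>x. r (f x)) ` (?V - V1)"
  \<comment> \<open>\<open>R\<close> has one representative for every disconnected fibre. Arcs are
    kept only inside \<open>V1\<close>, so these representatives are isolated.\<close>
  define H1 where "H1 = \<lparr>pverts = V1 \<union> R, parcs = ?E \<inter> V1 \<times> V1\<rparr>"
  have V1iff: "x \<in> V1 \<longleftrightarrow> y \<in> V1" if "x \<in> ?V" "y \<in> ?V" "f x = f y" for x y
    using that by (simp add: V1_def)
  have RV: "R \<subseteq> ?V - V1"
  proof
    fix y assume "y \<in> R"
    then obtain x where x: "x \<in> ?V" "x \<notin> V1" "y = r (f x)" unfolding R_def by blast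
    then have "y \<in> ?V" "f y = f x" using r[OF x(1)] by simp_all
    then show "y \<in> ?V - V1" using V1iff[of y x] x(1,2) by simp
  qed
  have V1V: "V1 \<subseteq> ?V" by (auto simp: V1_def)
  have H1g: "pair_graph H1"
    unfolding pair_graph_iff
  proof (intro conjI allI impI)
    show "finite (pverts H1)" using finite_subset[OF V1V finV] finite_subset[OF RV] finV by (simp add: H1_def)
    show "sym (parcs H1)" using symm by (auto simp: H1_def sym_def)
  qed (use nl in \<open>auto simp: H1_def\<close>)
  have H1p: "planar H1" using V1V RV by (intro planar_subgraph[OF pl]) (auto simp: H1_def)
  have fib1: "conn (parcs H1) {y \<in> pverts H1. f y = f x}" if x: "x \<in> pverts H1" for x
  proof (cases "x \<in> V1")
    case True
    then have xV: "x \<in> ?V" using V1V by auto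
    have sub: "?F x \<subseteq> V1" using V1iff[OF xV] True by auto
    have "pverts H1 \<subseteq> ?V" "V1 \<subseteq> pverts H1" using V1V RV by (auto simp: H1_def)
    then have "{y \<in> pverts H1. f y = f x} = ?F x" using sub by blast
    moreover have "conn (parcs H1) (?F x)"
    proof (rule conn_mono)
      show "conn ?E (?F x)" using True by (simp add: V1_def)
      have "?F x \<times> ?F x \<subseteq> V1 \<times> V1" using sub by (rule Sigma_mono) (use sub in simp)
      then show "?E \<inter> ?F x \<times> ?F x \<subseteq> parcs H1" unfolding H1_def by (simp add: le_infI2)
    qed
    ultimately show ?thesis by simp
  next
    case False
    then have "x \<in> R" using x by (simp add: H1_def)
    then have xV: "x \<in> ?V - V1" using RV by auto
    have "y = x" if "y \<in> pverts H1" "f y = f x" for y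
    proof -
      have "y \<notin> V1" using V1iff[of y x] that V1V xV by auto
      then have "y \<in> R" using that by (simp add: H1_def)
      obtain x' where x': "x' \<in> ?V - V1" "x = r (f x')" using \<open>x \<in> R\<close> by (auto simp: R_def)
      obtain y' where y': "y' \<in> ?V - V1" "y = r (f y')" using \<open>y \<in> R\<close> by (auto simp: R_def)
      have "f x' = f x" "f y' = f y" using r[of x'] r[of y'] x' y' by simp_all
      then have "f x' = f y'" using that(2) by simp
      then show ?thesis unfolding x'(2) y'(2) by simp
    qed
    then have "{y \<in> pverts H1. f y = f x} = {x}" using x by blast
    then show ?thesis by simp
  qed
  obtain D :: "complex pair_pre_digraph" and g where D: "planar D" "pair_graph D" "inj_on g (pverts D)"
    "g ` pverts D = f ` pverts H1"
    and arc: "\<forall>a b. (a, b) \<in> parcs H1 \<longrightarrow> f a \<noteq> f b \<longrightarrow> (\<exists>a' b'. (a', b') \<in> parcs D \<and> g a' = f a \<and> g b' = f b)"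
    by (rule planar_quotient[OF H1g H1p fib1])
  have symmD: "sym (parcs D)" and PD: "parcs D \<subseteq> pverts D \<times> pverts D" using D(2) by (auto simp: pair_graph_iff)
  have f1: "f ` pverts H1 = f ` ?V"
  proof
    show "f ` pverts H1 \<subseteq> f ` ?V" using V1V RV by (auto simp: H1_def)
    show "f ` ?V \<subseteq> f ` pverts H1"
    proof
      fix c assume "c \<in> f ` ?V"
      then obtain x where x: "x \<in> ?V" "c = f x" by auto
      show "c \<in> f ` pverts H1"
      proof (cases "x \<in> V1")
        case True then show ?thesis using x by (auto simp: H1_def)
      next
        case False
        then have "r (f x) \<in> pverts H1" using x by (auto simp: H1_def R_def)
        then show ?thesis using r[OF x(1)] x(2) by (metis image_eqI)
      qed
    qed
  qed
  define \<psi> where "\<psi> x = inv_into (pverts D) g (f x)" for x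
  have \<psi>: "\<psi> x \<in> pverts D" "g (\<psi> x) = f x" if "x \<in> ?V" for x
  proof -
    have "f x \<in> g ` pverts D" using that D(4) f1 by auto
    then show "\<psi> x \<in> pverts D" "g (\<psi> x) = f x" unfolding \<psi>_def by (auto intro: inv_into_into f_inv_into_f)
  qed
  have \<psi>_eq: "\<psi> x = z" if "z \<in> pverts D" "g z = f x" for x z
    using that D(3) by (metis \<psi>_def inv_into_f_f)
  have \<psi>arc: "\<psi> a = \<psi> b \<or> (\<psi> a, \<psi> b) \<in> parcs D" if ab: "(a, b) \<in> ?E" for a b
  proof (cases "f a = f b")
    case True then show ?thesis by (simp add: \<psi>_def)
  next
    case False
    have V: "a \<in> ?V" "b \<in> ?V" and ba: "(b, a) \<in> ?E" using ab PE symm by (auto dest: symD)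
    \<comment> \<open>An arc between different fibres shows that neither is a union of components.
      Both are therefore connected, and the arc is present in \<open>H1\<close>.\<close>
    have "\<not> arc_closed ?E (?F a)" "\<not> arc_closed ?E (?F b)"
      using False V ab ba unfolding arc_closed_def by (metis (mono_tags, lifting) mem_Collect_eq)+
    then have "a \<in> V1" "b \<in> V1" using fib V by (auto simp: V1_def)
    then have "(a, b) \<in> parcs H1" using ab by (simp add: H1_def)
    then obtain a' b' where ab': "(a', b') \<in> parcs D" "g a' = f a" "g b' = f b" using arc False by blast
    then have "\<psi> a = a'" "\<psi> b = b'" using \<psi>_eq PD by auto
    then show ?thesis using ab' by simp
  qed
  define bag' where "bag' z = (\<Union>y\<in>{y \<in> ?V. f y = g z}. bag y)" for z
  have B: "bags_containing D bag' v = \<psi> ` bags_containing H bag v" for v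
  proof (intro set_eqI iffI)
    fix z assume "z \<in> bags_containing D bag' v"
    then obtain y where y: "z \<in> pverts D" "y \<in> ?V" "f y = g z" "v \<in> bag y" by (auto simp: bags_containing_def bag'_def)
    then show "z \<in> \<psi> ` bags_containing H bag v" using \<psi>_eq[of z y] by (auto simp: bags_containing_def)
  next
    fix z assume "z \<in> \<psi> ` bags_containing H bag v"
    then obtain y where "y \<in> ?V" "v \<in> bag y" "z = \<psi> y" by (auto simp: bags_containing_def)
    then show "z \<in> bags_containing D bag' v" using \<psi>[of y] by (auto simp: bags_containing_def bag'_def)
  qed
  have decH: "\<And>x. x \<in> ?V \<Longrightarrow> bag x \<subseteq> pverts G" "\<And>v. v \<in> pverts G \<Longrightarrow> conn ?E (bags_containing H bag v)"
    "\<And>v w. (v, w) \<in> parcs G \<Longrightarrow> touch H (bags_containing H bag v) (bags_containing H bag w)"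
    using dec unfolding decomposition_iff[OF symm] by auto
  have "decomposition G D bag'"
    unfolding decomposition_iff[OF symmD] B
  proof (intro conjI ballI)
    show "pair_graph D" by (rule D(2))
    show "bag' z \<subseteq> pverts G" for z using decH(1) by (auto simp: bag'_def)
    show "conn (parcs D) (\<psi> ` bags_containing H bag v)" if "v \<in> pverts G" for v
      using \<psi>arc by (intro conn_image[OF decH(2)[OF that]]) auto
    fix vw assume vw: "vw \<in> parcs G"
    obtain v w where [simp]: "vw = (v, w)" by (cases vw)
    have "touch D (\<psi> ` bags_containing H bag v) (\<psi> ` bags_containing H bag w)"
      using decH(3)[of v w] vw \<psi>arc unfolding touch_def by fastforce
    then show "case vw of (v, w) \<Rightarrow> touch D (\<psi> ` bags_containing H bag v) (\<psi> ` bags_containing H bag w)" by simp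
  qed
  moreover have bagC: "card (bag' z) \<le> C * k" if z: "z \<in> pverts D" for z
  proof -
    have "g z \<in> f ` ?V" using z D(4) f1 by auto
    then obtain x where x: "x \<in> ?V" "g z = f x" by auto
    have "card (bag' z) \<le> (\<Sum>y\<in>?F x. card (bag y))"
      unfolding bag'_def x(2) using finV by (intro card_UN_le) auto
    also have "\<dots> \<le> (\<Sum>y\<in>?F x. k)" using bag by (intro sum_mono) auto
    also have "\<dots> \<le> C * k" using fc[OF x(1)] by simp
    finally show ?thesis .
  qed
  moreover have "card (pverts D) = card (f ` ?V)" using card_image[OF D(3)] D(4) f1 by simp
  ultimately show ?thesis using that D(1) bagC by blast
qed

section \<open>Planarization of a drawing\<close>

definition consecutive :: "real set \<Rightarrow> real \<Rightarrow> real \<Rightarrow> bool" where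
  "consecutive T s t \<longleftrightarrow> s \<in> T \<and> t \<in> T \<and> s < t \<and> T \<inter> {s<..<t} = {}"

lemma consecutive_pred:
  assumes "finite T" "r \<in> T" "a \<in> T" "a < r"
  obtains s where "consecutive T s r" "a \<le> s"
proof -
  let ?A = "T \<inter> {..<r}"
  have "finite ?A" "a \<in> ?A" using assms by auto
  then have "Max ?A \<in> ?A" "a \<le> Max ?A" using Max_in[of ?A] Max_ge[of ?A a] by blast+
  moreover have "T \<inter> {Max ?A<..<r} = {}" using Max_ge[OF \<open>finite ?A\<close>] by force
  ultimately show ?thesis using that[of "Max ?A"] assms(2) by (auto simp: consecutive_def)
qed

lemma consecutive_unique:
  "consecutive T r t \<Longrightarrow> consecutive T r t' \<Longrightarrow> t = t'" "consecutive T s r \<Longrightarrow> consecutive T s' r \<Longrightarrow> s = s'"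
  unfolding consecutive_def by (metis Int_iff empty_iff greaterThanLessThan_iff linorder_neqE_linordered_idom)+

lemma consecutive_overlap:
  assumes "consecutive T s t" "consecutive T s' t'" "r \<in> {s..t}" "r \<in> {s'..t'}"
  shows "(s = s' \<and> t = t') \<or> r \<in> T"
proof (cases "s = s'")
  case True
  then show ?thesis using consecutive_unique(1)[of T s t t'] assms by auto
next
  case False
  have *: "r = t" if "consecutive T s t" "consecutive T s' t'" "r \<le> t" "s' \<le> r" "s < s'" for s t s' t'
    using that unfolding consecutive_def by (metis Int_iff antisym_conv2 empty_iff greaterThanLessThan_iff not_less order_trans)
  show ?thesis
    using *[of s t s' t'] *[of s' t' s t] assms False unfolding consecutive_def by (cases "s < s'") auto
qed

text \<open>The points from \<open>b\<close> on are left out: for \<open>b = 1\<close> this omits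
  the head of an edge, whose bag does not contain the tail.\<close>

lemma conn_initial_points:
  assumes fin: "finite T" and "0 \<in> T" "T \<subseteq> {0..}" and r: "r \<in> T" "r < b"
    and arc: "\<And>s t. consecutive T s t \<Longrightarrow> t < b \<Longrightarrow> (g s, g t) \<in> E"
  shows "(g 0, g r) \<in> (E \<inter> g ` {t \<in> T. t < b} \<times> g ` {t \<in> T. t < b})\<^sup>*"
  using r
proof (induction "card (T \<inter> {..<r})" arbitrary: r rule: less_induct)
  case less
  show ?case
  proof (cases "r = 0")
    case False
    then have "0 < r" using less.prems assms(3) by force
    then obtain s where s: "consecutive T s r" "0 \<le> s" using consecutive_pred[OF fin less.prems(1) assms(2)] by blast
    then have sT: "s \<in> T" "s < r" by (auto simp: consecutive_def)
    then have "T \<inter> {..<s} \<subset> T \<inter> {..<r}" by auto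
    then have "card (T \<inter> {..<s}) < card (T \<inter> {..<r})" using fin by (intro psubset_card_mono) auto
    then have "(g 0, g s) \<in> (E \<inter> g ` {t \<in> T. t < b} \<times> g ` {t \<in> T. t < b})\<^sup>*"
      using sT less.prems by (intro less.hyps) auto
    moreover have "(g s, g r) \<in> E \<inter> g ` {t \<in> T. t < b} \<times> g ` {t \<in> T. t < b}"
      using arc[OF s(1) less.prems(2)] sT less.prems by auto
    ultimately show ?thesis by (rule rtrancl_into_rtrancl)
  qed simp
qed

lemma card_le_2I: "finite S \<Longrightarrow> (\<And>x y z. x \<in> S \<Longrightarrow> y \<in> S \<Longrightarrow> z \<in> S \<Longrightarrow> x = y \<or> x = z \<or> y = z) \<Longrightarrow> card S \<le> 2"
proof (rule ccontr)
  assume S: "finite S" "\<And>x y z. x \<in> S \<Longrightarrow> y \<in> S \<Longrightarrow> z \<in> S \<Longrightarrow> x = y \<or> x = z \<or> y = z" "\<not> card S \<le> 2"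
  then have "3 \<le> card S" by simp
  then obtain U where "U \<subseteq> S" "card U = 3" by (metis obtain_subset_with_card_n)
  then obtain x y z where "x \<in> S" "y \<in> S" "z \<in> S" "x \<noteq> y" "x \<noteq> z" "y \<noteq> z" by (auto simp: card_3_iff)
  then show False using S(2)[of x y z] by blast
qed

text \<open>Every edge is cut at the vertices and crossings on it. A vertex \<open>v\<close> lies in
  its own bag and in those of all crossings on edges with tail \<open>v\<close>. These form initial
  stretches of such edges, all starting at \<open>v\<close>, hence a connected set, and the last
  stretch of each edge leads from this set to the head. For the degree, each edge through a point
  contributes at most two neighbours.\<close>

lemma planarization:
  fixes G :: "'a pair_pre_digraph"
  assumes G: "pair_graph G" and dr: "is_drawing G d" and finC: "finite (crossings G d)"
    and deg: "\<And>v. v \<in> pverts G \<Longrightarrow> card {w. (v, w) \<in> parcs G} \<le> \<Delta>"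
  obtains H :: "complex pair_pre_digraph" and bag where "pair_graph H" "planar H" "decomposition G H bag"
    "\<And>x. card (bag x) \<le> 2" "card (pverts H) \<le> card (pverts G) + card (crossings G d)"
    "\<And>x. x \<in> pverts H \<Longrightarrow> card {y. (x, y) \<in> parcs H} \<le> 2 * (\<Delta> + 2)"
proof -
  have symG: "sym (parcs G)" and finG: "finite (pverts G)" and PG: "parcs G \<subseteq> pverts G \<times> pverts G"
    and noloop: "\<And>a b. (a, b) \<in> parcs G \<Longrightarrow> a \<noteq> b"
    using G by (auto simp: pair_graph_iff)
  have finE: "finite (edges G)" using finG PG unfolding edges_def by (meson finite_SigmaI finite_imageI finite_subset)
  have sub: "e \<subseteq> pverts G" if "e \<in> edges G" for e using that PG by (auto simp: edges_def)
  define pt where "pt = vertex_point d"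
  define g where "g = edge_curve d"
  let ?V = "pt ` pverts G"
  have inj: "inj_on pt (pverts G)" and arcg: "\<And>e. e \<in> edges G \<Longrightarrow> arc (g e)"
    and endsg: "\<And>e. e \<in> edges G \<Longrightarrow> {pathstart (g e), pathfinish (g e)} = pt ` e"
    and avoid: "\<And>e v. e \<in> edges G \<Longrightarrow> v \<in> pverts G \<Longrightarrow> v \<notin> e \<Longrightarrow> pt v \<notin> path_image (g e)"
    and three: "\<And>e f l. e \<in> edges G \<Longrightarrow> f \<in> edges G \<Longrightarrow> l \<in> edges G \<Longrightarrow> e \<noteq> f \<Longrightarrow> e \<noteq> l \<Longrightarrow> f \<noteq> l \<Longrightarrow>
      path_image (g e) \<inter> path_image (g f) \<inter> path_image (g l) \<subseteq> ?V"
    using dr by (simp_all add: is_drawing_def pt_def g_def)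
  define X where "X = ?V \<union> crossings G d"
  have finX: "finite X" using finG finC by (simp add: X_def)
  have meet: "z \<in> X" if "e \<in> edges G" "f \<in> edges G" "e \<noteq> f" "z \<in> path_image (g e)" "z \<in> path_image (g f)" for e f z
  proof (cases "z \<in> pt ` (e \<inter> f)")
    case True then show ?thesis using sub[OF that(1)] by (auto simp: X_def)
  next
    case False then show ?thesis using that by (auto simp: X_def crossings_def pt_def g_def)
  qed
  have injg: "inj_on (g e) {0..1}" if "e \<in> edges G" for e using arcg[OF that] by (simp add: arc_def)
  have img: "path_image (g e) = g e ` {0..1}" for e by (simp add: path_image_def)
  define T where "T e = {t \<in> {0..1}. g e t \<in> X}" for e
  have finT: "finite (T e)" if "e \<in> edges G" for e
  proof -
    have "finite (g e -` X \<inter> {0..1})" using finite_vimage_IntI[OF finX injg[OF that]] .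
    moreover have "T e = g e -` X \<inter> {0..1}" by (auto simp: T_def)
    ultimately show ?thesis by simp
  qed
  have "\<exists>v. v \<in> e \<and> pt v = g e 0" "\<exists>v. v \<in> e \<and> pt v = g e 1" if "e \<in> edges G" for e
  proof -
    have "g e 0 \<in> pt ` e" "g e 1 \<in> pt ` e" using endsg[OF that] by (auto simp: pathstart_def pathfinish_def)
    then show "\<exists>v. v \<in> e \<and> pt v = g e 0" "\<exists>v. v \<in> e \<and> pt v = g e 1" by auto
  qed
  \<comment> \<open>The parametrization of its curve orients an edge.\<close>
  then obtain tl hd where tl: "\<And>e. e \<in> edges G \<Longrightarrow> tl e \<in> e \<and> pt (tl e) = g e 0"
    and hd: "\<And>e. e \<in> edges G \<Longrightarrow> hd e \<in> e \<and> pt (hd e) = g e 1" by metis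
  have tlV: "tl e \<in> pverts G" "hd e \<in> pverts G" if "e \<in> edges G" for e using tl[OF that] hd[OF that] sub[OF that] by auto
  have th: "{tl e, hd e} = e" if e: "e \<in> edges G" for e
  proof -
    have "g e 0 \<noteq> g e 1" using inj_onD[OF injg[OF e], of 0 1] by auto
    then have "tl e \<noteq> hd e" using tl[OF e] hd[OF e] by auto
    moreover obtain a b where "e = {a, b}" using e by (rule edgesE)
    ultimately show ?thesis using tl[OF e] hd[OF e] by auto
  qed
  have T01: "0 \<in> T e" "1 \<in> T e" if "e \<in> edges G" for e
    using tl[OF that] hd[OF that] tlV[OF that] by (auto simp: T_def X_def) (metis image_eqI)+
  have Tsub: "T e \<subseteq> {0..1}" for e by (auto simp: T_def)
  have TX: "g e t \<in> X" if "t \<in> T e" for e t using that by (auto simp: T_def)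
  have Tmem: "\<exists>t\<in>T e. p = g e t" if "p \<in> X" "p \<in> path_image (g e)" for e p
    using that by (auto simp: T_def img)
  have interior: "t = 0 \<or> t = 1" if e: "e \<in> edges G" and t: "t \<in> {0..1}" "g e t \<in> ?V" for e t
  proof -
    obtain v where v: "v \<in> pverts G" "g e t = pt v" using t(2) by auto
    have "v \<in> e"
    proof (rule ccontr)
      assume "v \<notin> e"
      from avoid[OF e v(1) this] show False using v(2) t(1) by (metis image_eqI img)
    qed
    then have "pt v \<in> {g e 0, g e 1}" using endsg[OF e] by (auto simp: pathstart_def pathfinish_def)
    then show ?thesis using inj_onD[OF injg[OF e], of t 0] inj_onD[OF injg[OF e], of t 1] v(2) t(1) by auto
  qed
  let ?c = "\<lambda>e. consecutive (T e)"
  define A where "A = {(p, q). \<exists>e s t. e \<in> edges G \<and> ?c e s t \<and> p = g e s \<and> q = g e t}"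
  define H where "H = \<lparr>pverts = X, parcs = A \<union> A\<inverse>\<rparr>"
  have AH: "(g e s, g e t) \<in> parcs H" "(g e t, g e s) \<in> parcs H" if "e \<in> edges G" "?c e s t" for e s t
  proof -
    have "(g e s, g e t) \<in> A" using that unfolding A_def by blast
    then show "(g e s, g e t) \<in> parcs H" "(g e t, g e s) \<in> parcs H" by (simp_all add: H_def)
  qed
  have HA: "\<exists>e s t. e \<in> edges G \<and> ?c e s t \<and> {a, b} = {g e s, g e t}" if "(a, b) \<in> parcs H" for a b
    using that by (auto simp: H_def A_def)
  have cT: "s \<in> T e" "t \<in> T e" "s < t" "0 \<le> s" "t \<le> 1" if "?c e s t" for e s t
    using that Tsub[of e] by (auto simp: consecutive_def)
  have cne: "g e s \<noteq> g e t" if "e \<in> edges G" "?c e s t" for e s t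
    using inj_onD[OF injg[OF that(1)], of s t] cT[OF that(2)] by auto
  have symH: "sym (parcs H)" by (auto simp: H_def sym_def)
  have H: "pair_graph H"
  proof -
    have "parcs H \<subseteq> X \<times> X" by (auto simp: H_def A_def intro: TX[OF cT(1)] TX[OF cT(2)])
    moreover have "a \<noteq> b" if "(a, b) \<in> parcs H" for a b
    proof -
      obtain e s t where "e \<in> edges G" "?c e s t" "{a, b} = {g e s, g e t}" using HA \<open>(a, b) \<in> parcs H\<close> by blast
      then show ?thesis using cne[of e s t] by (auto simp: doubleton_eq_iff)
    qed
    ultimately show ?thesis using finX symH unfolding pair_graph_iff by (simp add: H_def)
  qed
  \<comment> \<open>Two edges that cross twice in succession have parallel stretches with the same
    ends. \<open>H\<close> is simple, so the choice operator keeps one of them.\<close>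
  define P where "P E = (SOME S. \<exists>e s t. e \<in> edges G \<and> ?c e s t \<and> E = {g e s, g e t} \<and> S = g e ` {s..t})" for E
  have P: "\<exists>e s t. e \<in> edges G \<and> ?c e s t \<and> {a, b} = {g e s, g e t} \<and> P {a, b} = g e ` {s..t}" if "(a, b) \<in> parcs H" for a b
  proof -
    have "\<exists>S. \<exists>e s t. e \<in> edges G \<and> ?c e s t \<and> {a, b} = {g e s, g e t} \<and> S = g e ` {s..t}"
      using HA[OF that] by blast
    from someI_ex[OF this] show ?thesis unfolding P_def .
  qed
  have onP: "z \<in> {g e s, g e t}" if e: "e \<in> edges G" "?c e s t" and z: "z \<in> X" "z \<in> g e ` {s..t}" for e s t z
  proof -
    obtain r where r: "r \<in> {s..t}" "z = g e r" using z(2) by auto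
    then have "r \<in> T e" using z(1) cT[OF e(2)] by (auto simp: T_def)
    then have "r = s \<or> r = t" using e(2) r(1) by (force simp: consecutive_def)
    then show ?thesis using r(2) by auto
  qed
  have "planar H"
  proof (rule planarI_arcs[OF H, of id P])
    fix a b assume "(a, b) \<in> parcs H"
    then obtain e s t where e: "e \<in> edges G" "?c e s t" "{a, b} = {g e s, g e t}" "P {a, b} = g e ` {s..t}" using P by blast
    have "arc (subpath s t (g e))" using arcg[OF e(1)] cT[OF e(2)] by (intro arc_subpath_arc) auto
    moreover have "path_image (subpath s t (g e)) = g e ` {s..t}" using cT[OF e(2)] by (simp add: path_image_subpath)
    ultimately show "\<exists>\<gamma>. arc \<gamma> \<and> {pathstart \<gamma>, pathfinish \<gamma>} = {id a, id b} \<and> path_image \<gamma> = P {a, b}"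
      using e by (intro exI[of _ "subpath s t (g e)"]) (simp add: pathstart_subpath pathfinish_subpath)
  next
    fix a b v assume ab: "(a, b) \<in> parcs H" and v: "v \<in> pverts H" "id v \<in> P {a, b}"
    obtain e s t where e: "e \<in> edges G" "?c e s t" "{a, b} = {g e s, g e t}" "P {a, b} = g e ` {s..t}" using P[OF ab] by blast
    show "v \<in> {a, b}" using onP[OF e(1,2), of v] v e(3,4) by (simp add: H_def)
  next
    fix a b c d' assume ab: "(a, b) \<in> parcs H" and cd: "(c, d') \<in> parcs H" and ne: "{a, b} \<noteq> {c, d'}"
    obtain e s t where e: "e \<in> edges G" "?c e s t" "{a, b} = {g e s, g e t}" "P {a, b} = g e ` {s..t}" using P[OF ab] by blast
    obtain f s' t' where f: "f \<in> edges G" "?c f s' t'" "{c, d'} = {g f s', g f t'}" "P {c, d'} = g f ` {s'..t'}" using P[OF cd] by blast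
    show "P {a, b} \<inter> P {c, d'} \<subseteq> id ` ({a, b} \<inter> {c, d'})"
    proof
      fix z assume z: "z \<in> P {a, b} \<inter> P {c, d'}"
      then obtain r r' where r: "r \<in> {s..t}" "z = g e r" "r' \<in> {s'..t'}" "z = g f r'" using e(4) f(4) by auto
      have r01: "r \<in> {0..1}" "r' \<in> {0..1}" using r cT[OF e(2)] cT[OF f(2)] by auto
      have "z \<in> X"
      proof (cases "e = f")
        case True
        then have "r = r'" using inj_onD[OF injg[OF e(1)], of r r'] r r01 by auto
        moreover have "\<not> (s = s' \<and> t = t')" using ne e(3) f(3) True by auto
        ultimately have "r \<in> T e" using consecutive_overlap[of "T e" s t s' t' r] e(2) f(2) r True by auto
        then show ?thesis using TX r(2) by auto
      next
        case False
        have "z \<in> path_image (g e)" unfolding img using r(2) r01(1) by blast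
        moreover have "z \<in> path_image (g f)" unfolding img using r(4) r01(2) by blast
        ultimately show ?thesis by (rule meet[OF e(1) f(1) False])
      qed
      then show "z \<in> id ` ({a, b} \<inter> {c, d'})"
        using onP[OF e(1,2), of z] onP[OF f(1,2), of z] z e(3,4) f(3,4) by auto
    qed
  qed simp
  define Ex where "Ex p = {e \<in> edges G. p \<in> path_image (g e)}" for p
  have finEx: "finite (Ex p)" for p using finE by (simp add: Ex_def)
  have Ex2: "card (Ex p) \<le> 2" if "p \<notin> ?V" for p
  proof (rule card_le_2I[OF finEx])
    fix e f l assume "e \<in> Ex p" "f \<in> Ex p" "l \<in> Ex p"
    then show "e = f \<or> e = l \<or> f = l" using three[of e f l] that unfolding Ex_def by blast
  qed
  define bag where "bag p = (if p \<in> ?V then {v \<in> pverts G. pt v = p} else tl ` Ex p)" for p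
  have bagV: "bag p \<subseteq> pverts G" for p using tlV by (auto simp: bag_def Ex_def)
  have bag2: "card (bag p) \<le> 2" for p
  proof (cases "p \<in> ?V")
    case True
    then obtain v where "v \<in> pverts G" "p = pt v" by auto
    then have "{v \<in> pverts G. pt v = p} = {v}" using inj by (auto simp: inj_on_def)
    then show ?thesis using True by (simp add: bag_def)
  next
    case False
    then show ?thesis using card_image_le[OF finEx, of tl p] Ex2[OF False] by (simp add: bag_def)
  qed
  let ?B = "bags_containing H bag"
  have ptB: "pt v \<in> ?B v" if "v \<in> pverts G" for v
    using that by (auto simp: bags_containing_def bag_def H_def X_def)
  have edgeB: "g e t \<in> ?B (tl e)" if e: "e \<in> edges G" and t: "t \<in> T e" "t < 1" for e t
  proof (cases "t = 0")
    case True then show ?thesis using tl[OF e] ptB tlV[OF e] by metis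
  next
    case False
    then have "g e t \<notin> ?V" using interior[OF e, of t] t Tsub[of e] by auto
    moreover have "e \<in> Ex (g e t)" using e t Tsub[of e] by (auto simp: Ex_def img)
    ultimately show ?thesis using TX[OF t(1)] by (auto simp: bags_containing_def bag_def H_def)
  qed
  have connB: "conn (parcs H) (?B v)" if v: "v \<in> pverts G" for v
  proof (rule conn_via_root[OF symH ptB[OF v]])
    fix p assume p: "p \<in> ?B v"
    then have pX: "p \<in> X" "v \<in> bag p" by (auto simp: bags_containing_def H_def)
    show "(pt v, p) \<in> (parcs H \<inter> ?B v \<times> ?B v)\<^sup>*"
    proof (cases "p \<in> ?V")
      case True then show ?thesis using pX(2) by (auto simp: bag_def)
    next
      case False
      then obtain e where e: "e \<in> edges G" "v = tl e" "p \<in> path_image (g e)" using pX(2) by (auto simp: bag_def Ex_def)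
      obtain t where t: "t \<in> T e" "p = g e t" using Tmem[OF pX(1) e(3)] by blast
      have "t \<noteq> 1" using False hd[OF e(1)] tlV[OF e(1)] t(2) by (metis image_eqI)
      then have t1: "t < 1" using t(1) Tsub[of e] by force
      have "(g e 0, g e t) \<in> (parcs H \<inter> g e ` {t \<in> T e. t < 1} \<times> g e ` {t \<in> T e. t < 1})\<^sup>*"
        using T01[OF e(1)] Tsub[of e] AH[OF e(1)] t t1 by (intro conn_initial_points[OF finT[OF e(1)]]) auto
      from conn_rtrancl_mono[OF this, of "?B v"] show ?thesis
        using edgeB[OF e(1)] e(2) tl[OF e(1)] t(2) by auto
    qed
  qed
  have touchB: "touch H (?B v) (?B w)" if vw: "(v, w) \<in> parcs G" for v w
  proof -
    have e: "{v, w} \<in> edges G" using vw by (auto simp: edges_def)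
    let ?e = "{v, w}"
    \<comment> \<open>The last stretch of the edge: its start still has the tail in its bag, and its
      end is the point of the head.\<close>
    obtain s where s: "?c ?e s 1" using consecutive_pred[OF finT[OF e] T01(2)[OF e] T01(1)[OF e]] by auto
    have "g ?e s \<in> ?B (tl ?e)" using edgeB[OF e, of s] cT[OF s] by auto
    moreover have "g ?e 1 \<in> ?B (hd ?e)" using ptB[OF tlV(2)[OF e]] hd[OF e] by simp
    moreover have "v = tl ?e \<and> w = hd ?e \<or> v = hd ?e \<and> w = tl ?e"
      using th[OF e] noloop[OF vw] by (auto simp: doubleton_eq_iff)
    ultimately show ?thesis using AH[OF e s] unfolding touch_def by metis
  qed
  have "decomposition G H bag"
    unfolding decomposition_iff[OF symH] using H bagV connB touchB by auto
  moreover have "card (pverts H) \<le> card (pverts G) + card (crossings G d)"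
  proof -
    have "card X \<le> card ?V + card (crossings G d)" unfolding X_def by (rule card_Un_le)
    then show ?thesis using card_image[OF inj] by (simp add: H_def)
  qed
  moreover have "card {y. (x, y) \<in> parcs H} \<le> 2 * (\<Delta> + 2)" if x: "x \<in> pverts H" for x
  proof -
    \<comment> \<open>The successor and the predecessor of \<open>x\<close> along \<open>e\<close>,
      each unique if it exists.\<close>
    define Y where "Y e = {y. \<exists>s t. ?c e s t \<and> (x = g e s \<and> y = g e t)} \<union> {y. \<exists>s t. ?c e s t \<and> (x = g e t \<and> y = g e s)}" for e
    have Y2: "finite (Y e) \<and> card (Y e) \<le> 2" if e: "e \<in> edges G" for e
    proof -
      have eq: "s = s'" if "g e s = g e s'" "s \<in> T e" "s' \<in> T e" for s s'
        using inj_onD[OF injg[OF e] that(1)] that(2,3) Tsub[of e] by blast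
      define Y1 where "Y1 = {y. \<exists>s t. ?c e s t \<and> x = g e s \<and> y = g e t}"
      define Y2 where "Y2 = {y. \<exists>s t. ?c e s t \<and> x = g e t \<and> y = g e s}"
      have "y = y'" if "y \<in> Y1" "y' \<in> Y1" for y y'
      proof -
        obtain s t where st: "?c e s t" "x = g e s" "y = g e t" using \<open>y \<in> Y1\<close> by (auto simp: Y1_def)
        obtain s' t' where st': "?c e s' t'" "x = g e s'" "y' = g e t'" using \<open>y' \<in> Y1\<close> by (auto simp: Y1_def)
        have "s = s'" using eq[of s s'] st(2) st'(2) cT(1)[OF st(1)] cT(1)[OF st'(1)] by simp
        then show ?thesis using consecutive_unique(1)[OF st(1)] st'(1) st(3) st'(3) by simp
      qed
      then have 1: "finite Y1 \<and> card Y1 \<le> 1" using finite_if_all_eq[of Y1] by blast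
      have "y = y'" if "y \<in> Y2" "y' \<in> Y2" for y y'
      proof -
        obtain s t where st: "?c e s t" "x = g e t" "y = g e s" using \<open>y \<in> Y2\<close> by (auto simp: Y2_def)
        obtain s' t' where st': "?c e s' t'" "x = g e t'" "y' = g e s'" using \<open>y' \<in> Y2\<close> by (auto simp: Y2_def)
        have "t = t'" using eq[of t t'] st(2) st'(2) cT(2)[OF st(1)] cT(2)[OF st'(1)] by simp
        then show ?thesis using consecutive_unique(2)[OF st(1)] st'(1) st(3) st'(3) by simp
      qed
      then have 2: "finite Y2 \<and> card Y2 \<le> 1" using finite_if_all_eq[of Y2] by blast
      have "Y e = Y1 \<union> Y2" by (simp add: Y_def Y1_def Y2_def)
      then show ?thesis using 1 2 card_Un_le[of Y1 Y2] by simp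
    qed
    have "{y. (x, y) \<in> parcs H} \<subseteq> (\<Union>e\<in>Ex x. Y e)"
    proof
      fix y assume "y \<in> {y. (x, y) \<in> parcs H}"
      then obtain e s t where e: "e \<in> edges G" "?c e s t" "{x, y} = {g e s, g e t}" using HA by blast
      then have "y \<in> Y e" unfolding Y_def doubleton_eq_iff by blast
      moreover have "x \<in> {g e s, g e t}" using e(3) by blast
      then have "x \<in> path_image (g e)" using cT[OF e(2)] by (auto simp: img)
      ultimately show "y \<in> (\<Union>e\<in>Ex x. Y e)" using e(1) by (auto simp: Ex_def)
    qed
    moreover have "finite (\<Union>e\<in>Ex x. Y e)" using finEx Y2 by (auto simp: Ex_def)
    ultimately have "card {y. (x, y) \<in> parcs H} \<le> card (\<Union>e\<in>Ex x. Y e)" by (rule card_mono[rotated])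
    also have "\<dots> \<le> (\<Sum>e\<in>Ex x. card (Y e))" by (rule card_UN_le[OF finEx])
    also have "\<dots> \<le> (\<Sum>e\<in>Ex x. 2)" using Y2 by (intro sum_mono) (auto simp: Ex_def)
    also have "\<dots> = 2 * card (Ex x)" by simp
    \<comment> \<open>A single bound for both kinds of vertices of \<open>H\<close>: at most
      \<open>\<Delta>\<close> edges end at a vertex of \<open>G\<close>, and at most two pass
      through a crossing.\<close>
    also have "card (Ex x) \<le> \<Delta> + 2"
    proof (cases "x \<in> ?V")
      case True
      then obtain v where v: "v \<in> pverts G" "x = pt v" by auto
      have fw: "finite {w. (v, w) \<in> parcs G}" using PG finG by (auto intro: finite_subset[of _ "pverts G"])
      have "Ex x \<subseteq> (\<lambda>w. {v, w}) ` {w. (v, w) \<in> parcs G}"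
      proof
        fix e assume "e \<in> Ex x"
        then have e: "e \<in> edges G" "x \<in> path_image (g e)" by (auto simp: Ex_def)
        then have ve: "v \<in> e" using avoid v by blast
        obtain a b where ab: "e = {a, b}" "(a, b) \<in> parcs G" using e(1) by (rule edgesE)
        moreover have "(b, a) \<in> parcs G" using ab(2) symG by (auto dest: symD)
        ultimately show "e \<in> (\<lambda>w. {v, w}) ` {w. (v, w) \<in> parcs G}" using ve by (auto simp: insert_commute)
      qed
      then have "card (Ex x) \<le> card ((\<lambda>w. {v, w}) ` {w. (v, w) \<in> parcs G})" using fw by (intro card_mono) auto
      also have "\<dots> \<le> \<Delta>" using card_image_le[OF fw] deg[OF v(1)] order_trans by blast
      finally show ?thesis by simp
    next
      case False
      then show ?thesis using Ex2 by force
    qed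
    finally show ?thesis by simp
  qed
  ultimately show ?thesis using that[OF H \<open>planar H\<close>] bag2 by blast
qed

section \<open>The three conditions\<close>

text \<open>Without any drawing the infimum would be infinite, and a nonempty set of extended
  naturals contains its infimum.\<close>

lemma crossing_number_attained:
  assumes "crossing_number G \<noteq> \<infinity>"
  obtains d where "is_drawing G d" "finite (crossings G d)" "enat (card (crossings G d)) = crossing_number G"
proof -
  let ?A = "num_crossings G ` {d. is_drawing G d}"
  have eq: "crossing_number G = Inf ?A" by (simp add: crossing_number_def)
  have "?A \<noteq> {}"
  proof
    assume "?A = {}"
    then show False using assms eq by (simp add: Inf_enat_def)
  qed
  then have "Inf ?A \<in> ?A" unfolding Inf_enat_def by (auto intro: LeastI)
  then obtain d where d: "is_drawing G d" "num_crossings G d = crossing_number G" using eq by auto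
  then have "finite (crossings G d)" using assms by (auto simp: num_crossings_def split: if_splits)
  then show ?thesis using that[OF d(1)] d(2) by (simp add: num_crossings_def)
qed

lemma crossing_number_le: "is_drawing G d \<Longrightarrow> finite (crossings G d) \<Longrightarrow> crossing_number G \<le> enat (card (crossings G d))"
  unfolding crossing_number_def by (rule INF_lower2[of d]) (auto simp: num_crossings_def)

section \<open>Bounds in terms of degree, width and order\<close>

lemma card_neighbours_le_max_degree:
  assumes "pair_graph G" "v \<in> pverts G"
  shows "card {w. (v, w) \<in> parcs G} \<le> max_degree G"
proof -
  have "out_arcs (with_proj G) v = Pair v ` {w. (v, w) \<in> parcs G}" by (auto simp: out_arcs_def)
  then have "out_degree (with_proj G) v = card {w. (v, w) \<in> parcs G}"
    by (simp add: out_degree_def card_image inj_on_def)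
  moreover have "finite (pverts G)" using assms(1) by (simp add: pair_graph_iff)
  ultimately show ?thesis
    unfolding max_degree_def using assms(2)
    by (metis (no_types, lifting) bdd_above_finite cSUP_upper finite_imageI)
qed

lemma card_bag_le_width:
  assumes "pair_graph D" "x \<in> pverts D"
  shows "card (bag x) \<le> decomp_width D bag"
  unfolding decomp_width_def using assms
  by (intro cSUP_upper bdd_above_finite) (auto simp: pair_graph_iff)

lemma width_leI:
  assumes "\<And>x. x \<in> pverts D \<Longrightarrow> card (bag x) \<le> k"
  shows "decomp_width D bag \<le> k"
proof (cases "pverts D = {}")
  case False
  then show ?thesis unfolding decomp_width_def using assms by (intro cSUP_least) auto
qed (simp add: decomp_width_def)

lemma decomposition_crossing_number:
  fixes G :: "'a pair_pre_digraph" and D :: "'b pair_pre_digraph"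
  assumes "pair_graph G" "decomposition G D bag" "planar D" "decomp_width D bag \<le> k" "max_degree G \<le> \<Delta>"
  shows "crossing_number G \<le> enat (decomp_order D * (2 * (k * \<Delta>))\<^sup>2)"
proof -
  have D: "pair_graph D" using assms(2) by (simp add: decomposition_def)
  have "\<exists>d. is_drawing G d \<and> finite (crossings G d) \<and> card (crossings G d) \<le> card (pverts D) * (2 * (k * \<Delta>))\<^sup>2"
  proof (rule decomposition_crossing_bound[OF assms(1-3)])
    show "card (bag x) \<le> k" if "x \<in> pverts D" for x
      using card_bag_le_width[OF D that] assms(4) by (rule order_trans)
    show "card {w. (v, w) \<in> parcs G} \<le> \<Delta>" if "v \<in> pverts G" for v
      using card_neighbours_le_max_degree[OF assms(1) that] assms(5) by (rule order_trans)
  qed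
  then show ?thesis using crossing_number_le unfolding decomp_order_def by (meson enat_ord_simps(1) order_trans)
qed

lemma linear_crossings_planarization:
  fixes G :: "'a pair_pre_digraph"
  assumes G: "pair_graph G" and deg: "max_degree G \<le> \<Delta>" and cr: "crossing_number G \<le> enat m"
  obtains H :: "complex pair_pre_digraph" and bag where "pair_graph H" "planar H" "decomposition G H bag"
    "\<And>x. card (bag x) \<le> 2" "card (pverts H) \<le> card (pverts G) + m"
    "\<And>x. x \<in> pverts H \<Longrightarrow> card {y. (x, y) \<in> parcs H} \<le> 2 * (\<Delta> + 2)"
proof -
  have "crossing_number G \<noteq> \<infinity>"
  proof
    assume "crossing_number G = \<infinity>"
    then show False using cr by simp
  qed
  then obtain d where d: "is_drawing G d" "finite (crossings G d)" "enat (card (crossings G d)) = crossing_number G"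
    by (rule crossing_number_attained)
  have m: "card (crossings G d) \<le> m" using d(3) cr by (metis enat_ord_simps(1))
  have "card {w. (v, w) \<in> parcs G} \<le> \<Delta>" if "v \<in> pverts G" for v
    using card_neighbours_le_max_degree[OF G that] deg by (rule order_trans)
  from planarization[OF G d(1,2) this] obtain H :: "complex pair_pre_digraph" and bag where H: "pair_graph H" "planar H" "decomposition G H bag"
    "\<And>x. card (bag x) \<le> 2" "card (pverts H) \<le> card (pverts G) + card (crossings G d)"
    "\<And>x. x \<in> pverts H \<Longrightarrow> card {y. (x, y) \<in> parcs H} \<le> 2 * (\<Delta> + 2)" by metis
  show ?thesis using that[OF H(1-4) _ H(6)] H(5) m by linarith
qed

text \<open>With \<open>s = 2 * (1 + c)\<close> the number q of parts satisfies q * s \<le> (1 + c)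
  * n + s, that is 2 * q \<le> n + 2. In \<open>K\<close> the bracket is the size of a part together
  with all it absorbs, for degree \<open>2 * (\<Delta> + 2)\<close>, and the last factor 2 is the
  width before coarsening.\<close>

lemma small_order_decomposition:
  fixes G :: "'a pair_pre_digraph"
  assumes G: "pair_graph G" and deg: "max_degree G \<le> \<Delta>" and cr: "crossing_number G \<le> enat (c * card (pverts G))"
    and s: "s = 2 * (1 + c)" and K: "K = (2 * s + 2 * s * (2 * (\<Delta> + 2)) * s) * 2"
  shows "\<exists>(D :: nat pair_pre_digraph) bag. decomposition G D bag \<and> planar D \<and> decomp_width D bag \<le> K \<and>
    decomp_order D \<le> card (pverts G)"
proof -
  let ?n = "card (pverts G)"
  obtain H :: "complex pair_pre_digraph" and bag where H: "pair_graph H" "planar H" "decomposition G H bag"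
    "\<And>x. card (bag x) \<le> 2" "card (pverts H) \<le> ?n + c * ?n"
    "\<And>x. x \<in> pverts H \<Longrightarrow> card {y. (x, y) \<in> parcs H} \<le> 2 * (\<Delta> + 2)"
    using linear_crossings_planarization[OF G deg cr] by blast
  have s1: "1 \<le> s" by (simp add: s)
  obtain f :: "complex \<Rightarrow> complex set" where
    f: "\<And>x. x \<in> pverts H \<Longrightarrow> conn (parcs H) {y \<in> pverts H. f y = f x} \<or> arc_closed (parcs H) {y \<in> pverts H. f y = f x}"
    "\<And>x. x \<in> pverts H \<Longrightarrow> card {y \<in> pverts H. f y = f x} \<le> 2 * s + 2 * s * (2 * (\<Delta> + 2)) * s"
    "card (f ` pverts H) * s \<le> card (pverts H) + s"
    using balanced_partition[OF H(1,6) s1] by blast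
  obtain D :: "complex pair_pre_digraph" and bag' where D: "decomposition G D bag'" "planar D"
    "\<forall>z\<in>pverts D. card (bag' z) \<le> (2 * s + 2 * s * (2 * (\<Delta> + 2)) * s) * 2"
    "card (pverts D) = card (f ` pverts H)"
    by (rule decomposition_coarsen[OF H(3,2,4) f(1,2)])
  obtain D' :: "nat pair_pre_digraph" and bag'' where D': "decomposition G D' bag''" "planar D'"
    "card (pverts D') = card (pverts D)" "bag'' ` pverts D' = bag' ` pverts D"
    by (rule decomposition_on_nat[OF D(1,2)])
  have "card (bag'' x) \<le> K" if "x \<in> pverts D'" for x
  proof -
    have "bag'' x \<in> bag' ` pverts D" using D'(4) that by blast
    then show ?thesis using D(3) K by auto
  qed
  then have "decomp_width D' bag'' \<le> K" by (rule width_leI)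
  moreover have "card (pverts D') \<le> ?n"
  \<comment> \<open>The inequality 2 * q \<le> n + 2 yields q \<le> n only for positive n. For n = 0
    the planarization is empty and so is its quotient.\<close>
  proof (cases "?n = 0")
    case True
    then have "card (pverts H) = 0" using H(5) by simp
    then have "pverts H = {}" using H(1) by (simp add: pair_graph_iff)
    then show ?thesis using D'(3) D(4) by simp
  next
    case False
    let ?q = "card (pverts D')"
    have "?q * s \<le> card (pverts H) + s" using f(3) D'(3) D(4) by simp
    then have "?q * s \<le> ?n + c * ?n + s" using H(5) by linarith
    then have "(2 * ?q) * (1 + c) \<le> (?n + 2) * (1 + c)" by (simp add: s algebra_simps)
    then have "2 * ?q \<le> ?n + 2" by (simp only: mult_le_cancel2)
    then show ?thesis using False by linarith
  qed
  ultimately show ?thesis using D'(1,2) unfolding decomp_order_def by blast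
qed

lemma width_two_decomposition:
  fixes G :: "'a pair_pre_digraph"
  assumes G: "pair_graph G" and cr: "crossing_number G \<le> enat (c * card (pverts G))"
  shows "\<exists>(D :: nat pair_pre_digraph) bag. decomposition G D bag \<and> planar D \<and> decomp_width D bag \<le> 2 \<and>
    decomp_order D \<le> (1 + c) * card (pverts G)"
proof -
  obtain H :: "complex pair_pre_digraph" and bag where H: "pair_graph H" "planar H" "decomposition G H bag"
    "\<And>x. card (bag x) \<le> 2" "card (pverts H) \<le> card (pverts G) + c * card (pverts G)"
    "\<And>x. x \<in> pverts H \<Longrightarrow> card {y. (x, y) \<in> parcs H} \<le> 2 * (max_degree G + 2)"
    by (rule linear_crossings_planarization[OF G order_refl cr]) blast
  obtain D' :: "nat pair_pre_digraph" and bag'' where D': "decomposition G D' bag''" "planar D'"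
    "card (pverts D') = card (pverts H)" "bag'' ` pverts D' = bag ` pverts H"
    by (rule decomposition_on_nat[OF H(3,2)])
  have "card (bag'' x) \<le> 2" if "x \<in> pverts D'" for x
  proof -
    have "bag'' x \<in> bag ` pverts H" using D'(4) that by blast
    then show ?thesis using H(4) by auto
  qed
  then have "decomp_width D' bag'' \<le> 2" by (rule width_leI)
  moreover have "decomp_order D' \<le> (1 + c) * card (pverts G)"
    unfolding decomp_order_def D'(3) using H(5) by simp
  ultimately show ?thesis using D'(1,2) by blast
qed

theorem theorem4p5:
  fixes \<Delta> :: int and \<G> :: "'a pair_pre_digraph set"
  assumes "\<And>G. G \<in> \<G> \<Longrightarrow> pair_graph G"
    and "\<And>G. G \<in> \<G> \<Longrightarrow> int (max_degree G) \<le> \<Delta>"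
  defines "cond1 \<equiv> \<exists>c\<^sub>1::real. \<forall>G\<in>\<G>.
      ereal_of_enat (crossing_number G) \<le> ereal (c\<^sub>1 * real (card (pverts G)))"
    and "cond2 \<equiv> \<exists>c\<^sub>2::real. \<forall>G\<in>\<G>. \<exists>(D :: nat pair_pre_digraph) bag.
      decomposition G D bag \<and> planar D \<and>
      real (decomp_width D bag) \<le> c\<^sub>2 \<and> decomp_order D \<le> card (pverts G)"
    and "cond3 \<equiv> \<exists>c\<^sub>3::real. \<forall>G\<in>\<G>. \<exists>(D :: nat pair_pre_digraph) bag.
      decomposition G D bag \<and> planar D \<and>
      decomp_width D bag \<le> 2 \<and> real (decomp_order D) \<le> c\<^sub>3 * real (card (pverts G))"
  shows "(cond1 \<longleftrightarrow> cond2) \<and> (cond2 \<longleftrightarrow> cond3)"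
proof -
  let ?\<Delta> = "nat \<Delta>"
  have deg: "max_degree G \<le> ?\<Delta>" if "G \<in> \<G>" for G using assms(2)[OF that] by linarith
  have nat_bound: "\<exists>c. \<forall>G\<in>\<G>. crossing_number G \<le> enat (c * card (pverts G))" if h: cond1
  proof -
    obtain r where r: "\<And>G. G \<in> \<G> \<Longrightarrow> ereal_of_enat (crossing_number G) \<le> ereal (r * real (card (pverts G)))"
      using h unfolding cond1_def by blast
    \<comment> \<open>Rounding up and truncating at 0 turns the real constant, which may be
      negative, into a natural number that is no smaller.\<close>
    have "crossing_number G \<le> enat (nat \<lceil>r\<rceil> * card (pverts G))" if "G \<in> \<G>" for G
    proof -
      have "r * real (card (pverts G)) \<le> real (nat \<lceil>r\<rceil>) * real (card (pverts G))"
        by (intro mult_right_mono real_nat_ceiling_ge) auto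
      then have "ereal_of_enat (crossing_number G) \<le> ereal (real (nat \<lceil>r\<rceil> * card (pverts G)))"
        using r[OF that] by (metis ereal_less_eq(3) of_nat_mult order_trans)
      then have "ereal_of_enat (crossing_number G) \<le> ereal_of_enat (enat (nat \<lceil>r\<rceil> * card (pverts G)))" by simp
      then show ?thesis by (simp only: ereal_of_enat_le_iff)
    qed
    then show ?thesis by blast
  qed
  have cond1I: cond1 if c: "\<And>G. G \<in> \<G> \<Longrightarrow> crossing_number G \<le> enat (m G)" "\<And>G. G \<in> \<G> \<Longrightarrow> real (m G) \<le> r * real (card (pverts G))" for m r
  proof -
    have "ereal_of_enat (crossing_number G) \<le> ereal (r * real (card (pverts G)))" if "G \<in> \<G>" for G
    proof -
      have "ereal_of_enat (crossing_number G) \<le> ereal_of_enat (enat (m G))" using c(1)[OF that] by (simp only: ereal_of_enat_le_iff)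
      also have "\<dots> = ereal (real (m G))" by simp
      also have "\<dots> \<le> ereal (r * real (card (pverts G)))" using c(2)[OF that] by simp
      finally show ?thesis .
    qed
    then show ?thesis unfolding cond1_def by blast
  qed
  have 12: cond2 if h: cond1
  proof -
    obtain c where c: "\<And>G. G \<in> \<G> \<Longrightarrow> crossing_number G \<le> enat (c * card (pverts G))" using nat_bound[OF h] by blast
    define s where "s = 2 * (1 + c)"
    define K where "K = (2 * s + 2 * s * (2 * (?\<Delta> + 2)) * s) * 2"
    have "\<exists>(D :: nat pair_pre_digraph) bag. decomposition G D bag \<and> planar D \<and>
      real (decomp_width D bag) \<le> real K \<and> decomp_order D \<le> card (pverts G)" if "G \<in> \<G>" for G
      using small_order_decomposition[OF assms(1)[OF that] deg[OF that] c[OF that] s_def K_def] by simp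
    then show ?thesis unfolding cond2_def by blast
  qed
  have 13: cond3 if h: cond1
  proof -
    obtain c where c: "\<And>G. G \<in> \<G> \<Longrightarrow> crossing_number G \<le> enat (c * card (pverts G))" using nat_bound[OF h] by blast
    have "\<exists>(D :: nat pair_pre_digraph) bag. decomposition G D bag \<and> planar D \<and>
      decomp_width D bag \<le> 2 \<and> real (decomp_order D) \<le> real (1 + c) * real (card (pverts G))" if "G \<in> \<G>" for G
      using width_two_decomposition[OF assms(1)[OF that] c[OF that]] unfolding of_nat_mult[symmetric] of_nat_le_iff .
    then show ?thesis unfolding cond3_def by blast
  qed
  have 21: cond1 if h: cond2
  proof -
    obtain r where r: "\<And>G. G \<in> \<G> \<Longrightarrow> \<exists>(D :: nat pair_pre_digraph) bag. decomposition G D bag \<and> planar D \<and>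
      real (decomp_width D bag) \<le> r \<and> decomp_order D \<le> card (pverts G)" using h unfolding cond2_def by blast
    let ?C = "(2 * (nat \<lceil>r\<rceil> * ?\<Delta>))\<^sup>2"
    have "crossing_number G \<le> enat (card (pverts G) * ?C)" if G: "G \<in> \<G>" for G
    proof -
      obtain D :: "nat pair_pre_digraph" and bag where D: "decomposition G D bag" "planar D"
        "real (decomp_width D bag) \<le> r" "decomp_order D \<le> card (pverts G)" using r[OF G] by blast
      have "decomp_width D bag \<le> nat \<lceil>r\<rceil>" using D(3) real_nat_ceiling_ge[of r] by linarith
      from decomposition_crossing_number[OF assms(1)[OF G] D(1,2) this deg[OF G]]
      have "crossing_number G \<le> enat (decomp_order D * ?C)" .
      also have "\<dots> \<le> enat (card (pverts G) * ?C)" using D(4) by simp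
      finally show ?thesis .
    qed
    then show ?thesis by (rule cond1I[where r = "real ?C"]) (simp_all add: mult.commute)
  qed
  have 31: cond1 if h: cond3
  proof -
    obtain r where r: "\<And>G. G \<in> \<G> \<Longrightarrow> \<exists>(D :: nat pair_pre_digraph) bag. decomposition G D bag \<and> planar D \<and>
      decomp_width D bag \<le> 2 \<and> real (decomp_order D) \<le> r * real (card (pverts G))" using h unfolding cond3_def by blast
    let ?C = "(2 * (2 * ?\<Delta>))\<^sup>2" and ?r = "nat \<lceil>r\<rceil>"
    have "crossing_number G \<le> enat (?r * card (pverts G) * ?C)" if G: "G \<in> \<G>" for G
    proof -
      obtain D :: "nat pair_pre_digraph" and bag where D: "decomposition G D bag" "planar D"
        "decomp_width D bag \<le> 2" "real (decomp_order D) \<le> r * real (card (pverts G))" using r[OF G] by blast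
      from decomposition_crossing_number[OF assms(1)[OF G] D(1-3) deg[OF G]]
      have "crossing_number G \<le> enat (decomp_order D * ?C)" .
      also have "r * real (card (pverts G)) \<le> real ?r * real (card (pverts G))"
        by (intro mult_right_mono real_nat_ceiling_ge) auto
      then have "real (decomp_order D) \<le> real (?r * card (pverts G))" using D(4) by simp
      then have "decomp_order D \<le> ?r * card (pverts G)" by (simp only: of_nat_le_iff)
      then have "enat (decomp_order D * ?C) \<le> enat (?r * card (pverts G) * ?C)"
        unfolding enat_ord_simps(1) by (rule mult_le_mono1)
      finally show ?thesis .
    qed
    then show ?thesis by (rule cond1I[where r = "real (?r * ?C)"]) (simp_all add: mult_ac)
  qed
  show ?thesis using 12 13 21 31 by blast
qed

end
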